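(* Fix an integer $n\ge 1$ and a real $\varepsilon>0$. Define $\eta_1(\varepsilon)=\eta_2(\varepsilon)=\frac{7}{27}\varepsilon$ and, recursively for $n\ge 3$, $$\eta_n(\varepsilon)=\frac{7\varepsilon}{18\,\kappa_n(\varepsilon)},\qquad \kappa_n(\varepsilon)=\left\lceil \frac{n-2-7\varepsilon/3}{2\eta_{n-1}(\varepsilon)}+3\right\rceil .$$ Then there is a constant $C>0$ depending only on $n$ and $\varepsilon$ such that for every prime $p$, every polynomial $f\in\mathbb{F}_p[X]$ of degree $n$, and every subgroup $\mathcal{G}\subseteq\mathbb{F}_p^*$ of order $\tau\ge p^{3/7+\varepsilon}$, we have $$\Big|\sum_{x\in\mathcal{G}} \mathbf{e}_p(f(x))\Big| \le C\,\tau\, p^{-\eta_n(\varepsilon)}.$$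
   Context: For a prime $p$, $\mathbb{F}_p$ is the field with $p$ elements, whose elements are represented by the integers $\{0,\dots,p-1\}$, and $\mathbf{e}_p(z)=\exp(2\pi i z/p)$. *)

theory Defs
  imports Complex_Main "HOL-Number_Theory.Residues" "HOL-Algebra.Polynomial_Divisibility"
begin

abbreviation Fp :: "nat \<Rightarrow> int ring" where
  "Fp p \<equiv> residue_ring (int p)"

definition e_p :: "nat \<Rightarrow> int \<Rightarrow> complex" where
  "e_p p z = exp (2 * complex_of_real pi * \<i> * of_int z / of_nat p)"

text \<open>
  The exponents are only meaningful for indices \<open>n \<ge> 1\<close> (\<open>eta\<close>) and \<open>n \<ge> 3\<close> (\<open>kappa\<close>);
  the values at smaller indices are never used. If \<open>kappa \<epsilon> n \<le> 0\<close> for some \<open>n \<ge> 3\<close>, then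
  \<open>\<epsilon>\<close> is so large (\<open>\<epsilon> \<ge> 4/7\<close>) that no subgroup of \<open>F\<^sub>p\<^sup>*\<close> has order at least
  \<open>p\<close> to the power \<open>3/7 + \<epsilon>\<close>, so the convention \<open>x / 0 = 0\<close> plays no role.
\<close>

function (sequential) eta :: "real \<Rightarrow> nat \<Rightarrow> real" and kappa :: "real \<Rightarrow> nat \<Rightarrow> int" where
  "eta \<epsilon> n = (if n \<le> 2 then 7 / 27 * \<epsilon> else 7 * \<epsilon> / (18 * of_int (kappa \<epsilon> n)))"
| "kappa \<epsilon> 0 = 0"
| "kappa \<epsilon> (Suc m) =
     \<lceil>(real (Suc m) - 2 - 7 * \<epsilon> / 3) / (2 * eta \<epsilon> m) + 3\<rceil>"
  by pat_completeness auto
termination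
  by (relation "measure (case_sum (\<lambda>(\<epsilon>, n). 2 * n + 1) (\<lambda>(\<epsilon>, n). 2 * n))") auto

declare eta.simps [simp del] kappa.simps [simp del]

lemma eta_1_2: "eta \<epsilon> 1 = 7 / 27 * \<epsilon>" "eta \<epsilon> 2 = 7 / 27 * \<epsilon>"
  by (simp_all add: eta.simps)

lemma eta_rec: "n \<ge> 3 \<Longrightarrow> eta \<epsilon> n = 7 * \<epsilon> / (18 * of_int (kappa \<epsilon> n))"
  by (simp add: eta.simps)

lemma kappa_rec:
  "n \<ge> 3 \<Longrightarrow> kappa \<epsilon> n = \<lceil>(real n - 2 - 7 * \<epsilon> / 3) / (2 * eta \<epsilon> (n - 1)) + 3\<rceil>"
  by (cases n) (simp_all add: kappa.simps)

end

theory Submission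
  imports Defs "Berlekamp_Zassenhaus.Finite_Field" "HOL-Analysis.Complex_Transcendental"
begin

text \<open>
  The \<open>2 k\<close>-th moment of the sums \<open>S\<close> with exponents in \<open>J\<close>, taken over all coefficient vectors,
  counts the solutions in \<open>G\<close> of \<open>x\<^sub>1\<^sup>j + \<dots> + x\<^sub>k\<^sup>j = y\<^sub>1\<^sup>j + \<dots> + y\<^sub>k\<^sup>j\<close>, \<open>j \<in> J\<close>. Substituting \<open>x := u x\<close> and
  averaging over \<open>u \<in> G\<close> turns \<open>S\<^sup>k\<close> into a bilinear sum, which Hoelder's inequality bounds by two
  such counts. For \<open>k \<le> 3\<close> the counts reduce to the number of points \<open>(x, y) \<in> G \<times> G\<close> on a plane
  curve, which Stepanov's method bounds by \<open>O(\<bar>G\<bar>\<^bsup>2/3\<^esup>)\<close>; this settles at most two exponents. For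
  more exponents, drop the leading one: the bound for degree \<open>n - 1\<close> controls the counts for large
  \<open>k = kappa \<epsilon> n\<close>, and the bilinear estimate then gives the bound for degree \<open>n\<close>.
\<close>

section \<open>Bivariate polynomials\<close>

text \<open>In \<open>'k poly poly\<close> the outer variable is \<open>x\<close> and the coefficients are polynomials in \<open>y\<close>.\<close>

hide_const (open) Divisibility.prime

text \<open>Write |G| = P^t and count exponents of P. For two exponents in J and k = 3, the counts
  of size P^(11 t / 3) and the P^2 coefficient vectors leave a saving eta with 18 eta <= 14 t / 3 -
  2. The right side is positive exactly for t > 3/7, and at t = 3/7 + \<epsilon> it permits eta = 7
  \<epsilon> / 27. For larger J this direct route fails near t = 3/7, since the factor P^(card J)
  grows. Hence \<open>kappa\<close>: it is a k at which, by the bound in degree n - 1, the nonzero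
  coefficient vectors add to the 2k-th moment no more than the order of the zero vector. Restoring
  the dropped exponent then costs one factor P, the count for three variables gains P^(7 t / 3), and
  7 t / 3 - 1 >= 7 \<epsilon> / 3, spread over the power 6 k of the sum, is 7 \<epsilon> / (18 k).
  The delicate point of Stepanov's method is that the auxiliary polynomial must not vanish on the
  curve. In characteristic p this rests on sparsity and on degrees below p, which is where the
  restriction |G|^(4/3) <= p arises.\<close>

definition bibox :: "nat \<Rightarrow> nat \<Rightarrow> 'k::zero poly poly set" where
  "bibox a b = {P. \<forall>i j. coeff (coeff P i) j \<noteq> 0 \<longrightarrow> i < a \<and> j < b}"

lemma bibox_zero [simp]: "0 \<in> bibox a b"
  by (simp add: bibox_def)

lemma bibox_mono: "P \<in> bibox a b \<Longrightarrow> a \<le> a' \<Longrightarrow> b \<le> b' \<Longrightarrow> P \<in> bibox a' b'"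
  unfolding bibox_def by fastforce

lemma bibox_add: "P \<in> bibox a b \<Longrightarrow> Q \<in> bibox a b \<Longrightarrow> P + Q \<in> bibox a (b :: nat)"
  for P Q :: "'k::comm_ring_1 poly poly"
  unfolding bibox_def by (auto, (metis add_0)+)

lemma bibox_diff: "P \<in> bibox a b \<Longrightarrow> Q \<in> bibox a b \<Longrightarrow> P - Q \<in> bibox a (b :: nat)"
  for P Q :: "'k::comm_ring_1 poly poly"
  unfolding bibox_def by (auto, (metis diff_0_right)+)

lemma bibox_mult:
  fixes P Q :: "'k::comm_ring_1 poly poly"
  assumes "P \<in> bibox a b" "Q \<in> bibox c d"
  shows "P * Q \<in> bibox (a + c - 1) (b + d - 1)"
proof -
  have "i < a + c - 1 \<and> j < b + d - 1" if nz: "coeff (coeff (P * Q) i) j \<noteq> 0" for i j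
  proof -
    have "coeff (coeff (P * Q) i) j
        = (\<Sum>l\<le>i. \<Sum>m\<le>j. coeff (coeff P l) m * coeff (coeff Q (i - l)) (j - m))"
      by (simp add: coeff_mult coeff_sum)
    with nz obtain l m where "l \<le> i" "m \<le> j" "coeff (coeff P l) m * coeff (coeff Q (i - l)) (j - m) \<noteq> 0"
      by (metis (no_types, lifting) atMost_iff sum.not_neutral_contains_not_neutral)
    then have "l < a" "m < b" "i - l < c" "j - m < d"
      using assms unfolding bibox_def by (auto, (metis mult_zero_left mult_zero_right)+)
    then show ?thesis
      using \<open>l \<le> i\<close> \<open>m \<le> j\<close> by linarith
  qed
  then show ?thesis
    unfolding bibox_def by blast
qed

lemma bibox_sum:
  fixes f :: "'a \<Rightarrow> 'k::comm_ring_1 poly poly"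
  shows "(\<And>i. i \<in> I \<Longrightarrow> f i \<in> bibox a b) \<Longrightarrow> sum f I \<in> bibox a b"
  by (induction I rule: infinite_finite_induct) (auto intro: bibox_add)

lemma bibox_degree: "P \<in> bibox a b \<Longrightarrow> P \<noteq> 0 \<Longrightarrow> degree P < a"
  unfolding bibox_def
  by simp (metis leading_coeff_0_iff)

lemma bibox_degree_coeff: "P \<in> bibox a b \<Longrightarrow> coeff P i \<noteq> 0 \<Longrightarrow> degree (coeff P i) < b"
  unfolding bibox_def
  by simp (metis leading_coeff_0_iff)

lemma bibox_I: "(\<And>i. degree (coeff P i) < b) \<Longrightarrow> degree P < a \<Longrightarrow> P \<in> bibox a b"
  unfolding bibox_def
  by auto (metis coeff_0 le_degree linorder_not_less order_le_less_trans,
    meson le_degree order_le_less_trans)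

definition bibox_poly :: "nat \<Rightarrow> nat \<Rightarrow> (nat \<times> nat \<Rightarrow> 'k::comm_ring_1) \<Rightarrow> 'k poly poly" where
  "bibox_poly a b f = (\<Sum>i<a. \<Sum>j<b. monom (monom (f (i, j)) j) i)"

lemma coeff_bibox_poly:
  "coeff (coeff (bibox_poly a b f) i) j = (if i < a \<and> j < b then f (i, j) else 0)"
proof -
  have "coeff (coeff (bibox_poly a b f) i) j
      = (\<Sum>i'<a. if i' = i then (\<Sum>j'<b. if j' = j then f (i', j') else 0) else 0)"
    unfolding bibox_poly_def coeff_sum by (intro sum.cong refl) (auto simp: coeff_sum intro!: sum.cong)
  then show ?thesis
    by simp
qed

lemma bij_betw_bibox:
  "bij_betw (bibox_poly a b) (({..<a} \<times> {..<b}) \<rightarrow>\<^sub>E (UNIV :: 'k::comm_ring_1 set)) (bibox a b)"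
proof (rule bij_betwI[where g = "\<lambda>P. \<lambda>(i, j)\<in>{..<a} \<times> {..<b}. coeff (coeff P i) j"])
  show "bibox_poly a b \<in> (({..<a} \<times> {..<b}) \<rightarrow>\<^sub>E (UNIV :: 'k set)) \<rightarrow> bibox a b"
    by (auto simp: bibox_def coeff_bibox_poly split: if_splits)
  show "(\<lambda>P. \<lambda>(i, j)\<in>{..<a} \<times> {..<b}. coeff (coeff P i) j) \<in> bibox a b \<rightarrow> (({..<a} \<times> {..<b}) \<rightarrow>\<^sub>E (UNIV :: 'k set))"
    by auto
  show "(\<lambda>(i, j)\<in>{..<a} \<times> {..<b}. coeff (coeff (bibox_poly a b f) i) j) = f"
    if "f \<in> (({..<a} \<times> {..<b}) \<rightarrow>\<^sub>E (UNIV :: 'k set))" for f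
    using that by (auto simp: fun_eq_iff coeff_bibox_poly PiE_def extensional_def)
  show "bibox_poly a b (\<lambda>(i, j)\<in>{..<a} \<times> {..<b}. coeff (coeff P i) j) = P"
    if "P \<in> bibox a b" for P :: "'k poly poly"
    using that by (auto simp: poly_eq_iff coeff_bibox_poly bibox_def)
qed

lemma finite_bibox [simp]: "finite (bibox a b :: 'k::{finite,comm_ring_1} poly poly set)"
proof -
  have "finite (({..<a} \<times> {..<b}) \<rightarrow>\<^sub>E (UNIV :: 'k set))"
    by (intro finite_PiE) auto
  then show ?thesis
    using bij_betw_finite[OF bij_betw_bibox] by blast
qed

text \<open>Over a finite field cardinalities stand in for dimensions: more unknowns than linear
  equations means a larger finite set, and the pigeonhole principle supplies a nonzero
  solution.\<close>

lemma card_bibox: "card (bibox a b :: 'k::{finite,comm_ring_1} poly poly set) = CARD('k) ^ (a * b)"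
  using bij_betw_same_card[OF bij_betw_bibox[where ?'k = 'k, of a b]] by (simp add: card_PiE)

lemma poly_shift_bibox: "P \<in> bibox a b \<Longrightarrow> poly_shift 1 P \<in> bibox (a - 1) b"
proof -
  assume P: "P \<in> bibox a b"
  have "i < a - 1 \<and> j < b" if "coeff (coeff (poly_shift 1 P) i) j \<noteq> 0" for i j
  proof -
    have "i + 1 < a \<and> j < b"
      using P that unfolding bibox_def by (simp add: coeff_poly_shift)
    then show ?thesis by arith
  qed
  then show ?thesis
    unfolding bibox_def by blast
qed

lemma bibox_dvd_eq_0:
  fixes P H :: "'k::idom poly poly"
  assumes "P \<in> bibox (degree H) b" "H dvd P"
  shows "P = 0"
  by (meson assms bibox_degree dvd_imp_degree_le linorder_not_less)

section \<open>Polynomials in y alone and the elimination of x\<close>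

definition lift_y :: "'k::comm_ring_1 poly \<Rightarrow> 'k poly poly" where
  "lift_y R = [:R:]"

lemma lift_y_0 [simp]: "lift_y 0 = 0"
  by (simp add: lift_y_def)

lemma lift_y_1 [simp]: "lift_y 1 = 1"
  by (simp add: lift_y_def one_pCons)

lemma lift_y_eq_0_iff [simp]: "lift_y R = 0 \<longleftrightarrow> R = 0"
  by (simp add: lift_y_def)

lemma lift_y_add: "lift_y (R + S) = lift_y R + lift_y S"
  by (simp add: lift_y_def)

lemma lift_y_mult: "lift_y (R * S) = lift_y R * lift_y S"
  by (simp add: lift_y_def)

lemma degree_lift_y [simp]: "degree (lift_y R) = 0"
  by (simp add: lift_y_def)

lemma coeff_lift_y_mult: "coeff (lift_y R * P) i = R * coeff P i"
  by (simp add: lift_y_def)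

text \<open>A dimension count for the Sylvester system, which also bounds the degree of \<open>R\<close>.\<close>

lemma elimination:
  fixes H \<Phi> :: "'k::{finite,field} poly poly"
  assumes H: "prime_elem H" "H \<in> bibox (degree H + 1) (d + 1)" "degree H \<ge> 1"
    and \<Phi>: "\<Phi> \<in> bibox Dx Dy" "Dx \<ge> 1" "Dy \<ge> 1" "\<not> H dvd \<Phi>"
    and T: "T > degree H * (Dy - 1) + (Dx - 1) * d"
  shows "\<exists>u v R. u * H + v * \<Phi> = lift_y R \<and> R \<noteq> 0 \<and> degree R < T"
proof -
  define e where "e = degree H"
  define A where "A = (bibox (Dx - 1) (T - d) :: 'k poly poly set) \<times> (bibox e (T + 1 - Dy) :: 'k poly poly set)"
  define f where "f = (\<lambda>(u, v). u * H + v * \<Phi>)"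
  have e: "e \<ge> 1" and T': "T > e * (Dy - 1) + (Dx - 1) * d"
    using H T by (auto simp: e_def)
  have "1 * (Dy - 1) \<le> e * (Dy - 1)"
    using e by (intro mult_right_mono) auto
  then have TDy: "T \<ge> Dy"
    using T' \<Phi> by linarith
  have Td: "T \<ge> d" if "Dx \<ge> 2"
  proof -
    have "1 * d \<le> (Dx - 1) * d"
      using that by (intro mult_right_mono) auto
    then show ?thesis
      using T' by linarith
  qed
  have fbox: "f w \<in> bibox (e + Dx - 1) T" if w: "w \<in> A" for w
  proof -
    obtain u v where [simp]: "w = (u, v)" and u: "u \<in> bibox (Dx - 1) (T - d)" and v: "v \<in> bibox e (T + 1 - Dy)"
      using w unfolding A_def by (cases w) auto
    have "u * H \<in> bibox (e + Dx - 1) T"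
    proof (cases "Dx \<ge> 2")
      case True
      show ?thesis
        using bibox_mult[OF u H(2)] by (rule bibox_mono) (use Td[OF True] True in \<open>auto simp: e_def\<close>)
    next
      \<comment> \<open>Here Dx = 1: the box for \<open>u\<close> contains only 0, and
        \<open>T - d\<close> may be a truncated subtraction.\<close>
      case False
      then have "u = 0"
        using u \<open>Dx \<ge> 1\<close> by (auto simp: bibox_def poly_eq_iff)
      then show ?thesis by simp
    qed
    moreover have "v * \<Phi> \<in> bibox (e + Dx - 1) T"
      using bibox_mult[OF v \<Phi>(1)] by (rule bibox_mono) (use TDy \<Phi> in auto)
    ultimately show ?thesis
      by (auto simp: f_def intro: bibox_add)
  qed
  have cA: "card A = CARD('k) ^ ((Dx - 1) * (T - d) + e * (T + 1 - Dy))"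
    by (simp add: A_def card_cartesian_product card_bibox power_add)
  \<comment> \<open>The equations are the coefficients of x^1, ..., x^(e + Dx - 2) of u H + v
    \<Phi>. Unknowns minus equations is T - e (Dy - 1) - (Dx - 1) d, positive by the assumption on
    T.\<close>
  have "(e + Dx - 2) * T < (Dx - 1) * (T - d) + e * (T + 1 - Dy)"
  proof -
    have 1: "(Dx - 1) * (T - d) + (Dx - 1) * d = (Dx - 1) * T"
      using Td by (cases "Dx \<ge> 2") (simp_all flip: distrib_left)
    have "T + 1 - Dy + (Dy - 1) = T"
      using \<Phi> TDy by simp
    then have 2: "e * (T + 1 - Dy) + e * (Dy - 1) = e * T"
      by (metis distrib_left)
    have "e + Dx - 2 = (e - 1) + (Dx - 1)"
      using e \<Phi> by simp
    then have 3: "(e + Dx - 2) * T = (e - 1) * T + (Dx - 1) * T"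
      by (metis distrib_right)
    have 4: "e * T = (e - 1) * T + T"
      using e by (metis Suc_eq_plus1 add.commute le_add_diff_inverse mult_Suc)
    have "\<And>p q r s t u v w :: nat. p + r = s \<Longrightarrow> q + t = u \<Longrightarrow> w = v + s \<Longrightarrow> u = v + T \<Longrightarrow>
        t + r < T \<Longrightarrow> w < p + q"
      by linarith
    from this[OF 1 2 3 4 T'] show ?thesis .
  qed
  moreover have "CARD('k) > 1"
    using card_mono[of UNIV "{0, 1 :: 'k}"] by simp
  ultimately have "card (bibox (e + Dx - 2) T :: 'k poly poly set) < card A"
    unfolding cA card_bibox by (intro power_strict_increasing) auto
  \<comment> \<open>\<open>poly_shift 1\<close> discards the coefficient of x^0, so two arguments
    with the same image differ by a pair whose combination is constant in x.\<close>
  moreover have "(\<lambda>w. poly_shift 1 (f w)) ` A \<subseteq> bibox (e + Dx - 2) T"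
    using poly_shift_bibox[OF fbox] by (auto simp: numeral_2_eq_2)
  ultimately have "\<not> inj_on (\<lambda>w. poly_shift 1 (f w)) A"
    by (metis card_inj_on_le finite_bibox linorder_not_less)
  then obtain w1 w2 where w: "w1 \<in> A" "w2 \<in> A" "w1 \<noteq> w2" "poly_shift 1 (f w1) = poly_shift 1 (f w2)"
    by (auto simp: inj_on_def)
  define u v where "u = fst w1 - fst w2" and "v = snd w1 - snd w2"
  define P where "P = u * H + v * \<Phi>"
  have P: "P = f w1 - f w2"
    by (auto simp: P_def u_def v_def f_def algebra_simps split: prod.splits)
  have "coeff P (Suc i) = 0" for i
    using arg_cong[OF w(4), of "\<lambda>p. coeff p i"] by (simp add: P coeff_poly_shift)
  then have "degree P = 0"
    by (metis Suc_pred degree_0 bot_nat_0.not_eq_extremum leading_coeff_0_iff)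
  then obtain R where PR: "P = [:R:]"
    by (rule degree_eq_zeroE)
  have "v \<in> bibox e (T + 1 - Dy)"
    using w unfolding v_def A_def by (auto intro!: bibox_diff)
  \<comment> \<open>If the combination vanished, the prime H would divide v, whose degree in x is
    below that of H.\<close>
  have "P \<noteq> 0"
  proof
    assume "P = 0"
    then have "v * \<Phi> = H * (- u)"
      unfolding P_def by (metis add_eq_0_iff minus_mult_right mult.commute)
    then have "H dvd v"
      using H(1) \<Phi>(4) prime_elem_dvd_mult_iff by (metis dvd_triv_left)
    then have "v = 0"
      using bibox_dvd_eq_0 \<open>v \<in> bibox e (T + 1 - Dy)\<close> by (auto simp: e_def)
    then have "u = 0"
      using \<open>P = 0\<close> H(3) by (auto simp: P_def)
    then have "fst w1 = fst w2" "snd w1 = snd w2"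
      using \<open>v = 0\<close> unfolding u_def v_def by simp_all
    then show False
      using w(3) by (simp add: prod_eq_iff)
  qed
  then have "R \<noteq> 0"
    using PR by fastforce
  have "P \<in> bibox (e + Dx - 1) T"
    using bibox_diff[OF fbox[OF w(1)] fbox[OF w(2)]] P by simp
  then have "degree R < T"
    using bibox_degree_coeff[of P "e + Dx - 1" T 0] \<open>R \<noteq> 0\<close> by (simp add: PR)
  then show ?thesis
    using PR \<open>R \<noteq> 0\<close> unfolding P_def lift_y_def by blast
qed

section \<open>Derivations along a curve\<close>

abbreviation dY :: "'k::idom poly poly \<Rightarrow> 'k poly poly" where
  "dY \<equiv> map_poly pderiv"

lemma dY_add [simp]: "dY (P + Q) = dY P + dY Q"
  by (rule poly_eqI) (simp add: coeff_map_poly pderiv_add)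

lemma dY_mult: "dY (P * Q) = P * dY Q + dY P * Q"
proof (rule poly_eqI)
  fix n
  have "coeff (dY (P * Q)) n = (\<Sum>i\<le>n. pderiv (coeff P i * coeff Q (n - i)))"
    by (simp add: coeff_map_poly coeff_mult pderiv_sum)
  also have "\<dots> = (\<Sum>i\<le>n. coeff P i * pderiv (coeff Q (n - i)))
      + (\<Sum>i\<le>n. pderiv (coeff P i) * coeff Q (n - i))"
    by (simp add: pderiv_mult sum.distrib mult.commute)
  also have "\<dots> = coeff (P * dY Q + dY P * Q) n"
    by (simp add: coeff_map_poly coeff_mult)
  finally show "coeff (dY (P * Q)) n = coeff (P * dY Q + dY P * Q) n" .
qed

lemma dY_const [simp]: "dY (lift_y R) = lift_y (pderiv R)"
  by (rule poly_eqI) (simp add: lift_y_def coeff_map_poly coeff_pCons split: nat.splits)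

lemma pderiv_lift_y [simp]: "pderiv (lift_y R) = 0"
  by (simp add: lift_y_def)

text \<open>The Jacobian of W and H: differentiation along the vector field (H_y, -H_x), which is
  tangent to the curve H = 0. This is implicit differentiation cleared of denominators.\<close>

definition deriv_along :: "'k::idom poly poly \<Rightarrow> 'k poly poly \<Rightarrow> 'k poly poly" where
  "deriv_along H W = dY H * pderiv W - pderiv H * dY W"

lemma deriv_along_add: "deriv_along H (V + W) = deriv_along H V + deriv_along H W"
  by (simp add: deriv_along_def pderiv_add algebra_simps)

lemma deriv_along_mult: "deriv_along H (V * W) = V * deriv_along H W + deriv_along H V * W"
  by (simp add: deriv_along_def pderiv_mult dY_mult algebra_simps)

lemma deriv_along_self [simp]: "deriv_along H H = 0"
  by (simp add: deriv_along_def mult.commute)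

lemma deriv_along_const: "deriv_along H (lift_y R) = - (pderiv H * (lift_y (pderiv R)))"
  by (simp add: deriv_along_def)

lemma dvd_deriv_along: "H dvd W \<Longrightarrow> H dvd deriv_along H W"
  by (auto simp: deriv_along_mult elim!: dvdE)

section \<open>Lifting and specialising one variable\<close>

definition lift_x :: "'k::comm_ring_1 poly \<Rightarrow> 'k poly poly" where
  "lift_x g = map_poly (\<lambda>c. [:c:]) g"

lemma coeff_lift_x: "coeff (lift_x g) i = [:coeff g i:]"
  by (simp add: lift_x_def coeff_map_poly)

lemma lift_x_0 [simp]: "lift_x 0 = 0"
  by (simp add: lift_x_def)

lemma lift_x_1 [simp]: "lift_x 1 = 1"
  by (simp add: lift_x_def one_pCons)

lemma lift_x_add: "lift_x (f + g) = lift_x f + lift_x g"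
  by (rule poly_eqI) (simp add: coeff_lift_x)

lemma lift_x_diff: "lift_x (f - g) = lift_x f - lift_x g"
  by (rule poly_eqI) (simp add: coeff_lift_x)

lemma sum_const_poly: "(\<Sum>i\<in>A. [:f i:]) = [:\<Sum>i\<in>A. f i:]"
  by (induction A rule: infinite_finite_induct) auto

lemma lift_x_mult: "lift_x (f * g) = lift_x f * lift_x g"
  by (rule poly_eqI) (simp add: coeff_lift_x coeff_mult sum_const_poly mult.commute)

lemma pderiv_lift_x: "pderiv (lift_x g) = lift_x (pderiv g)" for g :: "'k::idom poly"
  by (rule poly_eqI) (simp add: coeff_lift_x coeff_pderiv of_nat_poly)

lemma dY_lift_x [simp]: "dY (lift_x g) = 0" for g :: "'k::idom poly"
  by (rule poly_eqI) (simp add: coeff_lift_x coeff_map_poly pderiv_pCons)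

lemma lift_x_smult: "lift_x (smult c g) = lift_y [:c:] * lift_x g"
  by (rule poly_eqI) (simp add: coeff_lift_x coeff_lift_y_mult)

definition eval_y :: "'k::comm_ring_1 \<Rightarrow> 'k poly poly \<Rightarrow> 'k poly" where
  "eval_y y P = map_poly (\<lambda>q. poly q y) P"

lemma coeff_eval_y: "coeff (eval_y y P) i = poly (coeff P i) y"
  by (simp add: eval_y_def coeff_map_poly)

lemma eval_y_0 [simp]: "eval_y y 0 = 0"
  by (simp add: eval_y_def)

lemma eval_y_add: "eval_y y (P + Q) = eval_y y P + eval_y y Q"
  by (rule poly_eqI) (simp add: coeff_eval_y)

lemma eval_y_mult: "eval_y y (P * Q) = eval_y y P * eval_y y Q"
  by (rule poly_eqI) (simp add: coeff_eval_y coeff_mult poly_sum)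

lemma eval_y_lift_x [simp]: "eval_y y (lift_x g) = g"
  by (rule poly_eqI) (simp add: coeff_eval_y coeff_lift_x)

lemma eval_y_const [simp]: "eval_y y (lift_y R) = [:poly R y:]"
  by (rule poly_eqI) (simp add: lift_y_def coeff_eval_y coeff_pCons split: nat.splits)

abbreviation y_pow :: "nat \<Rightarrow> 'k::comm_ring_1 poly poly" where
  "y_pow s \<equiv> lift_y (monom 1 s)"

lemma y_pow_add: "y_pow (a + b) = y_pow a * y_pow b"
  by (simp add: mult_monom flip: lift_y_mult)

lemma not_dvd_lift_y:
  fixes H :: "'k::idom poly poly"
  assumes "degree H \<ge> 1" "R \<noteq> 0"
  shows "\<not> H dvd lift_y R"
  using assms dvd_imp_degree_le[of H "lift_y R"] by auto

text \<open>A power series with nonzero constant term is a unit; truncated at y^s, its inverse comes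
  from Bezout's identity, because \<rho> is coprime to y.\<close>

lemma inverse_mod_y_power:
  fixes \<rho> :: "'k::field_gcd poly"
  assumes "poly \<rho> 0 \<noteq> 0"
  shows "\<exists>\<sigma> \<zeta>. \<rho> * \<sigma> = 1 + monom 1 s * \<zeta>"
proof -
  have "coprime \<rho> (monom 1 s)"
  proof -
    have "coprime \<rho> (monom 1 1)"
    proof (rule ccontr)
      assume "\<not> coprime \<rho> (monom 1 1)"
      moreover have "prime_elem (monom 1 1 :: 'k poly)"
        using prime_elem_linear_field_poly[of "1 :: 'k" 0] by (simp add: monom_altdef)
      ultimately have "monom 1 1 dvd \<rho>"
        using prime_elem_imp_coprime coprime_commute by blast
      then show False
        using assms by (auto simp: poly_monom elim!: dvdE)
    qed
    then have "coprime \<rho> (monom 1 1 ^ s)"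
      by simp
    then show ?thesis
      by (simp add: monom_power)
  qed
  then obtain a b where "a * \<rho> + b * monom 1 s = 1"
    using bezout_coefficients_fst_snd[of \<rho> "monom 1 s"] by (metis coprime_iff_gcd_eq_1)
  then have "\<rho> * a = 1 + monom 1 s * (- b)"
    by (metis add_diff_cancel_right' diff_conv_add_uminus mult.commute mult_minus_right)
  then show ?thesis
    by blast
qed

lemma of_nat_neq_CHAR:
  assumes "m < CHAR('k::idom)" "n < CHAR('k)" "m \<noteq> n"
  shows "(of_nat m :: 'k) \<noteq> of_nat n"
  using assms of_nat_eq_iff_cong_CHAR[where ?'a = 'k] cong_less_modulus_unique_nat by blast

text \<open>
  One term of the sparse polynomial \<open>g\<close> is removed by the Euler operator \<open>x d/dx - e\<close>, lifted to the
  derivation \<open>x (H\<^sub>y \<partial>\<^sub>x - H\<^sub>x \<partial>\<^sub>y)\<close>, which preserves the ideal \<open>(H)\<close>. Dividing by \<open>H\<^sub>y\<close> modulo \<open>H\<close>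
  costs the power \<open>order 0 \<rho>\<close> of \<open>y\<close>.
\<close>

lemma sparse_not_vanishing:
  fixes H :: "'k::field_gcd poly poly"
  assumes H: "prime_elem H" and h: "degree (eval_y 0 H) \<ge> 1" "poly (eval_y 0 H) 0 \<noteq> 0"
    and \<rho>: "u * H + w * dY H = lift_y \<rho>" "\<rho> \<noteq> 0"
    and g: "g \<noteq> 0" "\<And>e. coeff g e \<noteq> 0 \<Longrightarrow> e < CHAR('k)"
    and dvd: "H dvd lift_x g + y_pow s * \<Psi>"
    and s: "s \<ge> 1 + (card {e. coeff g e \<noteq> 0} - 1) * (1 + order 0 \<rho>)"
  shows False
  using g dvd s
proof (induction "card {e. coeff g e \<noteq> 0}" arbitrary: g s \<Psi> rule: less_induct)
  case less
  define E where "E = {e. coeff g e \<noteq> 0}"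
  have finE: "finite E"
    unfolding E_def by (rule finite_subset[of _ "{..degree g}"]) (auto intro: le_degree)
  have "E \<noteq> {}"
    using less.prems(1) by (auto simp: E_def poly_eq_iff)
  then obtain e1 where e1: "e1 \<in> E" by auto
  have degH: "degree H \<ge> 1"
    using h(1) degree_map_poly_le[of "\<lambda>q. poly q 0" H] by (simp add: eval_y_def)
  have cardE: "card E \<ge> 1"
    using finE e1 by (metis One_nat_def Suc_leI card_gt_0_iff empty_iff)
  show False
  proof (cases "card E = 1")
    \<comment> \<open>One monomial is left. Modulo y, H(x, 0) divides c x^e1, yet it is coprime to x
      and not constant.\<close>
    case True
    then have "E = {e1}"
      using e1 by (metis card_1_singletonE singletonD)
    then have geq: "g = monom (coeff g e1) e1"
      by (auto simp: poly_eq_iff E_def)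
    obtain Q where "lift_x g + y_pow s * \<Psi> = H * Q"
      using less.prems(3) by (elim dvdE)
    then have "eval_y 0 (lift_x g + y_pow s * \<Psi>) = eval_y 0 H * eval_y 0 Q"
      by (simp add: eval_y_mult)
    moreover have "eval_y 0 (lift_x g + y_pow s * \<Psi>) = g"
      using less.prems(4) by (simp add: eval_y_add eval_y_mult poly_monom zero_power)
    ultimately have *: "eval_y 0 H dvd monom (coeff g e1) e1"
      using geq by (metis dvd_triv_left)
    have "coprime (eval_y 0 H) (monom 1 e1)"
    proof -
      obtain a b where "eval_y 0 H * a = 1 + monom 1 e1 * b"
        using inverse_mod_y_power[OF h(2)] by blast
      then have "1 = eval_y 0 H * a + monom 1 e1 * (- b)"
        by simp
      then show ?thesis
        by (metis coprimeI dvd_add dvd_mult2)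
    qed
    moreover have "eval_y 0 H dvd monom 1 e1"
    proof -
      have "coeff g e1 \<noteq> 0"
        using e1 by (simp add: E_def)
      then have "monom 1 e1 = smult (inverse (coeff g e1)) (monom (coeff g e1) e1)"
        by (simp add: smult_monom)
      then show ?thesis
        using * by (metis dvd_smult)
    qed
    ultimately have "is_unit (eval_y 0 H)"
      by (meson coprime_common_divisor dvd_refl)
    then show False
      using h(1) is_unit_poly_iff by fastforce
  next
    case False
    define v where "v = order 0 \<rho>"
    define s' where "s' = s - 1 - v"
    have c2: "card E \<ge> 2"
      using False cardE by simp
    have "1 + (card E - 1) * (1 + v) \<le> s"
      using less.prems(4) by (simp add: E_def v_def)
    moreover have "(card E - 1) * (1 + v) = (card E - 2) * (1 + v) + (1 + v)"
    proof -
      obtain k where k: "card E = 2 + k"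
        using c2 le_Suc_ex by blast
      show ?thesis
        unfolding k by simp
    qed
    ultimately have s': "s = 1 + v + s'" "s' \<ge> 1 + (card E - 2) * (1 + v)"
      by (auto simp: s'_def)
    define xx where "xx = (lift_x (monom 1 1) :: 'k poly poly)"
    define g1 where "g1 = monom 1 1 * pderiv g - smult (of_nat e1) g"
    have coeff_g1: "coeff g1 e = (of_nat e - of_nat e1) * coeff g e" for e
      by (cases e) (simp_all add: g1_def coeff_monom_mult coeff_pderiv left_diff_distrib)
    \<comment> \<open>All exponents lie below the characteristic, so e - e1 vanishes in the field
      only for e = e1: exactly one term disappears.\<close>
    have supp: "{e. coeff g1 e \<noteq> 0} = E - {e1}"
      using e1 less.prems(2) of_nat_neq_CHAR[where ?'k = 'k] by (auto simp: coeff_g1 E_def)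
    define W where "W = lift_x g + y_pow s * \<Psi>"
    have "H dvd xx * deriv_along H W - of_nat e1 * dY H * W"
      using less.prems(3) by (intro dvd_diff dvd_mult dvd_deriv_along) (simp_all add: W_def)
    \<comment> \<open>Differentiating y^s costs one power of y; everything else that is not H_y
      times \<open>g1\<close> keeps the factor y^(s - 1).\<close>
    moreover have "\<exists>\<Psi>'. xx * deriv_along H W - of_nat e1 * dY H * W = dY H * lift_x g1 + y_pow (s - 1) * \<Psi>'"
    proof -
      have "s \<ge> 1" using s' by simp
      then have m: "y_pow s = y_pow (s - 1) * (y_pow 1 :: 'k poly poly)"
        using y_pow_add[of "s - 1" 1] by simp
      have d: "deriv_along H (y_pow s) = y_pow (s - 1) * (- (pderiv H * of_nat s))"
        unfolding deriv_along_const pderiv_monom by (simp add: lift_y_def of_nat_poly smult_monom mult.commute)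
      have "deriv_along H (lift_x g) = dY H * lift_x (pderiv g)"
        by (simp add: deriv_along_def pderiv_lift_x)
      then have "xx * deriv_along H W - of_nat e1 * dY H * W =
         dY H * (xx * lift_x (pderiv g) - of_nat e1 * lift_x g)
         + y_pow (s - 1) * (xx * (y_pow 1 * deriv_along H \<Psi> - pderiv H * of_nat s * \<Psi>)
            - of_nat e1 * dY H * y_pow 1 * \<Psi>)"
        unfolding W_def deriv_along_add deriv_along_mult m[symmetric] d
        unfolding m by (simp only: ring_distribs mult_ac) (simp add: algebra_simps)
      moreover have "xx * lift_x (pderiv g) - of_nat e1 * lift_x g = lift_x g1"
        by (simp add: g1_def xx_def lift_x_diff lift_x_mult lift_x_smult) (simp add: lift_y_def of_nat_poly)
      ultimately show ?thesis by metis
    qed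
    ultimately obtain \<Psi>1 where 1: "H dvd dY H * lift_x g1 + y_pow (s - 1) * \<Psi>1"
      by auto
    \<comment> \<open>Multiplying by \<open>w\<close> and adding a multiple of H replaces H_y by
      \<rho>, which involves y only.\<close>
    have "H dvd w * (dY H * lift_x g1 + y_pow (s - 1) * \<Psi>1) + u * H * lift_x g1"
      using 1 by (intro dvd_add) auto
    also have "w * (dY H * lift_x g1 + y_pow (s - 1) * \<Psi>1) + u * H * lift_x g1
        = lift_y \<rho> * lift_x g1 + y_pow (s - 1) * (w * \<Psi>1)"
      unfolding \<rho>(1)[symmetric] by (simp only: ring_distribs mult_ac) (simp add: algebra_simps)
    finally have 2: "H dvd lift_y \<rho> * lift_x g1 + y_pow (s - 1) * (w * \<Psi>1)" .
    obtain \<rho>1 where "\<rho> = [:- 0, 1:] ^ v * \<rho>1" and \<rho>1: "\<not> [:- 0, 1:] dvd \<rho>1"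
      using order_decomp[OF \<rho>(2), of 0] by (auto simp: v_def)
    then have \<rho>eq: "\<rho> = monom 1 v * \<rho>1"
      by (simp add: monom_altdef)
    have "poly \<rho>1 0 \<noteq> 0"
      using \<rho>1 by (simp add: poly_eq_0_iff_dvd)
    have sv: "s - 1 = v + s'" using s' by simp
    have "lift_y \<rho> * lift_x g1 + y_pow (s - 1) * (w * \<Psi>1)
        = y_pow v * (lift_y \<rho>1 * lift_x g1 + y_pow s' * (w * \<Psi>1))"
      unfolding sv y_pow_add \<rho>eq lift_y_mult by (simp add: algebra_simps)
    \<comment> \<open>The prime H does not divide y^v, so this power can be cancelled. What remains
      is the exponent \<open>s'\<close> = s - 1 - v and the factor \<rho>1, invertible modulo powers
      of y.\<close>
    with 2 have "H dvd y_pow v * (lift_y \<rho>1 * lift_x g1 + y_pow s' * (w * \<Psi>1))"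
      by simp
    moreover have "\<not> H dvd y_pow v"
      using not_dvd_lift_y[OF degH] by simp
    ultimately have 3: "H dvd lift_y \<rho>1 * lift_x g1 + y_pow s' * (w * \<Psi>1)"
      using H prime_elem_dvd_mult_iff by blast
    obtain \<sigma> \<zeta> where \<sigma>: "\<rho>1 * \<sigma> = 1 + monom 1 s' * \<zeta>"
      using inverse_mod_y_power[OF \<open>poly \<rho>1 0 \<noteq> 0\<close>] by blast
    have "H dvd lift_y \<sigma> * (lift_y \<rho>1 * lift_x g1 + y_pow s' * (w * \<Psi>1))"
      using 3 by (rule dvd_mult)
    also have "lift_y \<sigma> * (lift_y \<rho>1 * lift_x g1 + y_pow s' * (w * \<Psi>1))
        = lift_y (\<rho>1 * \<sigma>) * lift_x g1 + y_pow s' * (lift_y \<sigma> * (w * \<Psi>1))"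
      by (simp add: algebra_simps lift_y_mult)
    also have "\<dots> = lift_x g1 + y_pow s' * (lift_y \<zeta> * lift_x g1 + lift_y \<sigma> * (w * \<Psi>1))"
      unfolding \<sigma> by (simp add: algebra_simps lift_y_mult lift_y_add)
    finally have 4: "H dvd lift_x g1 + y_pow s' * (lift_y \<zeta> * lift_x g1 + lift_y \<sigma> * (w * \<Psi>1))" .
    have cE: "card (E - {e1}) = card E - 1"
      using e1 finE by simp
    show False
    proof (rule less.hyps[OF _ _ _ 4])
      show "card {e. coeff g1 e \<noteq> 0} < card {e. coeff g e \<noteq> 0}"
        using cE c2 supp by (simp flip: E_def)
      have "E - {e1} \<noteq> {}"
        using cE c2 by (metis One_nat_def card.empty diff_is_0_eq le_numeral_extra(4) not_less_eq_eq numeral_2_eq_2)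
      then show "g1 \<noteq> 0"
        using supp by (metis (mono_tags, lifting) Collect_empty_eq coeff_0)
      show "e < CHAR('k)" if "coeff g1 e \<noteq> 0" for e
        using that less.prems(2) by (auto simp: coeff_g1)
      show "1 + (card {e. coeff g1 e \<noteq> 0} - 1) * (1 + order 0 \<rho>) \<le> s'"
        using s'(2) unfolding supp cE v_def by (simp add: numeral_2_eq_2)
    qed
  qed
qed

section \<open>Iterated derivatives at points of the curve\<close>

definition ev2 :: "'k::comm_ring_1 poly poly \<Rightarrow> 'k \<Rightarrow> 'k \<Rightarrow> 'k" where
  "ev2 P x y = poly (eval_y y P) x"

lemma ev2_simps [simp]:
  "ev2 0 x y = 0" "ev2 (P + Q) x y = ev2 P x y + ev2 Q x y"
  "ev2 (P * Q) x y = ev2 P x y * ev2 Q x y"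
  "ev2 (lift_x g) x y = poly g x" "ev2 (lift_y R) x y = poly R y"
  by (simp_all add: ev2_def eval_y_add eval_y_mult)

lemma ev2_sum [simp]: "ev2 (sum f I) x y = (\<Sum>i\<in>I. ev2 (f i) x y)"
  by (induction I rule: infinite_finite_induct) auto

lemma ev2_of_nat [simp]: "ev2 (of_nat n) x y = of_nat n"
  by (induction n) (simp_all add: ev2_def eval_y_def map_poly_pCons one_pCons eval_y_add[unfolded eval_y_def])

lemma ev2_uminus [simp]: "ev2 (- P) x y = - ev2 P x y"
  by (metis add.right_inverse add_eq_0_iff ev2_simps(1,2))

lemma ev2_diff [simp]: "ev2 (P - Q) x y = ev2 P x y - ev2 Q x y"
  using ev2_simps(2)[of P "- Q"] by simp

lemma ev2_dvd: "H dvd P \<Longrightarrow> ev2 H x y = 0 \<Longrightarrow> ev2 P x y = 0"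
  by (auto elim!: dvdE)

abbreviation x_pow :: "nat \<Rightarrow> 'k::comm_ring_1 poly poly" where
  "x_pow s \<equiv> lift_x (monom 1 s)"

lemma x_pow_add: "x_pow (a + b) = x_pow a * x_pow b"
  by (simp add: mult_monom flip: lift_x_mult)

text \<open>The factor x y makes x^m and y^n divide their own derivatives, and it limits the growth
  of both partial degrees per step to the degree bound of H.\<close>

definition euler :: "'k::idom poly poly \<Rightarrow> 'k poly poly \<Rightarrow> 'k poly poly" where
  "euler H W = x_pow 1 * y_pow 1 * deriv_along H W"

lemma euler_add: "euler H (V + W) = euler H V + euler H W"
  by (simp add: euler_def deriv_along_add algebra_simps)

lemma euler_0 [simp]: "euler H 0 = 0"
  by (simp add: euler_def deriv_along_def)

lemma euler_mult: "euler H (V * W) = V * euler H W + euler H V * W"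
  by (simp add: euler_def deriv_along_mult algebra_simps)

lemma dvd_euler: "H dvd W \<Longrightarrow> H dvd euler H W"
  unfolding euler_def by (intro dvd_mult dvd_deriv_along)

lemma euler_funpow_add: "(euler H ^^ k) (V + W) = (euler H ^^ k) V + (euler H ^^ k) W"
  by (induction k) (simp_all add: euler_add)

lemma euler_funpow_0 [simp]: "(euler H ^^ k) 0 = 0"
  by (induction k) simp_all

lemma euler_funpow_sum: "(euler H ^^ k) (sum f I) = (\<Sum>i\<in>I. (euler H ^^ k) (f i))"
  by (induction I rule: infinite_finite_induct) (simp_all add: euler_funpow_add)

lemma dvd_euler_funpow: "H dvd W \<Longrightarrow> H dvd (euler H ^^ k) W"
  by (induction k) (simp_all add: dvd_euler)

text \<open>Leibniz's rule: every term of the k-th derivative of a product with \<Phi> contains a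
  derivative of \<Phi> of order at most k.\<close>

lemma ev2_euler_funpow_mult:
  assumes "\<And>j. j \<le> k \<Longrightarrow> ev2 ((euler H ^^ j) \<Phi>) x y = 0"
  shows "ev2 ((euler H ^^ k) (V * \<Phi>)) x y = 0"
  using assms
proof (induction k arbitrary: V \<Phi>)
  case 0
  then show ?case by force
next
  case (Suc k)
  have "ev2 ((euler H ^^ k) (V * euler H \<Phi>)) x y = 0"
    using Suc.prems[of "Suc j" for j] by (intro Suc.IH) (simp add: funpow_swap1)
  moreover have "ev2 ((euler H ^^ k) (euler H V * \<Phi>)) x y = 0"
    using Suc.prems by (intro Suc.IH) simp
  ultimately show ?case
    by (simp add: funpow_Suc_right euler_mult euler_funpow_add del: funpow.simps)
qed

lemma dY_1 [simp]: "dY 1 = 0"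
  by (simp add: one_pCons flip: lift_y_def)

lemma euler_x_pow: "euler H (x_pow m) = of_nat m * y_pow 1 * dY H * x_pow m"
proof (cases m)
  case (Suc l)
  have "pderiv (monom (1::'a) m) = smult (of_nat m) (monom 1 l)"
    by (simp add: pderiv_monom Suc smult_monom)
  then have p: "pderiv (x_pow m :: 'a poly poly) = of_nat m * x_pow l"
    by (simp add: pderiv_lift_x lift_x_smult) (simp add: lift_y_def of_nat_poly)
  have xm: "(x_pow m :: 'a poly poly) = x_pow l * x_pow 1"
    using x_pow_add[of l 1] by (simp add: Suc)
  have e: "euler H (x_pow m) = x_pow 1 * y_pow 1 * dY H * pderiv (x_pow m)"
    by (simp add: euler_def deriv_along_def)
  have "euler H (x_pow m) = of_nat m * y_pow 1 * dY H * (x_pow l * x_pow 1)"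
    unfolding e p by (simp only: mult_ac)
  then show ?thesis
    by (simp only: xm)
qed (simp add: euler_def deriv_along_def)

lemma euler_lift_y: "euler H (lift_y R) = - (x_pow 1 * y_pow 1 * pderiv H * lift_y (pderiv R))"
  by (simp add: euler_def deriv_along_def)

lemma euler_y_pow: "euler H (y_pow m) = - (of_nat m * x_pow 1 * pderiv H * y_pow m)"
proof (cases m)
  case (Suc l)
  have "pderiv (monom (1::'a) m) = smult (of_nat m) (monom 1 l)"
    by (simp add: pderiv_monom Suc smult_monom)
  then have "lift_y (pderiv (monom (1::'a) m)) = of_nat m * y_pow l"
    by (simp add: lift_y_def of_nat_poly)
  moreover have "(y_pow m :: 'a poly poly) = y_pow l * y_pow 1"
    using y_pow_add[of l 1] by (simp add: Suc)
  ultimately show ?thesis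
    unfolding euler_lift_y by (simp only: mult_ac)
qed (simp add: euler_def deriv_along_def)

text \<open>
  At a zero with coordinates in \<open>G\<close> the factor \<open>x_pow (\<tau> * i) * y_pow (\<tau> * j)\<close> equals 1, so only its
  \<open>twist\<close>, whose degree does not involve \<open>\<tau>\<close>, contributes to iterated \<open>euler\<close> derivatives there.
\<close>

primrec twist :: "'k::idom poly poly \<Rightarrow> nat \<Rightarrow> nat \<Rightarrow> 'k poly poly \<Rightarrow> nat \<Rightarrow> 'k poly poly" where
  "twist H m n W 0 = W"
| "twist H m n W (Suc k) = euler H (twist H m n W k)
     + (of_nat m * (y_pow 1 * dY H) - of_nat n * (x_pow 1 * pderiv H)) * twist H m n W k"

text \<open>\<open>euler\<close> multiplies x^m y^n by m y H_y - n x H_x, so the monomial can be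
  carried through all applications; this multiplier is the second summand in the recursion of
  \<open>twist\<close>.\<close>

lemma euler_funpow_twist:
  "(euler H ^^ k) (x_pow m * y_pow n * W) = x_pow m * y_pow n * twist H m n W k"
proof (induction k)
  case (Suc k)
  then show ?case
    by (simp add: euler_mult euler_x_pow euler_y_pow algebra_simps)
qed simp

lemma bibox_x_pderiv: "W \<in> bibox a b \<Longrightarrow> x_pow 1 * pderiv W \<in> bibox a b" for W :: "'k::idom poly poly"
proof -
  assume W: "W \<in> bibox a b"
  have "coeff (coeff (x_pow 1 * pderiv W) i) j = of_nat i * coeff (coeff W i) j" for i j
  proof -
    have x1: "(x_pow 1 :: 'k poly poly) = monom 1 1"
      by (rule poly_eqI) (simp add: coeff_lift_x one_pCons)
    show ?thesis
      unfolding x1 by (cases i) (simp_all add: coeff_monom_mult coeff_pderiv of_nat_poly)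
  qed
  then have "coeff (coeff W i) j \<noteq> 0" if "coeff (coeff (x_pow 1 * pderiv W) i) j \<noteq> 0" for i j
    using that by auto
  then show ?thesis
    using W unfolding bibox_def by blast
qed

lemma bibox_y_dY: "W \<in> bibox a b \<Longrightarrow> y_pow 1 * dY W \<in> bibox a b" for W :: "'k::idom poly poly"
proof -
  assume W: "W \<in> bibox a b"
  have "coeff (coeff (y_pow 1 * dY W) i) j = of_nat j * coeff (coeff W i) j" for i j
    by (cases j) (simp_all add: coeff_lift_y_mult coeff_map_poly coeff_monom_mult coeff_pderiv)
  then have "coeff (coeff W i) j \<noteq> 0" if "coeff (coeff (y_pow 1 * dY W) i) j \<noteq> 0" for i j
    using that by auto
  then show ?thesis
    using W unfolding bibox_def by blast
qed

lemma bibox_mult_Suc: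
  "P \<in> bibox (Suc c) (Suc d) \<Longrightarrow> Q \<in> bibox a b \<Longrightarrow> P * Q \<in> bibox (a + c) (b + d)"
  for P Q :: "'k::comm_ring_1 poly poly"
  using bibox_mult[of P "Suc c" "Suc d" Q a b] by (simp add: add.commute)

lemma bibox_lift_y: "degree R < b \<Longrightarrow> lift_y R \<in> bibox 1 b"
  unfolding bibox_def lift_y_def
  by (auto simp: coeff_pCons split: nat.splits) (metis le_degree order_le_less_trans)

lemma bibox_of_nat_mult: "W \<in> bibox a b \<Longrightarrow> of_nat n * W \<in> bibox a b" for W :: "'k::idom poly poly"
  by (induction n) (simp_all add: algebra_simps bibox_add)

lemma bibox_euler:
  assumes H: "H \<in> bibox (Suc d) (Suc d)" and W: "W \<in> bibox a b"
  shows "euler H W \<in> bibox (a + d) (b + d)"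
proof -
  have "euler H W = (y_pow 1 * dY H) * (x_pow 1 * pderiv W) - (x_pow 1 * pderiv H) * (y_pow 1 * dY W)"
    by (simp add: euler_def deriv_along_def algebra_simps)
  then show ?thesis
    using bibox_diff bibox_mult_Suc bibox_x_pderiv bibox_y_dY H W by metis
qed

lemma bibox_twist:
  assumes H: "H \<in> bibox (Suc d) (Suc d)" and W: "W \<in> bibox a b"
  shows "twist H m n W k \<in> bibox (a + k * d) (b + k * d)"
proof (induction k)
  case (Suc k)
  have "of_nat m * (y_pow 1 * dY H) - of_nat n * (x_pow 1 * pderiv H) \<in> bibox (Suc d) (Suc d)"
    using H by (intro bibox_diff bibox_of_nat_mult bibox_x_pderiv bibox_y_dY)
  from bibox_add[OF bibox_euler[OF H Suc] bibox_mult_Suc[OF this Suc]] show ?case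
    by (simp add: add_ac)
qed (use W in simp)

text \<open>The value of \<open>(euler H ^^ k)\<close> at a zero is read off \<open>order y R\<close>: each step lowers the order by one.\<close>

lemma order_ge_if_euler_vanishes:
  fixes R :: "'k::idom poly"
  assumes nz: "x \<noteq> 0" "y \<noteq> 0" "ev2 (pderiv H) x y \<noteq> 0" "R \<noteq> 0" and K: "K \<le> CHAR('k)"
    and van: "\<And>k. k < K \<Longrightarrow> ev2 ((euler H ^^ k) (lift_y R)) x y = 0"
  shows "order y R \<ge> K"
proof (rule ccontr)
  define m where "m = order y R"
  define l where "l = [:- y, 1:]"
  assume "\<not> ?thesis"
  then have mK: "m < K" by (simp add: m_def)
  obtain R1 where R: "R = l ^ m * R1" and R1: "poly R1 y \<noteq> 0"
    using order_decomp[OF \<open>R \<noteq> 0\<close>, of y] by (auto simp: m_def l_def poly_eq_0_iff_dvd)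
  \<comment> \<open>Invariant: k steps lower the power of \<open>l\<close> by k and leave a cofactor
    that is nonzero at the point. Step k + 1 multiplies its value by -(m - k) x y H_x, and m - k is
    nonzero in the field because m < K <= CHAR.\<close>
  have "\<exists>V. (euler H ^^ k) (lift_y R) = lift_y (l ^ (m - k)) * V \<and> ev2 V x y \<noteq> 0" if "k \<le> m" for k
    using that
  proof (induction k)
    case 0
    show ?case
      by (rule exI[of _ "lift_y R1"]) (simp add: R R1 lift_y_mult)
  next
    case (Suc k)
    then obtain V where V: "(euler H ^^ k) (lift_y R) = lift_y (l ^ (m - k)) * V" "ev2 V x y \<noteq> 0"
      by auto
    define s where "s = m - Suc k"
    have s: "m - k = Suc s" using Suc.prems by (simp add: s_def)
    have pl: "pderiv (l ^ Suc s) = of_nat (Suc s) * l ^ s"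
      unfolding pderiv_power_Suc by (simp add: l_def pderiv_pCons of_nat_poly)
    have "(euler H ^^ Suc k) (lift_y R) = euler H (lift_y (l ^ Suc s) * V)"
      using V by (simp add: s)
    also have "\<dots> = lift_y (l ^ s) * (lift_y l * euler H V
        - x_pow 1 * y_pow 1 * pderiv H * lift_y (of_nat (Suc s)) * V)"
      unfolding euler_mult euler_lift_y pl by (simp add: lift_y_mult algebra_simps del: of_nat_Suc)
    finally have eq: "(euler H ^^ Suc k) (lift_y R) = lift_y (l ^ (m - Suc k)) * (lift_y l * euler H V
        - x_pow 1 * y_pow 1 * pderiv H * lift_y (of_nat (Suc s)) * V)"
      by (simp add: s_def)
    have "(of_nat (Suc s) :: 'k) \<noteq> of_nat 0"
      using mK K Suc.prems by (intro of_nat_neq_CHAR) (auto simp: s_def)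
    then have "ev2 (lift_y l * euler H V
        - x_pow 1 * y_pow 1 * pderiv H * lift_y (of_nat (Suc s)) * V) x y \<noteq> 0"
      using nz V(2) by (simp add: poly_monom l_def of_nat_poly del: of_nat_Suc)
    then show ?case
      using eq by blast
  qed
  from this[of m] obtain V where "(euler H ^^ m) (lift_y R) = V" "ev2 V x y \<noteq> 0"
    by auto
  then show False
    using van[OF mK] by simp
qed

lemma sum_order_le_degree:
  fixes R :: "'k::idom poly"
  assumes "R \<noteq> 0" "\<And>y. y \<in> S \<Longrightarrow> order y R \<ge> K" "K \<ge> 1"
  shows "finite S" "K * card S \<le> degree R"
proof -
  have sub: "S \<subseteq> {y. poly R y = 0}"
    using assms by (metis (mono_tags, lifting) mem_Collect_eq not_one_le_zero order_0I subsetI order_trans)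
  then show "finite S"
    using poly_roots_finite[OF assms(1)] finite_subset by blast
  have "K * card S = (\<Sum>y\<in>S. K)" by simp
  also have "\<dots> \<le> (\<Sum>y\<in>S. count (proots R) y)"
    using assms by (intro sum_mono) simp
  also have "\<dots> \<le> (\<Sum>y\<in>set_mset (proots R). count (proots R) y)"
    using sub assms(1) poly_roots_finite[OF assms(1)] by (intro sum_mono2) auto
  also have "\<dots> = size (proots R)"
    by (simp add: size_multiset_overloaded_eq)
  also have "\<dots> \<le> degree R"
    by (rule size_proots_le)
  finally show "K * card S \<le> degree R" .
qed

text \<open>Comparing degrees in x, the quotient depends on y alone. Then each coefficient of H
  divides its own derivative, which has smaller degree in y unless it is zero.\<close>

lemma dvd_dY_imp_dY_eq_0:
  fixes H :: "'k::idom poly poly"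
  assumes "H dvd dY H"
  shows "dY H = 0"
proof (rule ccontr)
  assume nz: "dY H \<noteq> 0"
  obtain Q where Q: "dY H = H * Q"
    using assms by (elim dvdE)
  then have "H \<noteq> 0" "Q \<noteq> 0"
    using nz by auto
  then have "degree H + degree Q = degree (dY H)"
    by (simp add: Q degree_mult_eq)
  also have "\<dots> \<le> degree H"
    by (rule degree_map_poly_le)
  finally obtain q where q: "Q = [:q:]"
    by (auto elim: degree_eq_zeroE)
  have "pderiv (coeff H i) = 0" for i
  proof (rule ccontr)
    assume *: "pderiv (coeff H i) \<noteq> 0"
    have "pderiv (coeff H i) = coeff H i * q"
      using arg_cong[OF Q, of "\<lambda>p. coeff p i"] by (simp add: coeff_map_poly q mult.commute)
    then have "degree (coeff H i) \<le> degree (pderiv (coeff H i))"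
      using * by (metis dvd_imp_degree_le dvd_triv_left)
    moreover have "degree (coeff H i) \<noteq> 0"
    proof
      assume "degree (coeff H i) = 0"
      then obtain a where "coeff H i = [:a:]"
        by (rule degree_eq_zeroE)
      then show False
        using * by simp
    qed
    ultimately show False
      using degree_pderiv_le[of "coeff H i"] by linarith
  qed
  then have "dY H = 0"
    by (intro poly_eqI) (simp add: coeff_map_poly)
  then show False
    using nz by simp
qed

section \<open>Stepanov's method\<close>

abbreviation cst :: "'k::comm_ring_1 \<Rightarrow> 'k poly poly" where
  "cst c \<equiv> lift_y [:c:]"

lemma cst_diff: "cst (a - b) = cst a - cst b"
  by (simp add: lift_y_def)

lemma lift_x_monom: "lift_x (monom c n) = cst c * x_pow n"
proof -
  have "monom c n = smult c (monom 1 n)"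
    by (simp add: smult_monom)
  then show ?thesis
    by (metis lift_x_smult)
qed

lemma euler_funpow_cst: "(euler H ^^ k) (cst c * W) = cst c * (euler H ^^ k) W"
  by (induction k) (simp_all add: euler_mult euler_lift_y)

lemma bibox_lift_x: "(\<And>e. coeff g e \<noteq> 0 \<Longrightarrow> e < a) \<Longrightarrow> lift_x g \<in> bibox a 1"
  unfolding bibox_def by (auto simp: coeff_lift_x coeff_pCons split: nat.splits if_splits)

lemma bibox_cst_mult: "W \<in> bibox a b \<Longrightarrow> cst c * W \<in> bibox a b"
  unfolding bibox_def by (simp add: coeff_lift_y_mult) (metis mult_zero_right)

lemma sum_arith: "(\<Sum>k<K. d * (A + 1 + d + 2 * k * d)) = d * K * (A + 1) + d * d * K * (K :: nat)"
  by (induction K) (simp_all add: algebra_simps)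

lemma bibox_dY: "W \<in> bibox a (Suc b) \<Longrightarrow> dY W \<in> bibox a (Suc b)" for W :: "'k::idom poly poly"
proof -
  assume W: "W \<in> bibox a (Suc b)"
  have "i < a \<and> j < Suc b" if "coeff (coeff (dY W) i) j \<noteq> 0" for i j
  proof -
    have "coeff (coeff W i) (Suc j) \<noteq> 0"
      using that by (auto simp: coeff_map_poly coeff_pderiv)
    then have "i < a \<and> Suc j < Suc b"
      using W unfolding bibox_def by blast
    then show ?thesis by simp
  qed
  then show ?thesis
    unfolding bibox_def by blast
qed

lemma bibox_pderiv: "W \<in> bibox (Suc a) b \<Longrightarrow> pderiv W \<in> bibox a b" for W :: "'k::idom poly poly"
proof -
  assume W: "W \<in> bibox (Suc a) b"
  have "i < a \<and> j < b" if "coeff (coeff (pderiv W) i) j \<noteq> 0" for i j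
  proof -
    have "coeff (coeff W (Suc i)) j \<noteq> 0"
      using that by (auto simp: coeff_pderiv of_nat_poly simp del: of_nat_Suc)
    then have "Suc i < Suc a \<and> j < b"
      using W unfolding bibox_def by blast
    then show ?thesis by simp
  qed
  then show ?thesis
    unfolding bibox_def by blast
qed

lemma bibox_degree_Suc: "W \<in> bibox a b \<Longrightarrow> W \<in> bibox (Suc (degree W)) b" for W :: "'k::idom poly poly"
proof -
  assume W: "W \<in> bibox a b"
  have "i < Suc (degree W) \<and> j < b" if nz: "coeff (coeff W i) j \<noteq> 0" for i j
  proof -
    have "coeff W i \<noteq> 0"
      using nz by auto
    then show ?thesis
      using W nz le_degree[of W i] unfolding bibox_def by auto
  qed
  then show ?thesis
    unfolding bibox_def by blast
qed

text \<open>Pigeonhole again. The quotients by H are taken as further unknowns beside \<alpha>,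
  which turns divisibility by H into linear equations and avoids a basis of the quotient
  ring.\<close>

lemma auxiliary_polynomial:
  fixes H :: "'k::{finite,field} poly poly"
  assumes H: "H \<in> bibox (Suc d) (Suc d)" "H \<noteq> 0" and d: "d \<ge> 1" and b: "b \<ge> 1"
    and A: "A = b\<^sup>2" and B: "B = 2 * d * b" and I: "I = {..<A} \<times> {..<B} \<times> {..<B}"
  shows "\<exists>\<alpha>. (\<exists>w\<in>I. \<alpha> w \<noteq> 0) \<and>
    (\<forall>k<A. H dvd (\<Sum>(a, i, j)\<in>I. cst (\<alpha> (a, i, j)) * twist H (\<tau> * i) (\<tau> * j) (x_pow a) k))"
proof -
  define S where "S = (\<lambda>\<alpha> k. \<Sum>(a, i, j)\<in>I. cst (\<alpha> (a, i, j)) * twist H (\<tau> * i) (\<tau> * j) (x_pow a) k)"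
  define D where "D = (I \<rightarrow>\<^sub>E (UNIV :: 'k set)) \<times> (\<Pi>\<^sub>E k\<in>{..<A}. (bibox (A + k * d) (1 + k * d) :: 'k poly poly set))"
  define f where "f = (\<lambda>(\<alpha>, U). \<lambda>k\<in>{..<A}. S \<alpha> k - U k * H)"
  define C where "C = (\<Pi>\<^sub>E k\<in>{..<A}. (bibox (A + k * d + d) (1 + k * d + d) :: 'k poly poly set))"
  have finI: "finite I" by (simp add: I)
  have S_box: "S \<alpha> k \<in> bibox (A + k * d) (1 + k * d)" for \<alpha> k
    unfolding S_def
  proof (intro bibox_sum, clarify)
    fix a i j assume "(a, i, j) \<in> I"
    then have "x_pow a \<in> (bibox A 1 :: 'k poly poly set)"
      by (intro bibox_lift_x) (auto simp: I split: if_splits)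
    then show "cst (\<alpha> (a, i, j)) * twist H (\<tau> * i) (\<tau> * j) (x_pow a) k \<in> bibox (A + k * d) (1 + k * d)"
      by (intro bibox_cst_mult bibox_twist H)
  qed
  have sub: "f ` D \<subseteq> C"
  proof
    fix w assume "w \<in> f ` D"
    then obtain \<alpha> U where w: "w = f (\<alpha>, U)" and U: "U \<in> (\<Pi>\<^sub>E k\<in>{..<A}. bibox (A + k * d) (1 + k * d))"
      unfolding D_def by auto
    have "S \<alpha> k - U k * H \<in> bibox (A + k * d + d) (1 + k * d + d)" if "k < A" for k
    proof (intro bibox_diff)
      show "S \<alpha> k \<in> bibox (A + k * d + d) (1 + k * d + d)"
        using S_box by (rule bibox_mono) auto
      have "U k \<in> bibox (A + k * d) (1 + k * d)"
        using U that by auto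
      from bibox_mult_Suc[OF H(1) this] show "U k * H \<in> bibox (A + k * d + d) (1 + k * d + d)"
        by (simp add: mult.commute)
    qed
    then show "w \<in> C"
      unfolding w f_def C_def by auto
  qed
  have finD: "finite D" and finC: "finite C"
    unfolding D_def C_def by (auto intro!: finite_PiE finI)
  have cD: "card D = CARD('k) ^ (A * B\<^sup>2 + (\<Sum>k<A. (A + k * d) * (1 + k * d)))"
    unfolding D_def card_cartesian_product
    by (simp add: card_PiE finI card_bibox power_add power_sum I power2_eq_square mult.assoc)
  have cC: "card C = CARD('k) ^ (\<Sum>k<A. (A + k * d + d) * (1 + k * d + d))"
    unfolding C_def by (simp add: card_PiE card_bibox power_sum)
  have "(\<Sum>k<A. (A + k * d + d) * (1 + k * d + d)) < A * B\<^sup>2 + (\<Sum>k<A. (A + k * d) * (1 + k * d))"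
  proof -
    have "(\<Sum>k<A. (A + k * d + d) * (1 + k * d + d))
        = (\<Sum>k<A. (A + k * d) * (1 + k * d) + d * (A + 1 + d + 2 * k * d))"
      by (intro sum.cong refl) (simp add: algebra_simps)
    also have "\<dots> = (\<Sum>k<A. (A + k * d) * (1 + k * d)) + (d * A * (A + 1) + d * d * A * A)"
      by (simp only: sum.distrib sum_arith)
    \<comment> \<open>The equations exceed the unknown coefficients of the quotients by at most 3
      d^2 A^2. The factor 2 in B = 2 d b makes the number of unknown \<alpha> equal to 4 d^2
      A^2.\<close>
    also have "d * A * (A + 1) + d * d * A * A < A * B\<^sup>2"
    proof -
      have "A \<ge> 1"
        using b by (simp add: A)
      then have "d * A * (A + 1) \<le> d * A * (A + A)"
        by (intro mult_left_mono) auto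
      also have "\<dots> = 2 * (d * 1 * (A * A))"
        by simp
      also have "\<dots> \<le> 2 * (d * d * (A * A))"
        using d by (intro mult_left_mono mult_right_mono) auto
      finally have "d * A * (A + 1) + d * d * A * A \<le> 3 * (d * d * (A * A))"
        by (simp add: mult_ac)
      also have "\<dots> < 4 * (d * d * (A * A))"
        using d \<open>A \<ge> 1\<close> by simp
      also have "\<dots> = A * B\<^sup>2"
        by (simp add: A B power2_eq_square)
      finally show ?thesis .
    qed
    finally show ?thesis by simp
  qed
  moreover have "CARD('k) > 1"
    using card_mono[of UNIV "{0, 1 :: 'k}"] by simp
  ultimately have "card C < card D"
    unfolding cC cD by (intro power_strict_increasing) auto
  then have "\<not> inj_on f D"
    using card_inj_on_le[OF _ sub finC] by linarith
  then obtain \<alpha>1 U1 \<alpha>2 U2 where *: "(\<alpha>1, U1) \<in> D" "(\<alpha>2, U2) \<in> D" "(\<alpha>1, U1) \<noteq> (\<alpha>2, U2)"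
    "f (\<alpha>1, U1) = f (\<alpha>2, U2)"
    unfolding inj_on_def by auto
  define \<alpha> where "\<alpha> = (\<lambda>w. \<alpha>1 w - \<alpha>2 w)"
  have S\<alpha>: "S \<alpha> k = S \<alpha>1 k - S \<alpha>2 k" for k
    unfolding S_def \<alpha>_def
    by (simp add: cst_diff left_diff_distrib case_prod_unfold sum_subtractf)
  have eq: "S \<alpha> k = (U1 k - U2 k) * H" if "k < A" for k
    using fun_cong[OF *(4), of k] that by (simp add: f_def S\<alpha> algebra_simps)
  have "\<exists>w\<in>I. \<alpha> w \<noteq> 0"
  proof (rule ccontr)
    assume "\<not> ?thesis"
    then have z: "\<alpha> w = 0" if "w \<in> I" for w using that by auto
    then have "\<alpha>1 = \<alpha>2"
      using *(1,2) by (intro PiE_ext[of _ I "\<lambda>_. UNIV"]) (auto simp: D_def \<alpha>_def)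
    \<comment> \<open>If \<alpha> were zero, the quotients would agree too, since H is nonzero, and
      the two colliding arguments would be equal.\<close>
    moreover have "S \<alpha> k = 0" for k
      unfolding S_def using z by (intro sum.neutral) (auto simp: case_prod_unfold)
    then have "U1 k = U2 k" if "k < A" for k
      using eq[OF that] H(2) by simp
    then have "U1 = U2"
      using *(1,2) unfolding D_def by (intro PiE_ext[of _ "{..<A}" "\<lambda>k. bibox (A + k * d) (1 + k * d)"]) auto
    ultimately show False
      using *(3) by simp
  qed
  moreover have "H dvd S \<alpha> k" if "k < A" for k
    using eq[OF that] by simp
  ultimately show ?thesis
    unfolding S_def by blast
qed

text \<open>Sorted by powers of y^\<tau>, \<Phi> has a lowest nonzero part, a sparse polynomial in
  x. After cancelling a power of y the remaining parts are divisible by y^\<tau>, so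
  \<open>sparse_not_vanishing\<close> applies with s = \<tau>.\<close>

lemma stepanov_aux:
  fixes H :: "'k::{finite,field_gcd} poly poly"
  assumes H: "prime_elem H" "H \<in> bibox (Suc d) (Suc d)" and d: "d \<ge> 1"
    and h: "degree (eval_y 0 H) \<ge> 1" "poly (eval_y 0 H) 0 \<noteq> 0" and Hy: "dY H \<noteq> 0"
    and b: "b \<ge> 1" "(2 * d * b) ^ 3 \<le> \<tau>" "2 * d * b * \<tau> \<le> CHAR('k)"
    and A: "A = b\<^sup>2" and B: "B = 2 * d * b" and I: "I = {..<A} \<times> {..<B} \<times> {..<B}"
    and \<alpha>: "\<exists>w\<in>I. \<alpha> w \<noteq> 0"
    and \<Phi>: "\<Phi> = (\<Sum>(a, i, j)\<in>I. cst (\<alpha> (a, i, j)) * (x_pow (\<tau> * i) * y_pow (\<tau> * j) * x_pow a))"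
  shows "\<not> H dvd \<Phi>" "\<Phi> \<in> bibox (\<tau> * B) (\<tau> * (B - 1) + 1)"
proof -
  define g where "g = (\<lambda>c. \<Sum>(a, i)\<in>{..<A} \<times> {..<B}. monom (\<alpha> (a, i, c)) (a + \<tau> * i))"
  have "1 * 1 * b \<le> 2 * d * b"
    using d by (intro mult_mono) auto
  then have bB: "b \<le> B" by (simp add: B)
  have "A \<le> b ^ 3"
    using b(1) unfolding A by (intro power_increasing) auto
  also have "b ^ 3 \<le> B ^ 3"
    using bB by (rule power_mono) simp
  also have "\<dots> \<le> \<tau>"
    using b(2) by (simp only: B)
  finally have A\<tau>: "A \<le> \<tau>" .
  have B1: "B \<ge> 1" using bB b(1) by simp
  have \<tau>1: "\<tau> \<ge> 1" using A\<tau> one_le_power[OF b(1), of 2] unfolding A by (rule order_trans[rotated])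
  have degH: "degree H \<ge> 1"
    using h(1) degree_map_poly_le[of "\<lambda>q. poly q 0" H] by (simp add: eval_y_def)
  have less: "a + \<tau> * i < \<tau> * B" if "a < A" "i < B" for a i
  proof -
    have "a + \<tau> * i < \<tau> * (i + 1)"
      using that A\<tau> by simp
    also have "\<dots> \<le> \<tau> * B"
      using that by (intro mult_left_mono) auto
    finally show ?thesis .
  qed
  have coeff_g: "coeff (g c) e = (\<Sum>w\<in>{..<A} \<times> {..<B}. if fst w + \<tau> * snd w = e then \<alpha> (fst w, snd w, c) else 0)" for c e
    unfolding g_def by (simp add: coeff_sum case_prod_unfold)
  \<comment> \<open>As A <= \<tau>, the exponents a + \<tau> i are pairwise distinct, so no two
    entries of \<alpha> merge.\<close>
  have coeff_g_nz: "coeff (g c) (a + \<tau> * i) = \<alpha> (a, i, c)" if "a < A" "i < B" for a i c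
  proof -
    have "fst w + \<tau> * snd w = a + \<tau> * i \<longleftrightarrow> w = (a, i)" if "w \<in> {..<A} \<times> {..<B}" for w
    proof
      assume eq: "fst w + \<tau> * snd w = a + \<tau> * i"
      have "fst w < \<tau>" "a < \<tau>"
        using that \<open>a < A\<close> A\<tau> by auto
      then have "fst w = a" "snd w = i"
        using arg_cong[OF eq, of "\<lambda>n. n mod \<tau>"] arg_cong[OF eq, of "\<lambda>n. n div \<tau>"] by simp_all
      then show "w = (a, i)" by (simp add: prod_eq_iff)
    qed simp
    then have "coeff (g c) (a + \<tau> * i) = (\<Sum>w\<in>{..<A} \<times> {..<B}. if w = (a, i) then \<alpha> (fst w, snd w, c) else 0)"
      unfolding coeff_g by (intro sum.cong) simp_all
    then show ?thesis
      using that by (simp add: sum.delta)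
  qed
  define E where "E = (\<lambda>(a, i). a + \<tau> * i) ` ({..<A} \<times> {..<B})"
  have supp: "{e. coeff (g c) e \<noteq> 0} \<subseteq> E" for c
  proof
    fix e assume "e \<in> {e. coeff (g c) e \<noteq> 0}"
    then have "coeff (g c) e \<noteq> 0" by simp
    then obtain w where "w \<in> {..<A} \<times> {..<B}"
        "(if fst w + \<tau> * snd w = e then \<alpha> (fst w, snd w, c) else 0) \<noteq> 0"
      unfolding coeff_g by (rule sum.not_neutral_contains_not_neutral)
    then have "w \<in> {..<A} \<times> {..<B}" "fst w + \<tau> * snd w = e"
      by (simp_all split: if_splits)
    then show "e \<in> E"
      unfolding E_def by (auto simp: case_prod_unfold)
  qed
  have E_less: "e < \<tau> * B" if "e \<in> E" for e
    using that less unfolding E_def by auto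
  have finE: "finite E"
    unfolding E_def by simp
  have cardE: "card E \<le> A * B"
    unfolding E_def using card_image_le[of "{..<A} \<times> {..<B}" "\<lambda>(a, i). a + \<tau> * i"] by (simp add: card_cartesian_product)
  have \<Phi>g: "\<Phi> = (\<Sum>c<B. y_pow (\<tau> * c) * lift_x (g c))"
  proof -
    have lg: "lift_x (g c) = (\<Sum>(a, i)\<in>{..<A} \<times> {..<B}. cst (\<alpha> (a, i, c)) * (x_pow (\<tau> * i) * x_pow a))" for c
    proof -
      have hom: "lift_x (sum F M) = (\<Sum>w\<in>M. lift_x (F w))" for F :: "nat \<times> nat \<Rightarrow> 'k poly" and M
        by (induction M rule: infinite_finite_induct) (simp_all add: lift_x_add)
      have m: "lift_x (monom r (a + \<tau> * i)) = (cst r * (x_pow (\<tau> * i) * x_pow a) :: 'k poly poly)" for r a i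
        using lift_x_monom[of r "a + \<tau> * i"] by (simp only: x_pow_add mult_ac)
      show ?thesis
        unfolding g_def hom case_prod_unfold by (intro sum.cong refl m)
    qed
    have "\<Phi> = (\<Sum>a<A. \<Sum>i<B. \<Sum>c<B. cst (\<alpha> (a, i, c)) * (x_pow (\<tau> * i) * y_pow (\<tau> * c) * x_pow a))"
      unfolding \<Phi> I by (simp add: sum.cartesian_product[symmetric])
    also have "\<dots> = (\<Sum>a<A. \<Sum>c<B. \<Sum>i<B. cst (\<alpha> (a, i, c)) * (x_pow (\<tau> * i) * y_pow (\<tau> * c) * x_pow a))"
      by (intro sum.cong refl sum.swap)
    also have "\<dots> = (\<Sum>c<B. \<Sum>a<A. \<Sum>i<B. cst (\<alpha> (a, i, c)) * (x_pow (\<tau> * i) * y_pow (\<tau> * c) * x_pow a))"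
      by (rule sum.swap)
    also have "\<dots> = (\<Sum>c<B. y_pow (\<tau> * c) * lift_x (g c))"
      unfolding lg by (simp add: sum.cartesian_product[symmetric] sum_distrib_left mult_ac)
    finally show ?thesis .
  qed
  show "\<Phi> \<in> bibox (\<tau> * B) (\<tau> * (B - 1) + 1)"
    unfolding \<Phi>g
  proof (intro bibox_sum)
    fix c assume "c \<in> {..<B}"
    then have "\<tau> * c \<le> \<tau> * (B - 1)"
      by (intro mult_left_mono) auto
    have "lift_x (g c) \<in> bibox (\<tau> * B) 1"
      using supp E_less by (intro bibox_lift_x) blast
    moreover have "y_pow (\<tau> * c) \<in> (bibox (Suc 0) (Suc (\<tau> * c)) :: 'k poly poly set)"
      using bibox_lift_y[of "monom (1 :: 'k) (\<tau> * c)" "Suc (\<tau> * c)"] degree_monom_le[of "1 :: 'k" "\<tau> * c"] by simp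
    ultimately have "y_pow (\<tau> * c) * lift_x (g c) \<in> bibox (\<tau> * B + 0) (1 + \<tau> * c)"
      by (intro bibox_mult_Suc) auto
    then show "y_pow (\<tau> * c) * lift_x (g c) \<in> bibox (\<tau> * B) (\<tau> * (B - 1) + 1)"
      by (rule bibox_mono) (use \<open>\<tau> * c \<le> \<tau> * (B - 1)\<close> in auto)
  qed
  obtain c1 where c1: "c1 < B" "g c1 \<noteq> 0"
  proof -
    obtain a i c where "a < A" "i < B" "c < B" "\<alpha> (a, i, c) \<noteq> 0"
      using \<alpha> unfolding I by auto
    then show ?thesis
      using coeff_g_nz[of a i c] that[of c] by (cases "g c = 0") auto
  qed
  define c0 where "c0 = (LEAST c. g c \<noteq> 0)"
  have c0: "g c0 \<noteq> 0"
    unfolding c0_def using c1(2) by (rule LeastI)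
  have "c0 < B"
    using Least_le[of "\<lambda>c. g c \<noteq> 0", OF c1(2)] c1(1) by (simp add: c0_def)
  have c0_min: "g c = 0" if "c < c0" for c
    using not_less_Least[of c "\<lambda>c. g c \<noteq> 0"] that by (simp add: c0_def)
  define \<Psi> where "\<Psi> = (\<Sum>c\<in>{c0<..<B}. y_pow (\<tau> * (c - c0 - 1)) * lift_x (g c))"
  have \<Phi>c: "\<Phi> = y_pow (\<tau> * c0) * (lift_x (g c0) + y_pow \<tau> * \<Psi>)"
  proof -
    have "{..<B} = {..<c0} \<union> insert c0 {c0<..<B}"
      using \<open>c0 < B\<close> by auto
    moreover have "sum F ({..<c0} \<union> insert c0 {c0<..<B}) = sum F {..<c0} + (F c0 + sum F {c0<..<B})"
      for F :: "nat \<Rightarrow> 'k poly poly"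
      by (subst sum.union_disjoint) auto
    ultimately have "\<Phi> = (\<Sum>c<c0. y_pow (\<tau> * c) * lift_x (g c)) + (y_pow (\<tau> * c0) * lift_x (g c0)
        + (\<Sum>c\<in>{c0<..<B}. y_pow (\<tau> * c) * lift_x (g c)))"
      unfolding \<Phi>g by simp
    moreover have "(\<Sum>c<c0. y_pow (\<tau> * c) * lift_x (g c)) = 0"
      using c0_min by simp
    moreover have "(\<Sum>c\<in>{c0<..<B}. y_pow (\<tau> * c) * lift_x (g c)) = y_pow (\<tau> * c0) * (y_pow \<tau> * \<Psi>)"
      unfolding \<Psi>_def sum_distrib_left
    proof (intro sum.cong refl)
      fix c assume c: "c \<in> {c0<..<B}"
      have "\<tau> * c = \<tau> * c0 + (\<tau> + \<tau> * (c - c0 - 1))"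
      proof -
        define k where "k = c - c0 - 1"
        then have "c = c0 + 1 + k"
          using c by simp
        then show ?thesis by (simp add: algebra_simps)
      qed
      then show "y_pow (\<tau> * c) * lift_x (g c) = y_pow (\<tau> * c0) * (y_pow \<tau> * (y_pow (\<tau> * (c - c0 - 1)) * lift_x (g c)))"
        by (metis y_pow_add mult.assoc)
    qed
    ultimately show ?thesis
      by (simp add: algebra_simps)
  qed
  \<comment> \<open>Eliminating x from H and H_y yields \<rho> of degree at most 2 d^2. This bounds
    the power of y lost in each differentiation step.\<close>
  have "\<not> H dvd dY H"
    using Hy dvd_dY_imp_dY_eq_0 by blast
  moreover have "dY H \<in> bibox (Suc d) (Suc d)"
    using bibox_dY[OF H(2)] .
  moreover have H': "H \<in> bibox (degree H + 1) (d + 1)"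
    using bibox_degree_Suc[OF H(2)] by simp
  moreover have degHd: "degree H \<le> d"
    using bibox_degree[OF H(2)] degH by (cases "H = 0") auto
  then have "degree H * d \<le> d * d"
    by (rule mult_right_mono) simp
  then have "degree H * (Suc d - 1) + (Suc d - 1) * d < 2 * d\<^sup>2 + 1"
    unfolding power2_eq_square diff_Suc_1 by linarith
  ultimately obtain u w \<rho> where \<rho>: "u * H + w * dY H = lift_y \<rho>" "\<rho> \<noteq> 0" "degree \<rho> < 2 * d\<^sup>2 + 1"
    using elimination[OF H(1) H' degH, of "dY H" "Suc d" "Suc d" "2 * d\<^sup>2 + 1"] by auto
  show "\<not> H dvd \<Phi>"
  proof
    assume "H dvd \<Phi>"
    moreover have "\<not> H dvd y_pow (\<tau> * c0)"
      using not_dvd_lift_y[OF degH] by simp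
    ultimately have dvd: "H dvd lift_x (g c0) + y_pow \<tau> * \<Psi>"
      using H(1) prime_elem_dvd_mult_iff unfolding \<Phi>c by blast
    show False
    proof (rule sparse_not_vanishing[OF H(1) h \<rho>(1,2) c0 _ dvd])
      show "e < CHAR('k)" if "coeff (g c0) e \<noteq> 0" for e
        using that supp[of c0] E_less[of e] b(3) unfolding B by (auto simp: mult_ac)
      have "order 0 \<rho> \<le> 2 * d\<^sup>2"
        using order_degree[OF \<rho>(2), of 0] \<rho>(3) by simp
      moreover have "card {e. coeff (g c0) e \<noteq> 0} \<le> A * B"
        using card_mono[OF finE supp] cardE by (rule order_trans)
      ultimately have "(card {e. coeff (g c0) e \<noteq> 0} - 1) * (1 + order 0 \<rho>) \<le> (A * B - 1) * (1 + 2 * d\<^sup>2)"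
        by (intro mult_mono) auto
      also have "1 + \<dots> \<le> A * B * (1 + 2 * d\<^sup>2)"
      proof -
        have "A * B \<ge> 1"
          using B1 b(1) by (simp add: A)
        then obtain k where "A * B = Suc k"
          by (metis not0_implies_Suc not_one_le_zero)
        then show ?thesis by simp
      qed
      \<comment> \<open>A B (4 d^2) = (2 d b)^3, which explains the lower bound imposed on
        \<tau>.\<close>
      also have "\<dots> \<le> A * B * (4 * d\<^sup>2)"
        using d by (intro mult_left_mono) (auto simp: power2_eq_square)
      also have "\<dots> = (2 * d * b) ^ 3"
        by (simp add: A B power2_eq_square power3_eq_cube)
      finally show "1 + (card {e. coeff (g c0) e \<noteq> 0} - 1) * (1 + order 0 \<rho>) \<le> \<tau>"
        using b(2) by simp
    qed
  qed
qed

text \<open>Eliminating x from H and \<Phi> leaves a polynomial R(y) of degree below 2 d \<tau> B =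
  4 d^2 b \<tau>. It vanishes to order at least b^2 at the y-coordinate of every solution outside a
  small exceptional set, and comparing the two gives the bound.\<close>

lemma stepanov_prime:
  fixes H :: "'k::{finite,field_gcd} poly poly"
  assumes H: "prime_elem H" "H \<in> bibox (Suc d) (Suc d)" and d: "d \<ge> 1"
    and h: "degree (eval_y 0 H) \<ge> 1" "poly (eval_y 0 H) 0 \<noteq> 0" and Hy: "dY H \<noteq> 0"
    and b: "b \<ge> 1" "(2 * d * b) ^ 3 \<le> \<tau>" "2 * d * b * \<tau> \<le> CHAR('k)"
    and G: "\<And>x. x \<in> G \<Longrightarrow> x ^ \<tau> = 1"
  shows "b * card {y\<in>G. \<exists>x\<in>G. ev2 H x y = 0} \<le> 4 * d\<^sup>2 * \<tau> + 2 * d\<^sup>2 * b"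
proof -
  define A B where "A = b\<^sup>2" and "B = 2 * d * b"
  define I where "I = {..<A} \<times> {..<B} \<times> {..<B}"
  have degH: "degree H \<ge> 1"
    using h(1) degree_map_poly_le[of "\<lambda>q. poly q 0" H] by (simp add: eval_y_def)
  have H0: "H \<noteq> 0" using degH by auto
  have H': "H \<in> bibox (degree H + 1) (d + 1)"
    using bibox_degree_Suc[OF H(2)] by simp
  have degHd: "degree H \<le> d"
    using bibox_degree[OF H(2) H0] by simp
  have A1: "A \<ge> 1" and B1: "B \<ge> 1"
    using b(1) d by (simp_all add: A_def B_def)
  have \<tau>: "\<tau> \<ge> 1"
    using b(2) B1 by (metis B_def one_le_power order_trans)
  have B\<tau>: "B * \<tau> \<le> CHAR('k)"
    using b(3) by (simp add: B_def)
  have AC: "A \<le> CHAR('k)"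
  proof -
    have "A \<le> B ^ 2"
      unfolding A_def using d by (intro power_mono) (auto simp: B_def)
    also have "\<dots> \<le> B ^ 3"
      using B1 by (intro power_increasing) auto
    also have "\<dots> \<le> 1 * \<tau>"
      using b(2) by (simp add: B_def)
    also have "\<dots> \<le> B * \<tau>"
      using B1 by (intro mult_right_mono) auto
    finally show ?thesis using B\<tau> by simp
  qed
  have dC: "d < CHAR('k)"
  proof -
    have "d * 1 < 2 * d * b"
      using d b(1) by (intro mult_less_le_imp_less) auto
    also have "2 * d * b * 1 \<le> B * \<tau>"
      using \<tau> unfolding B_def by (intro mult_left_mono) auto
    finally show ?thesis using B\<tau> by simp
  qed
  obtain \<alpha> where \<alpha>: "\<exists>w\<in>I. \<alpha> w \<noteq> 0"
    and W: "\<And>k. k < A \<Longrightarrow> H dvd (\<Sum>(a, i, j)\<in>I. cst (\<alpha> (a, i, j)) * twist H (\<tau> * i) (\<tau> * j) (x_pow a) k)"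
    using auxiliary_polynomial[OF H(2) H0 d b(1) A_def B_def I_def] by blast
  define \<Phi> where "\<Phi> = (\<Sum>(a, i, j)\<in>I. cst (\<alpha> (a, i, j)) * (x_pow (\<tau> * i) * y_pow (\<tau> * j) * x_pow a))"
  have \<Phi>: "\<not> H dvd \<Phi>" "\<Phi> \<in> bibox (\<tau> * B) (\<tau> * (B - 1) + 1)"
    using stepanov_aux[OF H d h Hy b A_def B_def I_def \<alpha> \<Phi>_def] by auto
  define T where "T = 2 * d * \<tau> * B"
  have T: "degree H * (\<tau> * (B - 1) + 1 - 1) + (\<tau> * B - 1) * d < T"
  proof -
    have "degree H * (\<tau> * (B - 1) + 1 - 1) \<le> d * (\<tau> * B)"
      using degHd by (intro mult_mono) auto
    moreover have "(\<tau> * B - 1) * d < \<tau> * B * d"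
      using \<tau> B1 d by (intro mult_strict_right_mono) auto
    moreover have "T = d * (\<tau> * B) + \<tau> * B * d"
      by (simp add: T_def)
    ultimately show ?thesis
      by linarith
  qed
  obtain u v R where R: "u * H + v * \<Phi> = lift_y R" "R \<noteq> 0" "degree R < T"
    using elimination[OF H(1) H' degH \<Phi>(2) _ _ \<Phi>(1) T] \<tau> B1 by auto
  \<comment> \<open>The degree of H in x is positive and below the characteristic, so the leading
    term survives differentiation.\<close>
  have "pderiv H \<noteq> 0"
  proof
    assume "pderiv H = 0"
    then have "coeff (pderiv H) (degree H - 1) = 0" by simp
    then have "(of_nat (degree H) :: 'k poly) * lead_coeff H = 0"
      using degH by (simp add: coeff_pderiv)
    then have "(of_nat (degree H) :: 'k) = of_nat 0"
      using H0 by (simp add: of_nat_poly)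
    then show False
      using of_nat_neq_CHAR[where ?'k = 'k, of "degree H" 0] degH degHd dC by auto
  qed
  moreover have pH: "pderiv H \<in> bibox (degree H) (d + 1)"
    using bibox_pderiv[of H "degree H"] H' by simp
  ultimately have nd: "\<not> H dvd pderiv H"
    using bibox_dvd_eq_0 by blast
  have Td: "degree H * (d + 1 - 1) + (degree H - 1) * d < 2 * d\<^sup>2 + 1"
  proof -
    have "degree H * d \<le> d * d" "(degree H - 1) * d \<le> d * d"
      using degHd by (intro mult_right_mono; simp)+
    then show ?thesis
      unfolding power2_eq_square add_diff_cancel_right' by linarith
  qed
  obtain u' w \<rho> where \<rho>: "u' * H + w * pderiv H = lift_y \<rho>" "\<rho> \<noteq> 0" "degree \<rho> < 2 * d\<^sup>2 + 1"
    using elimination[OF H(1) H' degH pH degH _ nd Td] by auto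
  define Y where "Y = {y\<in>G. \<exists>x\<in>G. ev2 H x y = 0}"
  \<comment> \<open>Outside these at most 2 d^2 values of y, the identity for \<rho> forces H_x to
    be nonzero at every point of the curve, as reading off the order of R requires.\<close>
  define Z where "Z = {y. poly \<rho> y = 0}"
  have "card Z \<le> 2 * d\<^sup>2" "finite Z"
    using card_poly_roots_bound[OF \<rho>(2)] \<rho>(3) poly_roots_finite[OF \<rho>(2)] by (auto simp: Z_def)
  have ord: "order y R \<ge> A" if y: "y \<in> Y - Z" for y
  proof -
    obtain x where x: "x \<in> G" "y \<in> G" and ev: "ev2 H x y = 0"
      using y by (auto simp: Y_def)
    have nz: "x \<noteq> 0" "y \<noteq> 0"
      using G[OF x(1)] G[OF x(2)] \<tau> by (auto simp: power_0_left)
    have "ev2 (u' * H + w * pderiv H) x y = poly \<rho> y"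
      by (simp add: \<rho>(1))
    moreover have "poly \<rho> y \<noteq> 0"
      using y by (simp add: Z_def)
    ultimately have nzx: "ev2 (pderiv H) x y \<noteq> 0"
      using ev by auto
    have x\<tau>: "x ^ (\<tau> * i) = 1" "y ^ (\<tau> * i) = 1" for i
      using G x by (simp_all add: power_mult)
    have \<Phi>0: "ev2 ((euler H ^^ k) \<Phi>) x y = 0" if "k < A" for k
    proof -
      have "ev2 ((euler H ^^ k) \<Phi>) x y
          = (\<Sum>(a, i, j)\<in>I. \<alpha> (a, i, j) * ev2 (twist H (\<tau> * i) (\<tau> * j) (x_pow a) k) x y)"
        unfolding \<Phi>_def euler_funpow_sum
        by (simp add: case_prod_unfold euler_funpow_cst euler_funpow_twist poly_monom x\<tau>)
      also have "\<dots> = ev2 (\<Sum>(a, i, j)\<in>I. cst (\<alpha> (a, i, j)) * twist H (\<tau> * i) (\<tau> * j) (x_pow a) k) x y"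
        by (simp add: case_prod_unfold)
      also have "\<dots> = 0"
        using W[OF that] ev by (rule ev2_dvd)
      finally show ?thesis .
    qed
    show ?thesis
    proof (rule order_ge_if_euler_vanishes[OF nz nzx R(2) AC])
      fix k assume k: "k < A"
      have "ev2 ((euler H ^^ k) (u * H)) x y = 0"
        by (rule ev2_dvd[OF dvd_euler_funpow[OF dvd_triv_right] ev])
      moreover have "ev2 ((euler H ^^ k) (v * \<Phi>)) x y = 0"
        using \<Phi>0 k by (intro ev2_euler_funpow_mult) auto
      ultimately show "ev2 ((euler H ^^ k) (lift_y R)) x y = 0"
        unfolding R(1)[symmetric] euler_funpow_add by simp
    qed
  qed
  have "A * card (Y - Z) \<le> degree R"
    using sum_order_le_degree(2)[OF R(2) ord A1] by blast
  also have "\<dots> \<le> 2 * d * \<tau> * B"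
    using R(3) by (simp add: T_def)
  finally have "b * (b * card (Y - Z)) \<le> b * (4 * d\<^sup>2 * \<tau>)"
    by (simp add: A_def B_def power2_eq_square mult_ac)
  then have good: "b * card (Y - Z) \<le> 4 * d\<^sup>2 * \<tau>"
    using b(1) by simp
  have "card Y \<le> card ((Y - Z) \<union> Z)"
    by (intro card_mono) auto
  also have "\<dots> \<le> card (Y - Z) + card Z"
    by (rule card_Un_le)
  also have "\<dots> \<le> card (Y - Z) + 2 * d\<^sup>2"
    using \<open>card Z \<le> 2 * d\<^sup>2\<close> by simp
  finally have "b * card Y \<le> b * (card (Y - Z) + 2 * d\<^sup>2)"
    by (rule mult_left_mono) simp
  also have "\<dots> \<le> 4 * d\<^sup>2 * \<tau> + 2 * d\<^sup>2 * b"
    using good by (simp add: distrib_left mult_ac)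
  finally show ?thesis
    by (simp add: Y_def)
qed

lemma card_fibres_le:
  assumes "finite Y" "\<And>y. y \<in> Y \<Longrightarrow> card (F y) \<le> m" "\<And>y. y \<in> Y \<Longrightarrow> finite (F y)"
  shows "card (\<Union>y\<in>Y. (\<lambda>x. (x, y)) ` F y) \<le> m * card Y"
proof -
  have "card (\<Union>y\<in>Y. (\<lambda>x. (x, y)) ` F y) \<le> (\<Sum>y\<in>Y. card ((\<lambda>x. (x, y)) ` F y))"
    by (rule card_UN_le[OF assms(1)])
  also have "\<dots> \<le> (\<Sum>y\<in>Y. m)"
    using assms(2,3) card_image_le by (intro sum_mono) (blast intro: le_trans)
  finally show ?thesis
    by (simp add: mult.commute)
qed

text \<open>
  The auxiliary parameter is \<open>b \<approx> \<tau>\<^bsup>1/3\<^esup> / (2 d)\<close>; for \<open>\<tau> < (2 d)\<^sup>3\<close> the bound is trivial.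
\<close>

lemma card_zeros_prime:
  fixes H :: "'k::{finite,field_gcd} poly poly"
  assumes H: "prime_elem H" "H \<in> bibox (Suc d) (Suc d)" and d: "d \<ge> 1"
    and h: "degree (eval_y 0 H) \<ge> 1" "poly (eval_y 0 H) 0 \<noteq> 0" and Hy: "dY H \<noteq> 0"
    and G: "\<And>x. x \<in> G \<Longrightarrow> x ^ card G = 1" and card: "real (card G) powr (4 / 3) \<le> real CHAR('k)"
  shows "real (card {(x, y)\<in>G \<times> G. ev2 H x y = 0}) \<le> 18 * real d ^ 4 * real (card G) powr (2 / 3)"
proof (cases "G = {}")
  case False
  define \<tau> where "\<tau> = card G"
  define Y where "Y = {y\<in>G. \<exists>x\<in>G. ev2 H x y = 0}"
  define t where "t = real \<tau> powr (1 / 3)"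
  have \<tau>: "\<tau> \<ge> 1" using False by (simp add: \<tau>_def Suc_leI card_gt_0_iff)
  have t1: "t \<ge> 1" using \<tau> by (simp add: t_def ge_one_powr_ge_zero)
  have t3: "t ^ 3 = real \<tau>" "t ^ 2 = real \<tau> powr (2 / 3)" "t ^ 4 = real \<tau> powr (4 / 3)"
    using \<tau> by (simp_all add: t_def flip: powr_numeral powr_powr) (simp_all add: powr_powr)
  have degH: "degree H \<ge> 1"
    using h(1) degree_map_poly_le[of "\<lambda>q. poly q 0" H] by (simp add: eval_y_def)
  have H0: "H \<noteq> 0" using degH by auto
  have degHd: "degree H \<le> d"
    using bibox_degree[OF H(2) H0] by simp
  have nz: "eval_y y H \<noteq> 0" for y
  proof
    assume "eval_y y H = 0"
    then have "[:- y, 1:] dvd coeff H i" for i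
      by (metis coeff_eval_y coeff_0 poly_eq_0_iff_dvd)
    then have "[:[:- y, 1:]:] dvd H"
      by (simp add: const_poly_dvd_iff)
    then obtain Q where Q: "H = [:[:- y, 1:]:] * Q" by (elim dvdE)
    have "\<not> is_unit [:[:- y, 1 :: 'k:]:]"
      by (simp add: is_unit_const_poly_iff is_unit_poly_iff)
    then have "is_unit Q"
      using Q prime_elem_imp_irreducible[OF H(1)] irreducibleD by blast
    then have "degree Q = 0"
      using is_unit_poly_iff[of Q] by auto
    then show False
      using degH unfolding Q by (simp add: degree_mult_eq)
  qed
  have sub: "{(x, y)\<in>G \<times> G. ev2 H x y = 0} \<subseteq> (\<Union>y\<in>Y. (\<lambda>x. (x, y)) ` {x. poly (eval_y y H) x = 0})"
    unfolding Y_def ev2_def by auto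
  have fin: "finite (\<Union>y\<in>Y. (\<lambda>x. (x, y)) ` {x. poly (eval_y y H) x = 0})"
    by (rule finite_subset[of _ UNIV]) auto
  have roots: "card {x. poly (eval_y y H) x = 0} \<le> d" for y
    using card_poly_roots_bound[OF nz[of y]] degree_map_poly_le[of "\<lambda>q. poly q y" H] degHd
    by (simp add: eval_y_def)
  have "card {(x, y)\<in>G \<times> G. ev2 H x y = 0} \<le> d * card Y"
  proof -
    have "card (\<Union>y\<in>Y. (\<lambda>x. (x, y)) ` {x. poly (eval_y y H) x = 0}) \<le> d * card Y"
      by (rule card_fibres_le) (simp_all add: roots)
    then show ?thesis
      using card_mono[OF fin sub] by linarith
  qed
  then have "real (card {(x, y)\<in>G \<times> G. ev2 H x y = 0}) \<le> real (d * card Y)"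
    by (simp only: of_nat_le_iff)
  then have N: "real (card {(x, y)\<in>G \<times> G. ev2 H x y = 0}) \<le> real d * real (card Y)"
    by simp
  have "real (card Y) \<le> 18 * real d ^ 3 * t ^ 2"
  proof (cases "t < 2 * real d")
    case True
    have "card Y \<le> \<tau>"
      unfolding \<tau>_def Y_def by (rule card_mono) auto
    then have "real (card Y) \<le> t * t ^ 2"
      using t3(1) by (simp add: power3_eq_cube power2_eq_square)
    also have "\<dots> \<le> (2 * real d) * t ^ 2"
      using True by (intro mult_right_mono) auto
    also have "\<dots> \<le> 18 * real d ^ 3 * t ^ 2"
    proof (intro mult_right_mono)
      have "real d \<le> real d ^ 3" "0 \<le> real d ^ 3"
        using d by (simp_all add: self_le_power)
      then show "2 * real d \<le> 18 * real d ^ 3" by linarith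
    qed simp
    finally show ?thesis .
  next
    case False
    define b where "b = nat \<lfloor>t / (2 * real d)\<rfloor>"
    have td: "t / (2 * real d) \<ge> 1"
      using False d by (simp add: field_simps)
    have fl: "1 \<le> \<lfloor>t / (2 * real d)\<rfloor>"
      using td by simp
    then have "real b = real_of_int \<lfloor>t / (2 * real d)\<rfloor>"
      by (simp add: b_def)
    then have b1: "b \<ge> 1" and b_le: "real b \<le> t / (2 * real d)" and "t / (2 * real d) \<le> 2 * real b"
      using fl by linarith+
    then have b_ge: "t / (4 * real d) \<le> real b"
      by (simp add: field_simps)
    have db: "real (2 * d * b) \<le> t"
      using b_le d by (simp add: field_simps)
    have "real ((2 * d * b) ^ 3) \<le> t ^ 3"
      using power_mono[OF db, of 3] by simp
    then have 1: "(2 * d * b) ^ 3 \<le> \<tau>"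
      unfolding t3 of_nat_le_iff .
    \<comment> \<open>The exponent 4/3 of the hypothesis enters here: 2 d b <= t and \<tau> = t^3,
      so the degrees in question are at most t^4.\<close>
    have "real (2 * d * b * \<tau>) \<le> t * t ^ 3"
      using mult_right_mono[OF db, of "real \<tau>"] by (simp add: t3)
    also have "\<dots> = t ^ 4" by (simp add: power4_eq_xxxx power3_eq_cube)
    also have "\<dots> \<le> real CHAR('k)"
      using card unfolding t3 \<tau>_def .
    finally have 2: "2 * d * b * \<tau> \<le> CHAR('k)"
      by (simp only: of_nat_le_iff)
    have Y: "b * card Y \<le> 4 * d\<^sup>2 * \<tau> + 2 * d\<^sup>2 * b"
      unfolding Y_def by (rule stepanov_prime[OF H d h Hy b1 1 2]) (use G in \<open>simp add: \<tau>_def\<close>)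
    have "real (b * card Y) \<le> real (4 * d\<^sup>2 * \<tau> + 2 * d\<^sup>2 * b)"
      unfolding of_nat_le_iff by (rule Y)
    then have "real b * real (card Y) \<le> 4 * real d ^ 2 * real \<tau> + 2 * real d ^ 2 * real b"
      by simp
    also have "real \<tau> = (t / (4 * real d)) * (4 * real d * t ^ 2)"
      using d by (simp flip: t3(1) add: power3_eq_cube power2_eq_square)
    also have "4 * real d ^ 2 * (t / (4 * real d) * (4 * real d * t ^ 2)) \<le> 4 * real d ^ 2 * (real b * (4 * real d * t ^ 2))"
      using b_ge by (intro mult_left_mono mult_right_mono) auto
    also have "2 * real d ^ 2 * real b \<le> real b * (2 * real d ^ 3 * t ^ 2)"
    proof -
      have "real d ^ 2 * 1 \<le> real d ^ 3 * t ^ 2"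
        using d t1 by (intro mult_mono power_increasing one_le_power) auto
      then show ?thesis
        using mult_left_mono[of "real d ^ 2" "real d ^ 3 * t ^ 2" "2 * real b"] by (simp add: mult_ac)
    qed
    \<comment> \<open>18 = 16 + 2: the first summand is 4 d^2 times the 4 d lost in rounding b down,
      the second stems from the exceptional values of y.\<close>
    finally have "real b * real (card Y) \<le> real b * (18 * real d ^ 3 * t ^ 2)"
      by (simp add: power3_eq_cube power2_eq_square algebra_simps)
    then show ?thesis
      using b1 by simp
  qed
  then have "real d * real (card Y) \<le> real d * (18 * real d ^ 3 * t ^ 2)"
    by (rule mult_left_mono) simp
  also have "\<dots> = 18 * real d ^ 4 * t ^ 2"
    by (simp add: power4_eq_xxxx power3_eq_cube)
  finally show ?thesis
    using N by (simp only: t3(2) \<tau>_def)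
qed simp

section \<open>From irreducible to arbitrary curves\<close>

lemma coeff_mult_top:
  assumes "degree p \<le> m" "degree q \<le> l"
  shows "coeff (p * q) (m + l) = coeff p m * coeff q l"
proof -
  have "coeff (p * q) (m + l) = (\<Sum>i\<le>m + l. if i = m then coeff p m * coeff q l else 0)"
    unfolding coeff_mult
  proof (intro sum.cong refl)
    fix i
    show "coeff p i * coeff q (m + l - i) = (if i = m then coeff p m * coeff q l else 0)"
      using assms by (cases i m rule: linorder_cases) (auto simp: coeff_eq_0)
  qed
  then show ?thesis
    by simp
qed

definition coeff_y :: "nat \<Rightarrow> 'k::comm_ring_1 poly poly \<Rightarrow> 'k poly" where
  "coeff_y l P = map_poly (\<lambda>q. coeff q l) P"

lemma coeff_coeff_y: "coeff (coeff_y l P) i = coeff (coeff P i) l"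
  by (simp add: coeff_y_def coeff_map_poly)

lemma coeff_y_0 [simp]: "coeff_y l 0 = 0"
  by (simp add: coeff_y_def)

lemma coeff_y_add: "coeff_y l (P + Q) = coeff_y l P + coeff_y l Q"
  by (rule poly_eqI) (simp add: coeff_coeff_y)

lemma coeff_y_diff: "coeff_y l (P - Q) = coeff_y l P - coeff_y l Q"
  by (rule poly_eqI) (simp add: coeff_coeff_y)

lemma coeff_y_sum: "coeff_y l (sum f I) = (\<Sum>i\<in>I. coeff_y l (f i))"
  by (induction I rule: infinite_finite_induct) (simp_all add: coeff_y_add)

lemma coeff_y_lift_x_mult: "coeff_y l (lift_x h * Q) = h * coeff_y l Q"
  by (rule poly_eqI) (simp add: coeff_coeff_y coeff_lift_x coeff_mult coeff_sum)

lemma coeff_y_y_pow: "coeff_y l (y_pow m) = (if l = m then 1 else 0)"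
  by (rule poly_eqI) (auto simp: coeff_coeff_y lift_y_def coeff_pCons one_pCons split: nat.splits)

lemma coeff_y_mult_top:
  fixes P Q :: "'k::idom poly poly"
  assumes "\<And>i. degree (coeff P i) \<le> m" "\<And>i. degree (coeff Q i) \<le> l"
  shows "coeff_y (m + l) (P * Q) = coeff_y m P * coeff_y l Q"
  by (rule poly_eqI) (simp add: coeff_coeff_y coeff_mult[of P] coeff_mult[of "coeff_y m P"] coeff_sum
      coeff_mult_top[OF assms])

lemma ex_top_coeff_y:
  fixes P :: "'k::idom poly poly"
  assumes "P \<noteq> 0"
  obtains m where "\<And>i. degree (coeff P i) \<le> m" "coeff_y m P \<noteq> 0"
proof -
  define I where "I = {i. coeff P i \<noteq> 0}"
  have "finite I"
    unfolding I_def by (rule finite_subset[of _ "{..degree P}"]) (auto intro: le_degree)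
  moreover have "I \<noteq> {}"
    using assms by (auto simp: I_def poly_eq_iff)
  ultimately obtain i0 where i0: "i0 \<in> I" and max: "\<And>i. i \<in> I \<Longrightarrow> degree (coeff P i) \<le> degree (coeff P i0)"
    using obtains_MAX[of I "\<lambda>i. degree (coeff P i)"] by (metis Max_ge finite_imageI imageI)
  show thesis
  proof (rule that)
    show "degree (coeff P i) \<le> degree (coeff P i0)" for i
      using max[of i] by (cases "i \<in> I") (auto simp: I_def)
    have "coeff (coeff_y (degree (coeff P i0)) P) i0 \<noteq> 0"
      using i0 by (simp add: I_def coeff_coeff_y)
    then show "coeff_y (degree (coeff P i0)) P \<noteq> 0"
      by auto
  qed
qed

text \<open>Over a domain both partial degrees are additive. The degree in y is the largest index
  with nonzero \<open>coeff_y\<close>, and these top coefficients multiply.\<close>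

lemma bibox_dvd:
  fixes F H :: "'k::idom poly poly"
  assumes "F \<in> bibox a b" "F \<noteq> 0" "H dvd F"
  shows "H \<in> bibox a b"
proof -
  obtain Q where F: "F = H * Q"
    using assms by (elim dvdE)
  then have nz: "H \<noteq> 0" "Q \<noteq> 0"
    using assms by auto
  obtain m where m: "\<And>i. degree (coeff H i) \<le> m" "coeff_y m H \<noteq> 0"
    using ex_top_coeff_y[OF nz(1)] by blast
  obtain l where l: "\<And>i. degree (coeff Q i) \<le> l" "coeff_y l Q \<noteq> 0"
    using ex_top_coeff_y[OF nz(2)] by blast
  have "coeff_y (m + l) F \<noteq> 0"
    unfolding F coeff_y_mult_top[OF m(1) l(1)] using m l by simp
  then obtain i where "coeff (coeff F i) (m + l) \<noteq> 0"
    by (auto simp: poly_eq_iff coeff_coeff_y)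
  then have "m + l < b"
    using assms(1) by (auto simp: bibox_def)
  moreover have "degree H \<le> degree F"
    using assms dvd_imp_degree_le by blast
  then have "degree H < a"
    using bibox_degree[OF assms(1,2)] by simp
  moreover have "degree (coeff H i) \<le> m + l" for i
    using m(1)[of i] by simp
  ultimately show ?thesis
    by (intro bibox_I) (meson order_le_less_trans)
qed

lemma card_set_mset_le_size: "card (set_mset M) \<le> size M"
  using size_mset_mono[OF mset_set_set_mset_msubset[of M]] by simp

text \<open>The hypotheses are shaped so that each prime factor H inherits what
  \<open>card_zeros_prime\<close> asks for. The values at the origin and the leading coefficients
  are multiplicative; the exclusion of factors in one variable gives positive degree in x and H_y
  nonzero. The additional d bounds the number of distinct prime factors.\<close>

lemma card_zeros:
  fixes F :: "'k::{finite,field_gcd} poly poly"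
  assumes F: "F \<in> bibox (Suc d) (Suc d)" and d: "d \<ge> 1" "d < CHAR('k)"
    and F00: "ev2 F 0 0 \<noteq> 0" and lc: "poly (lead_coeff F) 0 \<noteq> 0"
    and no_y: "\<And>h. prime_elem (lift_y h) \<Longrightarrow> \<not> lift_y h dvd F"
    and no_x: "\<And>h. prime_elem (lift_x h) \<Longrightarrow> \<not> lift_x h dvd F"
    and G: "\<And>x. x \<in> G \<Longrightarrow> x ^ card G = 1" and card: "real (card G) powr (4 / 3) \<le> real CHAR('k)"
  shows "real (card {(x, y)\<in>G \<times> G. ev2 F x y = 0}) \<le> 18 * real d ^ 5 * real (card G) powr (2 / 3)"
proof -
  define M where "M = prime_factorization F"
  define C where "C = 18 * real d ^ 4 * real (card G) powr (2 / 3)"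
  have F0: "F \<noteq> 0" using F00 by auto
  have M: "prime_elem H" "H dvd F" "degree H \<ge> 1" if "H \<in># M" for H
  proof -
    show 1: "prime_elem H" "H dvd F"
      using that by (auto simp: M_def in_prime_factors_iff prime_def)
    show "degree H \<ge> 1"
    proof (rule ccontr)
      assume "\<not> ?thesis"
      then obtain h where "H = lift_y h"
        by (metis degree_eq_zeroE less_one linorder_not_le lift_y_def)
      then show False
        using 1 no_y by simp
    qed
  qed
  have FM: "F dvd prod_mset M" "prod_mset M dvd F"
    using prod_mset_prime_factorization_weak[OF F0] unfolding M_def
    by (metis dvd_normalize_iff dvd_refl normalize_dvd_iff)+
  have "size M \<le> degree F"
  proof -
    have "size M' \<le> degree (prod_mset M') \<and> prod_mset M' \<noteq> 0" if "\<forall>H\<in>#M'. degree H \<ge> 1" for M' :: "'k poly poly multiset"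
      using that
    proof (induction M')
      case (add H M')
      then have "H \<noteq> 0" by auto
      then show ?case
        using add by (simp add: degree_mult_eq)
    qed simp
    then have "size M \<le> degree (prod_mset M)"
      using M(3) by blast
    also have "\<dots> \<le> degree F"
      using FM(2) F0 by (rule dvd_imp_degree_le)
    finally show ?thesis .
  qed
  then have cM: "card (set_mset M) \<le> d"
    using card_set_mset_le_size[of M] bibox_degree[OF F F0] by simp
  have bound: "real (card {(x, y)\<in>G \<times> G. ev2 H x y = 0}) \<le> C" if HM: "H \<in># M" for H
    unfolding C_def
  proof (rule card_zeros_prime[OF M(1)[OF HM] bibox_dvd[OF F F0 M(2)[OF HM]] d(1) _ _ _ G card])
    obtain Q where Q: "F = H * Q"
      using M(2)[OF HM] by (elim dvdE)
    have "poly (lead_coeff H) 0 \<noteq> 0"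
      using lc unfolding Q by (auto simp: lead_coeff_mult)
    then have "coeff (eval_y 0 H) (degree H) \<noteq> 0"
      by (simp add: coeff_eval_y)
    then show "degree (eval_y 0 H) \<ge> 1"
      using M(3)[OF HM] le_degree by (meson order_trans)
    show "poly (eval_y 0 H) 0 \<noteq> 0"
      using F00 unfolding Q by (simp add: ev2_def eval_y_mult)
    \<comment> \<open>For degrees below the characteristic, H_y = 0 means that y does not occur in
      H, and then H is an excluded factor.\<close>
    show "dY H \<noteq> 0"
    proof
      assume dH: "dY H = 0"
      have "H = lift_x (eval_y 0 H)"
      proof (rule poly_eqI)
        fix i
        have deg: "degree (coeff H i) \<le> d"
          using bibox_degree_coeff[OF bibox_dvd[OF F F0 M(2)[OF HM]], of i] by (cases "coeff H i = 0") auto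
        have pd: "pderiv (coeff H i) = 0"
          using arg_cong[OF dH, of "\<lambda>p. coeff p i"] by (simp add: coeff_map_poly)
        have "coeff (coeff H i) (Suc j) = 0" for j
        proof (cases "Suc j \<le> d")
          case True
          have "(of_nat (Suc j) :: 'k) \<noteq> of_nat 0"
            using True d(2) by (intro of_nat_neq_CHAR) auto
          moreover have "of_nat (Suc j) * coeff (coeff H i) (Suc j) = 0"
            using arg_cong[OF pd, of "\<lambda>p. coeff p j"] by (simp add: coeff_pderiv)
          ultimately show ?thesis
            by (simp del: of_nat_Suc)
        next
          case False
          then show ?thesis
            using deg by (intro coeff_eq_0) auto
        qed
        then show "coeff H i = coeff (lift_x (eval_y 0 H)) i"
          by (auto simp: poly_eq_iff coeff_lift_x coeff_eval_y coeff_pCons poly_0_coeff_0 split: nat.splits)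
      qed
      then show False
        using no_x M(1,2)[OF HM] by metis
    qed
  qed
  have "{(x, y)\<in>G \<times> G. ev2 F x y = 0} \<subseteq> (\<Union>H\<in>set_mset M. {(x, y)\<in>G \<times> G. ev2 H x y = 0})"
  proof clarify
    fix x y assume xy: "x \<in> G" "y \<in> G" and "ev2 F x y = 0"
    then have "ev2 (prod_mset M) x y = 0"
      using ev2_dvd[OF FM(1)] by blast
    moreover have "ev2 (prod_mset M') x y = prod_mset (image_mset (\<lambda>H. ev2 H x y) M')" for M'
      using ev2_of_nat[of 1 x y] by (induction M') simp_all
    ultimately have "0 \<in># image_mset (\<lambda>H. ev2 H x y) M"
      by simp
    then show "(x, y) \<in> (\<Union>H\<in>set_mset M. {(x, y)\<in>G \<times> G. ev2 H x y = 0})"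
      using xy by auto
  qed
  then have "card {(x, y)\<in>G \<times> G. ev2 F x y = 0} \<le> card (\<Union>H\<in>set_mset M. {(x, y)\<in>G \<times> G. ev2 H x y = 0})"
    by (intro card_mono) (auto intro: finite_subset[of _ UNIV])
  also have "\<dots> \<le> (\<Sum>H\<in>set_mset M. card {(x, y)\<in>G \<times> G. ev2 H x y = 0})"
    by (rule card_UN_le) simp
  finally have "real (card {(x, y)\<in>G \<times> G. ev2 F x y = 0}) \<le> (\<Sum>H\<in>set_mset M. real (card {(x, y)\<in>G \<times> G. ev2 H x y = 0}))"
    by (simp flip: of_nat_sum)
  also have "\<dots> \<le> (\<Sum>H\<in>set_mset M. C)"
    by (intro sum_mono bound)
  also have "\<dots> \<le> real d * C"
    using cM by (simp add: C_def mult_right_mono)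
  also have "\<dots> = 18 * real d ^ 5 * real (card G) powr (2 / 3)"
    by (simp add: C_def eval_nat_numeral)
  finally show ?thesis .
qed

lemma is_unit_cst: "c \<noteq> 0 \<Longrightarrow> is_unit (cst c)" for c :: "'k::field"
  by (simp add: lift_y_def is_unit_const_poly_iff is_unit_poly_iff)

lemma prime_not_dvd_cst: "prime_elem H \<Longrightarrow> c \<noteq> 0 \<Longrightarrow> \<not> H dvd cst c" for c :: "'k::field"
  using is_unit_cst[of c] dvd_trans prime_elem_not_unit by blast

lemma cst_1 [simp]: "cst 1 = 1"
  by (simp add: lift_y_def one_pCons)

lemma cst_mult: "cst (a * b) = cst a * cst b"
  by (simp add: lift_y_def)

lemma cst_power: "cst (a ^ n) = cst a ^ n"
  by (induction n) (simp_all add: cst_mult)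

lemma cst_uminus: "cst (- a) = - cst a"
  by (simp add: lift_y_def)

text \<open>Modulo H, V becomes -a and W becomes -b, and a nonzero constant is not divisible by a
  prime. It serves to exclude factors of \<open>sum_curve\<close> in a single variable.\<close>

lemma prime_dvd_both:
  fixes a b :: "'k::field"
  assumes "prime_elem H" "H dvd V + cst a" "H dvd W + cst b" "V ^ j = W ^ i"
  shows "(- a) ^ j = (- b) ^ i"
proof (rule ccontr)
  assume ne: "(- a) ^ j \<noteq> (- b) ^ i"
  have pow: "H dvd V ^ n - cst ((- c) ^ n)" if "H dvd V + cst c" for V c n
  proof -
    have "V - cst (- c) dvd V ^ n - cst (- c) ^ n"
      by (metis dvd_triv_left power_diff_sumr2)
    then show ?thesis
      using that dvd_trans by (simp add: cst_power cst_uminus)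
  qed
  have "H dvd (W ^ i - cst ((- b) ^ i)) - (V ^ j - cst ((- a) ^ j))"
    by (rule dvd_diff[OF pow[OF assms(3)] pow[OF assms(2)]])
  then have "H dvd cst ((- a) ^ j - (- b) ^ i)"
    using assms(4) by (simp add: cst_diff)
  then show False
    using prime_not_dvd_cst[OF assms(1)] ne by simp
qed

lemma lift_x_of_nat: "lift_x (of_nat m) = of_nat m"
  by (induction m) (simp_all add: lift_x_add)

lemma lift_x_power: "lift_x (a ^ m) = lift_x a ^ m"
  by (induction m) (simp_all add: lift_x_mult)

lemma lift_x_const: "lift_x [:c:] = cst c"
  by (rule poly_eqI) (simp add: coeff_lift_x lift_y_def coeff_pCons split: nat.splits)

lemma lift_y_of_nat: "lift_y (of_nat m) = of_nat m"
  by (simp add: lift_y_def of_nat_poly)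

lemma lift_y_power: "lift_y (a ^ m) = lift_y a ^ m"
  by (induction m) (simp_all add: lift_y_mult)

lemma lift_y_diff: "lift_y (a - b) = lift_y a - lift_y b"
  by (simp add: lift_y_def)

section \<open>Two families of curves\<close>

lemma choose_pred: "1 \<le> n \<Longrightarrow> n choose (n - 1) = n"
  by (cases n) simp_all

lemma coeff_const_plus_monom_power:
  fixes A s :: "'a::comm_ring_1"
  shows "coeff (([:A:] + monom s i) ^ n) e
    = (\<Sum>k\<le>n. if i * k = e then of_nat (n choose k) * s ^ k * A ^ (n - k) else 0)"
proof -
  have "([:A:] + monom s i) ^ n = (\<Sum>k\<le>n. of_nat (n choose k) * monom s i ^ k * [:A:] ^ (n - k))"
    unfolding add.commute[of "[:A:]"] by (rule binomial_ring)
  also have "\<dots> = (\<Sum>k\<le>n. monom (of_nat (n choose k) * s ^ k * A ^ (n - k)) (i * k))"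
    by (intro sum.cong refl) (simp add: monom_power poly_const_pow of_nat_poly smult_monom mult_ac)
  finally show ?thesis
    by (simp add: coeff_sum)
qed

lemma coeff_y_lift_x_plus_power:
  "coeff_y e ((lift_x a + y_pow i) ^ n) = (\<Sum>k\<le>n. if i * k = e then of_nat (n choose k) * a ^ (n - k) else 0)"
proof -
  have y: "y_pow i ^ k = (y_pow (i * k) :: 'a poly poly)" for k
    by (induction k) (simp_all add: y_pow_add)
  have "(lift_x a + y_pow i) ^ n = (\<Sum>k\<le>n. of_nat (n choose k) * y_pow i ^ k * lift_x a ^ (n - k))"
    unfolding add.commute[of "lift_x a"] by (rule binomial_ring)
  also have "\<dots> = (\<Sum>k\<le>n. lift_x (of_nat (n choose k) * a ^ (n - k)) * y_pow (i * k))"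
    by (intro sum.cong refl) (simp add: lift_x_mult lift_x_of_nat lift_x_power y mult_ac)
  finally show ?thesis
    by (simp add: coeff_y_sum coeff_y_lift_x_mult coeff_y_y_pow if_distrib cong: if_cong) (simp add: eq_commute)
qed

lemma sum_multiples:
  fixes f :: "nat \<Rightarrow> 'a::comm_monoid_add"
  assumes "i \<ge> 1" "k \<le> n"
  shows "(\<Sum>k'\<le>n. if i * k' = i * k then f k' else 0) = f k"
  using assms by (simp add: sum.delta)

lemma sum_no_multiple:
  fixes f :: "nat \<Rightarrow> 'a::comm_monoid_add"
  assumes "\<And>k. k \<le> n \<Longrightarrow> i * k \<noteq> e"
  shows "(\<Sum>k\<le>n. if i * k = e then f k else 0) = 0"
  using assms by (intro sum.neutral) auto

lemma mult_pred_not_multiple: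
  fixes i j k :: nat
  assumes "1 \<le> i" "i < j"
  shows "j * k \<noteq> i * (j - 1)"
proof
  assume "j * k = i * (j - 1)"
  then have "j * k + i = i * j"
    using assms by (cases j) auto
  then have "j dvd i"
    by (metis dvd_add_right_iff dvd_triv_left dvd_triv_right)
  then show False
    using assms by (auto dest: dvd_imp_le)
qed

lemma diff_powers_exponents:
  fixes i j k e :: nat
  assumes "1 \<le> i" "i < j" "e > i * (j - 1)" "e \<noteq> i * j"
  shows "k \<le> j \<Longrightarrow> i * k \<noteq> e" "k \<le> i \<Longrightarrow> j * k \<noteq> e"
proof -
  show "i * k \<noteq> e" if "k \<le> j"
  proof (cases "k = j")
    case False
    then have "i * k \<le> i * (j - 1)"
      using that by (intro mult_left_mono) auto
    then show ?thesis using assms(3) by linarith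
  qed (use assms in simp)
  show "j * k \<noteq> e" if "k \<le> i"
  proof (cases "k = i")
    case False
    then have "j * k \<le> j * (i - 1)"
      using that by (intro mult_left_mono) auto
    also have "\<dots> \<le> i * (j - 1)"
      using assms by (simp add: diff_mult_distrib2 mult.commute)
    finally show ?thesis using assms(3) by linarith
  qed (use assms in \<open>simp add: mult.commute\<close>)
qed

text \<open>The second power contributes only in degrees divisible by j, and i (j - 1) is none of
  them. For A = 0 the first power contributes only in degree i j, so the position j (i - 1) isolates
  B. For s = 1 the terms of degree i j cancel, and i (j - 1) becomes the degree when j A is
  nonzero.\<close>

lemma coeff_diff_powers:
  fixes A B s :: "'a::comm_ring_1"
  assumes ij: "1 \<le> i" "i < j"
  defines "P \<equiv> ([:A:] + monom s i) ^ j - ([:B:] + monom s j) ^ i"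
  shows "coeff P (i * (j - 1)) = of_nat j * s ^ (j - 1) * A"
    and "e > i * (j - 1) \<Longrightarrow> e \<noteq> i * j \<Longrightarrow> coeff P e = 0"
    and "coeff P (i * j) = s ^ j - s ^ i"
    and "coeff P 0 = A ^ j - B ^ i"
    and "A = 0 \<Longrightarrow> coeff P (j * (i - 1)) = - (of_nat i * s ^ (i - 1) * B)"
proof -
  note c = coeff_const_plus_monom_power
  have "coeff (([:A:] + monom s i) ^ j) (i * (j - 1)) = of_nat j * s ^ (j - 1) * A"
    unfolding c using ij by (subst sum_multiples) (simp_all add: choose_pred[unfolded One_nat_def])
  moreover have "coeff (([:B:] + monom s j) ^ i) (i * (j - 1)) = 0"
    unfolding c using mult_pred_not_multiple[OF ij] by (intro sum_no_multiple) auto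
  ultimately show "coeff P (i * (j - 1)) = of_nat j * s ^ (j - 1) * A"
    by (simp add: P_def)
  show "coeff P e = 0" if "e > i * (j - 1)" "e \<noteq> i * j"
    using diff_powers_exponents[OF ij that] by (simp add: P_def c sum_no_multiple)
  have "coeff (([:A:] + monom s i) ^ j) (i * j) = s ^ j"
    unfolding c using ij by (subst sum_multiples) auto
  moreover have "coeff (([:B:] + monom s j) ^ i) (j * i) = s ^ i"
    unfolding c using ij by (subst sum_multiples) auto
  ultimately show "coeff P (i * j) = s ^ j - s ^ i"
    by (simp add: P_def mult.commute)
  show "coeff P 0 = A ^ j - B ^ i"
    using c[of A s i j "i * 0"] c[of B s j i "j * 0"] ij unfolding P_def
    by (simp only: sum_multiples[of i 0 j] sum_multiples[of j 0 i]) (simp add: sum_multiples)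
  show "coeff P (j * (i - 1)) = - (of_nat i * s ^ (i - 1) * B)" if "A = 0"
  proof -
    have "coeff (([:A:] + monom s i) ^ j) (j * (i - 1)) = 0"
    proof -
      have "j * (i - 1) \<noteq> i * j"
        using ij by (cases i) auto
      then show ?thesis
        unfolding c using that by (intro sum.neutral) (auto simp: power_0_left)
    qed
    moreover have "coeff (([:B:] + monom s j) ^ i) (j * (i - 1)) = of_nat i * s ^ (i - 1) * B"
      unfolding c using ij by (subst sum_multiples) (simp_all add: choose_pred[unfolded One_nat_def])
    ultimately show ?thesis
      by (simp add: P_def)
  qed
qed

lemma x_pow_eq_monom: "x_pow i = monom 1 i"
  by (rule poly_eqI) (simp add: coeff_lift_x one_pCons)

lemma of_nat_neq_0_CHAR: "0 < n \<Longrightarrow> n < CHAR('k::idom) \<Longrightarrow> (of_nat n :: 'k) \<noteq> 0"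
  using of_nat_neq_CHAR[of n 0, where ?'k = 'k] by simp

lemma bibox_power:
  fixes P :: "'k::comm_ring_1 poly poly"
  assumes "P \<in> bibox (Suc a) (Suc a)"
  shows "P ^ n \<in> bibox (Suc (a * n)) (Suc (a * n))"
proof (induction n)
  case 0
  then show ?case by (simp add: bibox_def one_pCons coeff_pCons split: nat.splits)
next
  case (Suc n)
  then show ?case
    using bibox_mult_Suc[OF assms Suc] by (simp add: add.commute)
qed

text \<open>The elimination of z from z^i = x^i + y^i + a and z^j = x^j + y^j + b, through (z^i)^j =
  (z^j)^i.\<close>

definition sum_curve :: "nat \<Rightarrow> nat \<Rightarrow> 'k::comm_ring_1 \<Rightarrow> 'k \<Rightarrow> 'k poly poly" where
  "sum_curve i j a b = (x_pow i + y_pow i + cst a) ^ j - (x_pow j + y_pow j + cst b) ^ i"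

lemma sum_curve_x:
  "sum_curve i j a b = ([:monom 1 i + [:a:]:] + monom 1 i) ^ j - ([:monom 1 j + [:b:]:] + monom 1 j) ^ i"
proof -
  have "x_pow n + y_pow n + cst c = [:monom 1 n + [:c:]:] + monom (1 :: 'a poly) n" for n c
    by (simp add: x_pow_eq_monom lift_y_def add_ac)
  then show ?thesis
    by (simp add: sum_curve_def)
qed

lemma sum_curve_y:
  "sum_curve i j a b = (lift_x (monom 1 i + [:a:]) + y_pow i) ^ j - (lift_x (monom 1 j + [:b:]) + y_pow j) ^ i"
proof -
  show ?thesis
    by (simp add: sum_curve_def lift_x_add lift_x_const add_ac)
qed

lemma bibox_x_pow: "x_pow n \<in> bibox (Suc n) 1"
  by (rule bibox_lift_x) (auto split: if_splits)

lemma bibox_y_pow: "y_pow n \<in> bibox 1 (Suc n)"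
  by (rule bibox_lift_y) (metis degree_monom_le less_Suc_eq_le)

lemma bibox_cst: "cst c \<in> bibox 1 1"
  by (rule bibox_lift_y) simp

lemma bibox_sum_curve:
  fixes a b :: "'k::comm_ring_1"
  shows "sum_curve i j a b \<in> bibox (Suc (i * j)) (Suc (i * j))"
proof -
  have "x_pow n + y_pow n + cst c \<in> bibox (Suc n) (Suc n)" for n and c :: 'k
    using bibox_mono[OF bibox_x_pow[of n, where 'a = 'k], of "Suc n" "Suc n"]
      bibox_mono[OF bibox_y_pow[of n, where 'a = 'k], of "Suc n" "Suc n"]
      bibox_mono[OF bibox_cst[of c], of "Suc n" "Suc n"]
    by (intro bibox_add) auto
  from bibox_power[OF this, of i a j] bibox_power[OF this, of j b i] show ?thesis
    unfolding sum_curve_def by (intro bibox_diff) (simp_all add: mult.commute)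
qed

text \<open>The conditions on a and b match those of \<open>card_zeros\<close>: a^j and b^i differ
  because the origin must be off the curve; the leading coefficient in x is j (y^i + a), nonzero at
  y = 0 as a is nonzero; the inequality with signs says that y^i + a and y^j + b have no common
  prime factor, which a factor of the curve in one variable would be.\<close>

lemma card_zeros_sum_curve:
  fixes a b :: "'k::{finite,field_gcd}"
  assumes ij: "1 \<le> i" "i < j" "i * j < CHAR('k)"
    and a: "a \<noteq> 0" and ab: "a ^ j \<noteq> b ^ i" "(- a) ^ j \<noteq> (- b) ^ i"
    and G: "\<And>x. x \<in> G \<Longrightarrow> x ^ card G = 1" and card: "real (card G) powr (4 / 3) \<le> real CHAR('k)"
  shows "real (card {(x, y)\<in>G \<times> G. ev2 (sum_curve i j a b) x y = 0})
    \<le> 18 * real (i * j) ^ 5 * real (card G) powr (2 / 3)"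
proof (rule card_zeros[OF bibox_sum_curve _ ij(3) _ _ _ _ G card])
  define F where "F = sum_curve i j a b"
  define A where "A = monom 1 i + [:a:]"
  define B where "B = monom 1 j + [:b:]"
  have Fx: "F = ([:A:] + monom 1 i) ^ j - ([:B:] + monom 1 j) ^ i"
    by (simp add: F_def sum_curve_x A_def B_def)
  note coeffs = coeff_diff_powers[OF ij(1,2), where A = A and B = B and s = 1, folded Fx]
  have ne: "i * (j - 1) < i * j" and j: "1 * j \<le> i * j"
    using ij by (auto intro: mult_right_mono)
  show "1 \<le> i * j" using ij by simp
  show "ev2 (sum_curve i j a b) 0 0 \<noteq> 0"
  proof -
    have pw: "ev2 (P ^ n) x y = ev2 P x y ^ n" for P :: "'k poly poly" and n x y
      using ev2_of_nat[of 1 x y] by (induction n) simp_all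
    show ?thesis
      using ab(1) ij by (simp add: sum_curve_def pw poly_monom power_0_left)
  qed
  have jnz: "(of_nat j :: 'k) \<noteq> 0"
    using ij j by (intro of_nat_neq_0_CHAR) linarith+
  have coeff1: "coeff F (i * (j - 1)) = of_nat j * A"
    using coeffs(1) by simp
  have Anz: "poly A 0 = a"
    using ij by (simp add: A_def poly_monom power_0_left)
  have deg: "degree F = i * (j - 1)"
  proof (rule antisym)
    show "degree F \<le> i * (j - 1)"
    proof (rule degree_le, clarify)
      fix e assume "i * (j - 1) < e"
      then show "coeff F e = 0"
        using coeffs(2,3) by (cases "e = i * j") auto
    qed
    show "i * (j - 1) \<le> degree F"
      using coeff1 jnz Anz a by (intro le_degree) (auto simp: of_nat_poly)
  qed
  then show "poly (lead_coeff (sum_curve i j a b)) 0 \<noteq> 0"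
    using coeff1 jnz Anz a by (simp add: F_def of_nat_poly)
  have u: "is_unit (of_nat j :: 'k poly poly)"
    using jnz is_unit_cst[of "of_nat j :: 'k"] by (simp add: lift_y_def of_nat_poly)
  show "\<not> lift_y h dvd sum_curve i j a b" if h: "prime_elem (lift_y h)" for h
  proof
    assume "lift_y h dvd sum_curve i j a b"
    then have dvd: "h dvd coeff F n" for n
      by (simp add: lift_y_def const_poly_dvd_iff F_def)
    have lift: "h dvd q \<Longrightarrow> lift_y h dvd lift_y q" for q
      by (auto simp: lift_y_mult elim!: dvdE)
    have "lift_y h dvd of_nat j * lift_y A"
      using lift[OF dvd[of "i * (j - 1)"]] unfolding coeff1 lift_y_mult lift_y_of_nat .
    then have 1: "lift_y h dvd lift_y A"
      using u by (simp add: dvd_mult_unit_iff')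
    have "lift_y h dvd lift_y A ^ j - lift_y B ^ i"
      using lift[OF dvd[of 0]] unfolding coeffs(4) lift_y_diff lift_y_power .
    moreover have "lift_y h dvd lift_y A ^ j"
      using 1 ij dvd_trans[OF 1 dvd_power[of j "lift_y A"]] by simp
    ultimately have "lift_y h dvd lift_y B ^ i"
      by (metis dvd_diff_commute dvd_add_right_iff diff_add_cancel)
    then have 2: "lift_y h dvd lift_y B"
      using h prime_elem_dvd_power by blast
    have "(- a) ^ j = (- b) ^ i"
    proof (rule prime_dvd_both[OF h, of "y_pow i" a "y_pow j" b])
      show "lift_y h dvd y_pow i + cst a" "lift_y h dvd y_pow j + cst b"
        using 1 2 by (simp_all add: A_def B_def lift_y_add)
      show "y_pow i ^ j = (y_pow j ^ i :: 'k poly poly)"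
        by (simp add: lift_y_def poly_const_pow monom_power mult.commute)
    qed
    then show False using ab by simp
  qed
  show "\<not> lift_x h dvd sum_curve i j a b" if h: "prime_elem (lift_x h)" for h
  proof
    assume "lift_x h dvd sum_curve i j a b"
    then have dvd: "h dvd coeff_y n F" for n
      by (auto simp: F_def coeff_y_lift_x_mult elim!: dvdE)
    have lift: "h dvd q \<Longrightarrow> lift_x h dvd lift_x q" for q
      by (auto simp: lift_x_mult elim!: dvdE)
    have c: "coeff_y e F = (\<Sum>k\<le>j. if i * k = e then of_nat (j choose k) * A ^ (j - k) else 0)
        - (\<Sum>k\<le>i. if j * k = e then of_nat (i choose k) * B ^ (i - k) else 0)" for e
      unfolding F_def sum_curve_y A_def B_def coeff_y_diff coeff_y_lift_x_plus_power ..
    have "coeff_y (i * 1) F = of_nat j * A ^ (j - 1)"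
      unfolding c using ij by (subst sum_multiples) (auto simp: sum_no_multiple dvd_imp_le intro!: sum.neutral)
    then have "lift_x h dvd of_nat j * lift_x A ^ (j - 1)"
      using lift[OF dvd[of "i * 1"]] by (metis lift_x_mult lift_x_of_nat lift_x_power)
    then have "lift_x h dvd lift_x A ^ (j - 1)"
      using u by (simp add: dvd_mult_unit_iff')
    then have 1: "lift_x h dvd lift_x A"
      using h prime_elem_dvd_power by blast
    have "coeff_y 0 F = A ^ j - B ^ i"
      using c[of 0] sum_multiples[of i 0 j "\<lambda>k. of_nat (j choose k) * A ^ (j - k)"]
        sum_multiples[of j 0 i "\<lambda>k. of_nat (i choose k) * B ^ (i - k)"] ij by simp
    then have "lift_x h dvd lift_x A ^ j - lift_x B ^ i"
      using lift[OF dvd[of 0]] by (simp add: lift_x_diff lift_x_power)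
    moreover have "lift_x h dvd lift_x A ^ j"
      using 1 ij dvd_trans[OF 1 dvd_power[of j "lift_x A"]] by simp
    ultimately have "lift_x h dvd lift_x B ^ i"
      by (metis dvd_diff_commute dvd_add_right_iff diff_add_cancel)
    then have 2: "lift_x h dvd lift_x B"
      using h prime_elem_dvd_power by blast
    have "(- a) ^ j = (- b) ^ i"
    proof (rule prime_dvd_both[OF h, of "x_pow i" a "x_pow j" b])
      show "lift_x h dvd x_pow i + cst a" "lift_x h dvd x_pow j + cst b"
        using 1 2 by (simp_all add: A_def B_def lift_x_add lift_x_const)
      show "x_pow i ^ j = (x_pow j ^ i :: 'k poly poly)"
        by (simp add: x_pow_eq_monom monom_power mult.commute)
    qed
    then show False using ab by simp
  qed
qed

definition diff_curve :: "nat \<Rightarrow> 'k::comm_ring_1 \<Rightarrow> 'k poly poly" where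
  "diff_curve n a = x_pow n - y_pow n - cst a"

lemma card_zeros_diff_curve:
  fixes a :: "'k::{finite,field_gcd}"
  assumes n: "1 \<le> n" "n < CHAR('k)" and a: "a \<noteq> 0"
    and G: "\<And>x. x \<in> G \<Longrightarrow> x ^ card G = 1" and card: "real (card G) powr (4 / 3) \<le> real CHAR('k)"
  shows "real (card {(x, y)\<in>G \<times> G. ev2 (diff_curve n a) x y = 0})
    \<le> 18 * real n ^ 5 * real (card G) powr (2 / 3)"
proof (rule card_zeros[OF _ n _ _ _ _ G card])
  define F where "F = diff_curve n a"
  have "F \<in> bibox (Suc n) (Suc n)"
    unfolding F_def diff_curve_def
    using bibox_mono[OF bibox_x_pow[of n, where 'a = 'k], of "Suc n" "Suc n"]
      bibox_mono[OF bibox_y_pow[of n, where 'a = 'k], of "Suc n" "Suc n"]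
      bibox_mono[OF bibox_cst[of a], of "Suc n" "Suc n"]
    by (intro bibox_diff) auto
  then show "diff_curve n a \<in> bibox (Suc n) (Suc n)"
    by (simp add: F_def)
  show "ev2 (diff_curve n a) 0 0 \<noteq> 0"
    using a n by (simp add: diff_curve_def poly_monom power_0_left)
  have c: "coeff F e = (if e = n then 1 else 0)" if "e \<ge> 1" for e
    using that by (auto simp: F_def diff_curve_def x_pow_eq_monom lift_y_def coeff_pCons split: nat.splits)
  have "degree F = n"
    using c n by (intro antisym degree_le le_degree) auto
  then show "poly (lead_coeff (diff_curve n a)) 0 \<noteq> 0"
    using c n by (simp add: F_def)
  show "\<not> lift_y h dvd diff_curve n a" if h: "prime_elem (lift_y h)" for h
  proof
    assume "lift_y h dvd diff_curve n a"
    then have "h dvd coeff F n"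
      by (simp add: lift_y_def const_poly_dvd_iff F_def)
    then have "lift_y h dvd 1"
      using c n by (simp add: lift_y_def is_unit_const_poly_iff)
    then show False
      using h by (simp add: prime_elem_def)
  qed
  show "\<not> lift_x h dvd diff_curve n a" if h: "prime_elem (lift_x h)" for h
  proof
    assume "lift_x h dvd diff_curve n a"
    then have "h dvd coeff_y n F"
      by (auto simp: F_def coeff_y_lift_x_mult elim!: dvdE)
    moreover have "coeff_y n (lift_x g) = 0" for g :: "'k poly"
      using n by (auto simp: poly_eq_iff coeff_coeff_y coeff_lift_x coeff_pCons split: nat.splits)
    then have "coeff_y n F = - 1"
      using coeff_y_y_pow[of n n, where 'a = 'k]
      unfolding F_def diff_curve_def coeff_y_diff lift_x_const[symmetric] by simp
    ultimately have "h dvd - 1" by simp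
    then obtain q where "- 1 = h * q" ..
    then have "lift_x h * (- lift_x q) = 1"
      by (metis lift_x_1 lift_x_diff lift_x_mult minus_equation_iff mult_minus_right diff_0 lift_x_0)
    then show False
      using h by (metis dvd_triv_left prime_elem_not_unit)
  qed
qed

section \<open>Energies\<close>

lemma card_power_eq_le:
  fixes c :: "'k::idom"
  assumes "m \<ge> 1"
  shows "finite {x. x ^ m = c}" "card {x. x ^ m = c} \<le> m"
proof -
  define P where "P = monom 1 m - [:c:]"
  have "coeff P m = 1"
    using assms by (simp add: P_def coeff_pCons split: nat.splits)
  then have P0: "P \<noteq> 0" by auto
  have deg: "degree P \<le> m"
    unfolding P_def by (intro degree_diff_le degree_monom_le) simp
  have eq: "{x. x ^ m = c} = {x. poly P x = 0}"
    by (auto simp: P_def poly_monom)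
  show "finite {x. x ^ m = c}"
    unfolding eq by (rule poly_roots_finite[OF P0])
  show "card {x. x ^ m = c} \<le> m"
    unfolding eq using card_poly_roots_bound[OF P0] deg by simp
qed

lemma card_power_eq_in_le:
  fixes c :: "'k::idom"
  assumes "m \<ge> 1"
  shows "card {x\<in>G. x ^ m = c} \<le> m"
proof -
  have "card {x\<in>G. x ^ m = c} \<le> card {x. x ^ m = c}"
    by (intro card_mono card_power_eq_le(1)[OF assms]) auto
  then show ?thesis
    using card_power_eq_le(2)[OF assms, of c] by simp
qed

lemma card_roots_diff_powers:
  fixes A B s :: "'k::idom"
  assumes ij: "1 \<le> i" "i < j" "i * j < CHAR('k)" and nz: "A \<noteq> 0 \<or> B \<noteq> 0" and s: "s \<noteq> 0"
  shows "finite {x. (A + s * x ^ i) ^ j = (B + s * x ^ j) ^ i}"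
    "card {x. (A + s * x ^ i) ^ j = (B + s * x ^ j) ^ i} \<le> i * j"
proof -
  define P where "P = ([:A:] + monom s i) ^ j - ([:B:] + monom s j) ^ i"
  note coeffs = coeff_diff_powers[OF ij(1,2), where A = A and B = B and s = s, folded P_def]
  have "1 * j \<le> i * j" "i * 1 \<le> i * j"
    using ij by (auto intro: mult_right_mono)
  then have nz': "(of_nat i :: 'k) \<noteq> 0" "(of_nat j :: 'k) \<noteq> 0"
    using ij by (intro of_nat_neq_0_CHAR; linarith)+
  have P0: "P \<noteq> 0"
  proof (cases "A = 0")
    case True
    then have "coeff P (j * (i - 1)) \<noteq> 0"
      using coeffs(5) nz nz' s by simp
    then show ?thesis by auto
  next
    case False
    then have "coeff P (i * (j - 1)) \<noteq> 0"
      using coeffs(1) nz' s by simp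
    then show ?thesis by auto
  qed
  have deg: "degree P \<le> i * j"
  proof (rule degree_le, clarify)
    fix e assume e: "i * j < e"
    have "i * (j - 1) \<le> i * j" by (rule mult_left_mono) auto
    from coeffs(2)[OF le_less_trans[OF this e]] show "coeff P e = 0"
      using e by simp
  qed
  have eq: "{x. (A + s * x ^ i) ^ j = (B + s * x ^ j) ^ i} = {x. poly P x = 0}"
    by (auto simp: P_def poly_monom)
  show "finite {x. (A + s * x ^ i) ^ j = (B + s * x ^ j) ^ i}"
    unfolding eq by (rule poly_roots_finite[OF P0])
  show "card {x. (A + s * x ^ i) ^ j = (B + s * x ^ j) ^ i} \<le> i * j"
    unfolding eq using card_poly_roots_bound[OF P0] deg by simp
qed

lemma card_Sigma_le:
  assumes "finite A" "\<And>x. x \<in> A \<Longrightarrow> finite (B x)" "\<And>x. x \<in> A \<Longrightarrow> card (B x) \<le> m"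
  shows "card (Sigma A B) \<le> card A * m"
proof -
  have "card (Sigma A B) = (\<Sum>x\<in>A. card (B x))"
    using assms by (intro card_SigmaI) auto
  also have "\<dots> \<le> (\<Sum>x\<in>A. m)"
    using assms by (intro sum_mono)
  finally show ?thesis by simp
qed

definition energy :: "'t set \<Rightarrow> ('t \<Rightarrow> nat \<Rightarrow> 'k) \<Rightarrow> nat set \<Rightarrow> nat" where
  "energy T v J = card {(t, t') \<in> T \<times> T. \<forall>j\<in>J. v t j = v t' j}"

lemma energy_antimono: "finite T \<Longrightarrow> J \<subseteq> J' \<Longrightarrow> energy T v J' \<le> energy T v J"
  unfolding energy_def by (intro card_mono) (auto intro: finite_subset[of _ "T \<times> T"])

text \<open>D is meant for the degenerate elements: they are few, so a weaker bound b on their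
  fibres is affordable.\<close>

lemma energy_le:
  assumes T: "finite T" and D: "D \<subseteq> T"
    and a: "\<And>t. t \<in> T \<Longrightarrow> t \<notin> D \<Longrightarrow> real (card {t'\<in>T. \<forall>j\<in>J. v t' j = v t j}) \<le> a"
    and b: "\<And>t. t \<in> D \<Longrightarrow> real (card {t'\<in>T. \<forall>j\<in>J. v t' j = v t j}) \<le> b"
    and "a \<ge> 0"
  shows "real (energy T v J) \<le> a * card T + b * card D"
proof -
  have "{(t, t') \<in> T \<times> T. \<forall>j\<in>J. v t j = v t' j} = Sigma T (\<lambda>t. {t'\<in>T. \<forall>j\<in>J. v t' j = v t j})"
    by (auto simp: eq_commute)
  then have "energy T v J = (\<Sum>t\<in>T. card {t'\<in>T. \<forall>j\<in>J. v t' j = v t j})"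
    unfolding energy_def using T by simp
  then have "real (energy T v J) = (\<Sum>t\<in>T. real (card {t'\<in>T. \<forall>j\<in>J. v t' j = v t j}))"
    by simp
  also have "\<dots> = (\<Sum>t\<in>T - D. real (card {t'\<in>T. \<forall>j\<in>J. v t' j = v t j})) + (\<Sum>t\<in>D. real (card {t'\<in>T. \<forall>j\<in>J. v t' j = v t j}))"
    by (rule sum.subset_diff[OF D T])
  also have "\<dots> \<le> (\<Sum>t\<in>T - D. a) + (\<Sum>t\<in>D. b)"
    using a b by (intro add_mono sum_mono) auto
  also have "\<dots> \<le> a * card T + b * card D"
    using T D \<open>a \<ge> 0\<close> by (simp add: card_mono mult_left_mono mult.commute)
  finally show ?thesis .
qed

section \<open>Fibres and energies of power sums\<close>

definition pow1 :: "'k::comm_ring_1 \<Rightarrow> nat \<Rightarrow> 'k" where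
  "pow1 = (\<lambda>x j. x ^ j)"

definition pow_sum2 :: "'k::comm_ring_1 \<times> 'k \<Rightarrow> nat \<Rightarrow> 'k" where
  "pow_sum2 = (\<lambda>(x, y) j. x ^ j + y ^ j)"

definition pow_diff2 :: "'k::comm_ring_1 \<times> 'k \<Rightarrow> nat \<Rightarrow> 'k" where
  "pow_diff2 = (\<lambda>(x, y) j. x ^ j - y ^ j)"

text \<open>The signs make z the variable to eliminate: a fibre projects to points (x, y) of
  \<open>sum_curve\<close>, over each of which z takes at most i values.\<close>

definition pow_diff3 :: "'k::comm_ring_1 \<times> 'k \<times> 'k \<Rightarrow> nat \<Rightarrow> 'k" where
  "pow_diff3 = (\<lambda>(x, y, z) j. z ^ j - x ^ j - y ^ j)"

definition pow_sum3 :: "'k::comm_ring_1 \<times> 'k \<times> 'k \<Rightarrow> nat \<Rightarrow> 'k" where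
  "pow_sum3 = (\<lambda>(x, y, z) j. x ^ j + y ^ j + z ^ j)"

lemma energy_pow1:
  fixes G :: "'k::idom set"
  assumes "finite G" "n \<ge> 1"
  shows "energy G pow1 {n} \<le> n * card G"
proof -
  have "{(t, t') \<in> G \<times> G. \<forall>j\<in>{n}. pow1 t j = pow1 t' j} = Sigma G (\<lambda>t. {t'\<in>G. t' ^ n = t ^ n})"
    by (auto simp: pow1_def eq_commute)
  moreover have "card (Sigma G (\<lambda>t. {t'\<in>G. t' ^ n = t ^ n})) \<le> card G * n"
    using assms by (intro card_Sigma_le card_power_eq_in_le) auto
  ultimately show ?thesis
    unfolding energy_def by (simp add: mult.commute)
qed

lemma card_pairs_le:
  fixes c e :: "'k::idom"
  assumes "finite G" "i \<ge> 1"
  shows "card {(x, y) \<in> G \<times> G. x ^ i + y ^ i = c \<and> x ^ j + y ^ j = e} \<le> i * card G"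
proof -
  have "{(x, y) \<in> G \<times> G. x ^ i + y ^ i = c \<and> x ^ j + y ^ j = e} \<subseteq> Sigma G (\<lambda>x. {y\<in>G. y ^ i = c - x ^ i})"
    by (auto simp: algebra_simps)
  then have "card {(x, y) \<in> G \<times> G. x ^ i + y ^ i = c \<and> x ^ j + y ^ j = e}
      \<le> card (Sigma G (\<lambda>x. {y\<in>G. y ^ i = c - x ^ i}))"
    using assms by (intro card_mono) auto
  also have "\<dots> \<le> card G * i"
    using assms by (intro card_Sigma_le card_power_eq_in_le) auto
  finally show ?thesis by (simp add: mult.commute)
qed

text \<open>Eliminating y through (y^i)^j = (y^j)^i leaves an equation of degree at most i j in x,
  which is nontrivial because c or e is nonzero. Each x then allows at most i values of y.\<close>

lemma card_pairs_nonzero_le: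
  fixes c e :: "'k::idom"
  assumes "finite G" and ij: "1 \<le> i" "i < j" "i * j < CHAR('k)" and nz: "c \<noteq> 0 \<or> e \<noteq> 0"
  shows "card {(x, y) \<in> G \<times> G. x ^ i + y ^ i = c \<and> x ^ j + y ^ j = e} \<le> i * j * i"
proof -
  define R where "R = {x. (c + (- 1) * x ^ i) ^ j = (e + (- 1) * x ^ j) ^ i}"
  have R: "finite R" "card R \<le> i * j"
    unfolding R_def using card_roots_diff_powers[OF ij nz, of "- 1"] by simp_all
  have sub: "{(x, y) \<in> G \<times> G. x ^ i + y ^ i = c \<and> x ^ j + y ^ j = e} \<subseteq> Sigma R (\<lambda>x. {y\<in>G. y ^ i = c - x ^ i})"
  proof
    fix w assume w: "w \<in> {(x, y) \<in> G \<times> G. x ^ i + y ^ i = c \<and> x ^ j + y ^ j = e}"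
    obtain x y where [simp]: "w = (x, y)" by (cases w)
    have *: "x \<in> G" "y \<in> G" "c + (- 1) * x ^ i = y ^ i" "e + (- 1) * x ^ j = y ^ j"
      using w by (auto simp: algebra_simps)
    have "(y ^ i) ^ j = (y ^ j) ^ i"
      by (simp add: mult.commute flip: power_mult)
    then have "x \<in> R"
      unfolding R_def mem_Collect_eq * .
    then show "w \<in> Sigma R (\<lambda>x. {y\<in>G. y ^ i = c - x ^ i})"
      using * by simp
  qed
  have "card {(x, y) \<in> G \<times> G. x ^ i + y ^ i = c \<and> x ^ j + y ^ j = e}
      \<le> card (Sigma R (\<lambda>x. {y\<in>G. y ^ i = c - x ^ i}))"
    using assms R by (intro card_mono sub) auto
  also have "\<dots> \<le> card R * i"
    using assms R by (intro card_Sigma_le card_power_eq_in_le) auto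
  also have "\<dots> \<le> i * j * i"
    using R by (intro mult_right_mono) auto
  finally show ?thesis .
qed

text \<open>Generic fibres have bounded size. The pairs with both power sums zero number O(|G|) and
  have fibres of size O(|G|), so both kinds contribute |G|^2.\<close>

lemma energy_pow_sum2:
  fixes G :: "'k::idom set"
  assumes "finite G" and ij: "1 \<le> i" "i < j" "i * j < CHAR('k)"
  shows "real (energy (G \<times> G) pow_sum2 {i, j}) \<le> 2 * real (i * j * i) * real (card G) ^ 2"
proof -
  define D where "D = {(x, y) \<in> G \<times> G. x ^ i + y ^ i = 0 \<and> x ^ j + y ^ j = 0}"
  have fib: "{t'\<in>G \<times> G. \<forall>l\<in>{i, j}. pow_sum2 t' l = pow_sum2 t l}
      = {(x, y) \<in> G \<times> G. x ^ i + y ^ i = pow_sum2 t i \<and> x ^ j + y ^ j = pow_sum2 t j}" for t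
    by (auto simp: pow_sum2_def)
  have cD: "card D \<le> i * card G"
    unfolding D_def using assms by (intro card_pairs_le) auto
  have "real (energy (G \<times> G) pow_sum2 {i, j}) \<le> real (i * j * i) * card (G \<times> G) + real (i * card G) * card D"
  proof (rule energy_le)
    show "finite (G \<times> G)" "D \<subseteq> G \<times> G"
      using assms by (auto simp: D_def)
    show "real (card {t'\<in>G \<times> G. \<forall>l\<in>{i, j}. pow_sum2 t' l = pow_sum2 t l}) \<le> real (i * j * i)"
      if "t \<in> G \<times> G" "t \<notin> D" for t
      unfolding fib of_nat_le_iff
      by (rule card_pairs_nonzero_le[OF assms]) (use that in \<open>auto simp: D_def pow_sum2_def\<close>)
    show "real (card {t'\<in>G \<times> G. \<forall>l\<in>{i, j}. pow_sum2 t' l = pow_sum2 t l}) \<le> real (i * card G)" for t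
      unfolding fib of_nat_le_iff using assms by (intro card_pairs_le) auto
  qed simp
  also have "\<dots> \<le> real (i * j * i) * real (card G) ^ 2 + real (i * card G) * real (i * card G)"
  proof (intro add_mono mult_left_mono)
    show "real (card D) \<le> real (i * card G)"
      using cD by (simp only: of_nat_le_iff)
  qed (simp_all add: card_cartesian_product power2_eq_square)
  also have "real (i * card G) * real (i * card G) \<le> real (i * j * i) * real (card G) ^ 2"
  proof -
    have "i * 1 * i \<le> i * j * i"
      using ij by (intro mult_le_mono) auto
    then have "real (i * 1 * i) * real (card G) ^ 2 \<le> real (i * j * i) * real (card G) ^ 2"
      by (intro mult_right_mono) (simp_all only: of_nat_le_iff zero_le_power of_nat_0_le_iff)
    then show ?thesis by (simp add: power2_eq_square mult_ac)
  qed
  finally show ?thesis by linarith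
qed

text \<open>A fibre over a nonzero value is a \<open>diff_curve\<close>, with O(|G|^(2/3)) points;
  summed over |G|^2 pairs this is the main term. The pairs with x^n = y^n contribute only
  |G|^2.\<close>

lemma energy_pow_diff2:
  fixes G :: "'k::{finite,field_gcd} set"
  assumes n: "1 \<le> n" "n < CHAR('k)"
    and G: "\<And>x. x \<in> G \<Longrightarrow> x ^ card G = 1" and card: "real (card G) powr (4 / 3) \<le> real CHAR('k)"
    and ne: "G \<noteq> {}"
  shows "real (energy (G \<times> G) pow_diff2 {n}) \<le> 19 * real n ^ 5 * real (card G) powr (8 / 3)"
proof -
  define \<tau> where "\<tau> = real (card G)"
  have \<tau>: "\<tau> \<ge> 1"
    using ne by (simp add: \<tau>_def Suc_leI card_gt_0_iff)
  define D where "D = {(x, y) \<in> G \<times> G. x ^ n = y ^ n}"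
  have cS: "card (Sigma G (\<lambda>x. {y\<in>G. y ^ n = x ^ n - c})) \<le> card G * n" for c
    using n by (intro card_Sigma_le card_power_eq_in_le) auto
  have fib0: "card {t'\<in>G \<times> G. \<forall>l\<in>{n}. pow_diff2 t' l = pow_diff2 t l} \<le> card G * n" for t
  proof -
    have "{t'\<in>G \<times> G. \<forall>l\<in>{n}. pow_diff2 t' l = pow_diff2 t l} \<subseteq> Sigma G (\<lambda>x. {y\<in>G. y ^ n = x ^ n - pow_diff2 t n})"
      by (auto simp: pow_diff2_def algebra_simps)
    from card_mono[OF _ this] cS[of "pow_diff2 t n"] show ?thesis
      by (meson finite order_trans)
  qed
  have "D = Sigma G (\<lambda>x. {y\<in>G. y ^ n = x ^ n - 0})"
    by (auto simp: D_def)
  then have cD: "card D \<le> card G * n"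
    using cS[of 0] by simp
  have "real (energy (G \<times> G) pow_diff2 {n})
      \<le> (18 * real n ^ 5 * \<tau> powr (2 / 3)) * card (G \<times> G) + real (card G * n) * card D"
  proof (rule energy_le)
    show "finite (G \<times> G)" "D \<subseteq> G \<times> G"
      by (auto simp: D_def)
    show "real (card {t'\<in>G \<times> G. \<forall>l\<in>{n}. pow_diff2 t' l = pow_diff2 t l}) \<le> 18 * real n ^ 5 * \<tau> powr (2 / 3)"
      if "t \<in> G \<times> G" "t \<notin> D" for t
    proof -
      have eq: "{t'\<in>G \<times> G. \<forall>l\<in>{n}. pow_diff2 t' l = pow_diff2 t l}
          = {(x, y) \<in> G \<times> G. ev2 (diff_curve n (pow_diff2 t n)) x y = 0}"
        by (auto simp: diff_curve_def poly_monom pow_diff2_def)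
      show ?thesis
        unfolding eq \<tau>_def
        by (rule card_zeros_diff_curve[OF n _ G card]) (use that in \<open>auto simp: D_def pow_diff2_def\<close>)
    qed
    show "real (card {t'\<in>G \<times> G. \<forall>l\<in>{n}. pow_diff2 t' l = pow_diff2 t l}) \<le> real (card G * n)" for t
      using fib0 by (simp only: of_nat_le_iff)
  qed simp
  also have "\<dots> \<le> (18 * real n ^ 5 * \<tau> powr (2 / 3)) * \<tau> ^ 2 + (\<tau> * real n) * (\<tau> * real n)"
  proof (intro add_mono mult_left_mono)
    have "real (card D) \<le> real (card G * n)"
      using cD by (simp only: of_nat_le_iff)
    then show "real (card G * n) * real (card D) \<le> \<tau> * real n * (\<tau> * real n)"
      unfolding \<tau>_def of_nat_mult by (intro mult_left_mono) auto
  qed (simp_all add: \<tau>_def card_cartesian_product power2_eq_square)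
  also have "(\<tau> * real n) * (\<tau> * real n) \<le> real n ^ 5 * \<tau> powr (8 / 3)"
  proof -
    have "real n ^ 2 \<le> real n ^ 5" "\<tau> ^ 2 \<le> \<tau> powr (8 / 3)"
      using n \<tau> powr_mono[of 2 "8 / 3" \<tau>] by (simp_all add: power_increasing)
    then have "real n ^ 2 * \<tau> ^ 2 \<le> real n ^ 5 * \<tau> powr (8 / 3)"
      by (intro mult_mono) auto
    then show ?thesis
      by (simp add: power2_eq_square mult_ac)
  qed
  also have "(18 * real n ^ 5 * \<tau> powr (2 / 3)) * \<tau> ^ 2 = 18 * real n ^ 5 * \<tau> powr (8 / 3)"
  proof -
    have "\<tau> powr (2 / 3) * \<tau> powr 2 = \<tau> powr (8 / 3)"
      unfolding powr_add[symmetric] by simp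
    then show ?thesis
      using \<tau> by (simp add: mult.assoc)
  qed
  finally show ?thesis
    by (simp add: \<tau>_def)
qed

text \<open>The degenerate triples D are those whose values violate a hypothesis of
  \<open>card_zeros_sum_curve\<close>. There are O(|G|^2) of them with fibres of size O(|G|), so the
  generic contribution |G|^(3 + 2/3) dominates.\<close>

lemma energy_pow_diff3:
  fixes G :: "'k::{finite,field_gcd} set"
  assumes ij: "1 \<le> i" "i < j" "i * j < CHAR('k)"
    and G: "\<And>x. x \<in> G \<Longrightarrow> x ^ card G = 1" and card: "real (card G) powr (4 / 3) \<le> real CHAR('k)"
    and ne: "G \<noteq> {}"
  shows "real (energy (G \<times> G \<times> G) pow_diff3 {i, j})
    \<le> (18 * real i * real (i * j) ^ 5 + 10 * real (i * i * i * j * j)) * real (card G) powr (11 / 3)"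
proof -
  define \<tau> where "\<tau> = real (card G)"
  have \<tau>: "\<tau> \<ge> 1"
    using ne by (simp add: \<tau>_def Suc_leI card_gt_0_iff)
  define A where "A = (\<lambda>t. pow_diff3 t i :: 'k)"
  define B where "B = (\<lambda>t. pow_diff3 t j :: 'k)"
  define T where "T = G \<times> G \<times> G"
  define D where "D = {t\<in>T. A t = 0 \<or> A t ^ j = B t ^ i \<or> (- A t) ^ j = (- B t) ^ i}"
  define fib where "fib = (\<lambda>t. {t'\<in>T. \<forall>l\<in>{i, j}. pow_diff3 t' l = pow_diff3 t l})"
  have nondeg: "real (card (fib t)) \<le> 18 * real i * real (i * j) ^ 5 * \<tau> powr (2 / 3)" if t: "t \<in> T" "t \<notin> D" for t
  proof -
    define Z where "Z = {(x, y) \<in> G \<times> G. ev2 (sum_curve i j (A t) (B t)) x y = 0}"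
    have Z: "real (card Z) \<le> 18 * real (i * j) ^ 5 * \<tau> powr (2 / 3)"
      unfolding Z_def \<tau>_def by (rule card_zeros_sum_curve[OF ij _ _ _ G card]) (use t in \<open>auto simp: D_def\<close>)
    have pw: "ev2 (P ^ n) x y = ev2 P x y ^ n" for P :: "'k poly poly" and n x y
      using ev2_of_nat[of 1 x y] by (induction n) simp_all
    have ev: "ev2 (sum_curve i j a b) x y = (x ^ i + y ^ i + a) ^ j - (x ^ j + y ^ j + b) ^ i" for a b x y :: 'k
      by (simp add: sum_curve_def pw poly_monom)
    have "fib t \<subseteq> (\<lambda>((x, y), z). (x, y, z)) ` Sigma Z (\<lambda>(x, y). {z\<in>G. z ^ i = x ^ i + y ^ i + A t})"
    proof
      fix w assume w: "w \<in> fib t"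
      obtain x y z where [simp]: "w = (x, y, z)" by (cases w) auto
      have G3: "x \<in> G" "y \<in> G" "z \<in> G" and e: "z ^ i = x ^ i + y ^ i + A t" "z ^ j = x ^ j + y ^ j + B t"
        using w by (auto simp: fib_def T_def A_def B_def pow_diff3_def algebra_simps split: prod.splits)
      have "(z ^ i) ^ j = (z ^ j) ^ i"
        by (simp add: mult.commute flip: power_mult)
      then have "(x, y) \<in> Z"
        using G3 unfolding Z_def by (simp add: ev flip: e)
      then show "w \<in> (\<lambda>((x, y), z). (x, y, z)) ` Sigma Z (\<lambda>(x, y). {z\<in>G. z ^ i = x ^ i + y ^ i + A t})"
        using G3 e by force
    qed
    then have "card (fib t) \<le> card (Sigma Z (\<lambda>(x, y). {z\<in>G. z ^ i = x ^ i + y ^ i + A t}))"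
      by (rule surj_card_le[rotated]) simp
    also have "\<dots> \<le> card Z * i"
      using ij by (intro card_Sigma_le) (auto intro: card_power_eq_in_le)
    finally have "real (card (fib t)) \<le> real (card Z * i)"
      by (simp only: of_nat_le_iff)
    also have "\<dots> \<le> (18 * real (i * j) ^ 5 * \<tau> powr (2 / 3)) * real i"
      using Z by (simp add: mult_right_mono)
    finally show ?thesis by (simp add: mult_ac)
  qed
  \<comment> \<open>Fix z first. Unless z^i = A t, which leaves at most i values of z, the pair (x,
    y) has a prescribed nonzero power sum.\<close>
  have deg: "card (fib t) \<le> 2 * (i * i * j) * card G" for t
  proof -
    define P where "P = (\<lambda>z. {(x, y) \<in> G \<times> G. x ^ i + y ^ i = z ^ i - A t \<and> x ^ j + y ^ j = z ^ j - B t})"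
    define Z where "Z = {z\<in>G. z ^ i = A t}"
    have "fib t \<subseteq> (\<lambda>(z, x, y). (x, y, z)) ` (Sigma Z P \<union> Sigma (G - Z) P)"
    proof
      fix w assume w: "w \<in> fib t"
      obtain x y z where [simp]: "w = (x, y, z)" by (cases w) auto
      have "x \<in> G" "y \<in> G" "z \<in> G" "x ^ i + y ^ i = z ^ i - A t" "x ^ j + y ^ j = z ^ j - B t"
        using w by (auto simp: fib_def T_def A_def B_def pow_diff3_def algebra_simps split: prod.splits)
      then show "w \<in> (\<lambda>(z, x, y). (x, y, z)) ` (Sigma Z P \<union> Sigma (G - Z) P)"
        unfolding P_def Z_def by force
    qed
    then have "card (fib t) \<le> card (Sigma Z P \<union> Sigma (G - Z) P)"
      by (rule surj_card_le[rotated]) simp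
    also have "\<dots> \<le> card (Sigma Z P) + card (Sigma (G - Z) P)"
      by (rule card_Un_le)
    also have "card (Sigma Z P) \<le> card Z * (i * card G)"
      using ij unfolding P_def by (intro card_Sigma_le card_pairs_le) auto
    also have "card (Sigma (G - Z) P) \<le> card (G - Z) * (i * j * i)"
      unfolding P_def by (intro card_Sigma_le card_pairs_nonzero_le ij) (auto simp: Z_def)
    also have "card Z * (i * card G) \<le> i * (i * card G)"
      using card_power_eq_in_le[OF ij(1)] unfolding Z_def by (intro mult_right_mono) auto
    also have "card (G - Z) * (i * j * i) \<le> card G * (i * j * i)"
      by (intro mult_right_mono card_mono) auto
    also have "i * (i * card G) \<le> i * i * j * card G"
      using ij by simp
    finally show ?thesis by (simp add: mult_ac)
  qed
  \<comment> \<open>5 = 1 + 2 + 2. V covers A = 0, while \<open>U (- 1)\<close> and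
    \<open>U 1\<close> cover the two equations between powers. For given (y, z) the latter are
    polynomial equations in x; they may be trivial only for the pairs Y, which are counted with
    arbitrary x.\<close>
  have cD: "card D \<le> 5 * (i * j) * (card G)\<^sup>2"
  proof -
    define Y where "Y = {(y, z) \<in> G \<times> G. y ^ i = z ^ i}"
    define R where "R = (\<lambda>(s :: 'k) (y, z). {x. (s * (y ^ i - z ^ i) + s * x ^ i) ^ j = (s * (y ^ j - z ^ j) + s * x ^ j) ^ i})"
    have "Y = Sigma G (\<lambda>y. {z\<in>G. z ^ i = y ^ i})"
      by (auto simp: Y_def)
    moreover have "card (Sigma G (\<lambda>y. {z\<in>G. z ^ i = y ^ i})) \<le> card G * i"
      using ij by (intro card_Sigma_le card_power_eq_in_le) auto
    ultimately have cY: "card Y \<le> card G * i"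
      by simp
    have R: "card (R s w) \<le> i * j" if "w \<in> G \<times> G - Y" "s \<noteq> 0" for s w
    proof -
      obtain y z where [simp]: "w = (y, z)" by (cases w)
      have "s * (y ^ i - z ^ i) \<noteq> 0"
        using that by (auto simp: Y_def)
      then show ?thesis
        using card_roots_diff_powers(2)[OF ij _ that(2)] by (simp add: R_def)
    qed
    define U where "U = (\<lambda>s. (\<lambda>((y, z), x). (x, y, z)) ` (Sigma (G \<times> G - Y) (R s) \<union> Y \<times> G))"
    define V where "V = (\<lambda>((x, y), z). (x, y, z)) ` Sigma (G \<times> G) (\<lambda>(x, y). {z\<in>G. z ^ i = x ^ i + y ^ i})"
    have cU: "card (U s) \<le> 2 * (i * j) * (card G)\<^sup>2" if "s \<noteq> 0" for s
    proof -
      have "card (U s) \<le> card (Sigma (G \<times> G - Y) (R s) \<union> Y \<times> G)"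
        unfolding U_def by (rule card_image_le) simp
      also have "\<dots> \<le> card (Sigma (G \<times> G - Y) (R s)) + card (Y \<times> G)"
        by (rule card_Un_le)
      also have "card (Sigma (G \<times> G - Y) (R s)) \<le> card (G \<times> G - Y) * (i * j)"
        using R that by (intro card_Sigma_le) auto
      also have "\<dots> \<le> card (G \<times> G) * (i * j)"
        by (intro mult_right_mono card_mono) auto
      also have "card (Y \<times> G) \<le> (card G * i) * card G"
        unfolding card_cartesian_product using cY by (intro mult_right_mono) auto
      also have "\<dots> \<le> (i * j) * (card G)\<^sup>2"
        using ij by (simp add: power2_eq_square)
      finally show ?thesis
        by (simp add: card_cartesian_product power2_eq_square mult_ac)
    qed
    have cV: "card V \<le> (i * j) * (card G)\<^sup>2"
    proof -
      have "card V \<le> card (Sigma (G \<times> G) (\<lambda>(x, y). {z\<in>G. z ^ i = x ^ i + y ^ i}))"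
        unfolding V_def by (rule card_image_le) simp
      also have "\<dots> \<le> card (G \<times> G) * i"
        using card_power_eq_in_le[OF ij(1)] by (intro card_Sigma_le) auto
      also have "\<dots> \<le> (i * j) * (card G)\<^sup>2"
        using ij by (simp add: power2_eq_square card_cartesian_product)
      finally show ?thesis .
    qed
    have "D \<subseteq> V \<union> (U 1 \<union> U (- 1))"
    proof
      fix w assume w: "w \<in> D"
      obtain x y z where wxyz: "w = (x, y, z)" by (cases w) auto
      have G3: "x \<in> G" "y \<in> G" "z \<in> G"
        using w by (auto simp: D_def T_def wxyz)
      consider "z ^ i - x ^ i - y ^ i = 0"
        | "(z ^ i - x ^ i - y ^ i) ^ j = (z ^ j - x ^ j - y ^ j) ^ i"
        | "(- (z ^ i - x ^ i - y ^ i)) ^ j = (- (z ^ j - x ^ j - y ^ j)) ^ i"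
        using w by (auto simp: D_def A_def B_def pow_diff3_def wxyz)
      then show "w \<in> V \<union> (U 1 \<union> U (- 1))"
      proof cases
        case 1
        then have "((x, y), z) \<in> Sigma (G \<times> G) (\<lambda>(x, y). {z\<in>G. z ^ i = x ^ i + y ^ i})"
          using G3 by (simp add: algebra_simps)
        then have "w \<in> V"
          unfolding V_def wxyz by (rule rev_image_eqI) simp
        then show ?thesis by simp
      next
        case 2
        have "- 1 * (y ^ n - z ^ n) + - 1 * x ^ n = z ^ n - x ^ n - y ^ n" for n
          by simp
        then have "x \<in> R (- 1) (y, z)"
          using 2 by (simp only: R_def prod.case mem_Collect_eq)
        then have "((y, z), x) \<in> Sigma (G \<times> G - Y) (R (- 1)) \<union> Y \<times> G"
          using G3 by (cases "(y, z) \<in> Y") auto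
        then have "w \<in> U (- 1)"
          unfolding U_def wxyz by (rule rev_image_eqI) simp
        then show ?thesis by simp
      next
        case 3
        have "1 * (y ^ n - z ^ n) + 1 * x ^ n = - (z ^ n - x ^ n - y ^ n)" for n
          by simp
        then have "x \<in> R 1 (y, z)"
          using 3 by (simp only: R_def prod.case mem_Collect_eq)
        then have "((y, z), x) \<in> Sigma (G \<times> G - Y) (R 1) \<union> Y \<times> G"
          using G3 by (cases "(y, z) \<in> Y") auto
        then have "w \<in> U 1"
          unfolding U_def wxyz by (rule rev_image_eqI) simp
        then show ?thesis by simp
      qed
    qed
    then have "card D \<le> card (V \<union> (U 1 \<union> U (- 1)))"
      by (rule card_mono[rotated]) simp
    also have "\<dots> \<le> card V + (card (U 1) + card (U (- 1)))"
      using card_Un_le[of V "U 1 \<union> U (- 1)"] card_Un_le[of "U 1" "U (- 1)"] by linarith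
    finally show ?thesis
      using cV cU[of 1] cU[of "- 1"] by simp
  qed
  have "real (energy T pow_diff3 {i, j})
      \<le> (18 * real i * real (i * j) ^ 5 * \<tau> powr (2 / 3)) * card T + real (2 * (i * i * j) * card G) * card D"
  proof (rule energy_le)
    show "finite T" "D \<subseteq> T"
      by (auto simp: D_def)
    show "real (card {t'\<in>T. \<forall>l\<in>{i, j}. pow_diff3 t' l = pow_diff3 t l}) \<le> 18 * real i * real (i * j) ^ 5 * \<tau> powr (2 / 3)"
      if "t \<in> T" "t \<notin> D" for t
      using nondeg[OF that] by (simp only: fib_def)
    show "real (card {t'\<in>T. \<forall>l\<in>{i, j}. pow_diff3 t' l = pow_diff3 t l}) \<le> real (2 * (i * i * j) * card G)" for t
      using deg[of t] unfolding fib_def by (simp only: of_nat_le_iff)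
  qed simp
  also have "\<dots> \<le> (18 * real i * real (i * j) ^ 5 * \<tau> powr (2 / 3)) * \<tau> ^ 3
      + real (2 * (i * i * j) * card G) * real (5 * (i * j) * (card G)\<^sup>2)"
  proof (intro add_mono mult_left_mono)
    show "real (card D) \<le> real (5 * (i * j) * (card G)\<^sup>2)"
      using cD by (simp only: of_nat_le_iff)
  qed (simp_all add: \<tau>_def T_def card_cartesian_product power3_eq_cube)
  also have "real (2 * (i * i * j) * card G) * real (5 * (i * j) * (card G)\<^sup>2) = 10 * real (i * i * i * j * j) * \<tau> ^ 3"
    by (simp add: \<tau>_def power2_eq_square power3_eq_cube)
  finally have "real (energy T pow_diff3 {i, j})
    \<le> 18 * real i * real (i * j) ^ 5 * \<tau> powr (2 / 3) * \<tau> ^ 3 + 10 * real (i * i * i * j * j) * \<tau> ^ 3" .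
  moreover have "10 * real (i * i * i * j * j) * \<tau> ^ 3 \<le> 10 * real (i * i * i * j * j) * \<tau> powr (11 / 3)"
    using \<tau> powr_mono[of 3 "11 / 3" \<tau>] by (intro mult_left_mono) simp_all
  moreover have "(18 * real i * real (i * j) ^ 5 * \<tau> powr (2 / 3)) * \<tau> ^ 3 = 18 * real i * real (i * j) ^ 5 * \<tau> powr (11 / 3)"
  proof -
    have "\<tau> powr (2 / 3) * \<tau> powr 3 = \<tau> powr (11 / 3)"
      unfolding powr_add[symmetric] by simp
    then show ?thesis
      using \<tau> by (simp add: mult.assoc)
  qed
  ultimately show ?thesis
    unfolding T_def \<tau>_def distrib_right by linarith
qed

text \<open>By Newton's identities both triples are the roots of the same cubic.\<close>

lemma equal_power_sums3:
  fixes x1 :: "'k::field"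
  assumes six: "(6 :: 'k) \<noteq> 0"
    and "x1 + x2 + x3 = y1 + y2 + y3" "x1 ^ 2 + x2 ^ 2 + x3 ^ 2 = y1 ^ 2 + y2 ^ 2 + y3 ^ 2"
      "x1 ^ 3 + x2 ^ 3 + x3 ^ 3 = y1 ^ 3 + y2 ^ 3 + y3 ^ 3"
  shows "x1 = y1 \<or> x1 = y2 \<or> x1 = y3"
proof -
  define p1 p2 p3 where "p1 = y1 + y2 + y3" and "p2 = y1 ^ 2 + y2 ^ 2 + y3 ^ 2" and "p3 = y1 ^ 3 + y2 ^ 3 + y3 ^ 3"
  have "6 * ((x1 - y1) * (x1 - y2) * (x1 - y3))
      = 6 * x1 ^ 3 - 6 * p1 * x1 ^ 2 + 3 * (p1 ^ 2 - p2) * x1 - (p1 ^ 3 - 3 * p1 * p2 + 2 * p3)"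
    unfolding p1_def p2_def p3_def by (simp add: power2_eq_square power3_eq_cube algebra_simps)
  also have "\<dots> = 0"
    unfolding p1_def p2_def p3_def assms(2-4)[symmetric]
    by (simp add: power2_eq_square power3_eq_cube algebra_simps)
  finally have "6 * ((x1 - y1) * (x1 - y2) * (x1 - y3)) = 0" .
  then show ?thesis
    using six by simp
qed

text \<open>Every coordinate of one triple occurs in the other, whence 3^3 candidates per triple. No
  curve is involved, so the size of G is unrestricted; this serves the range of large G.\<close>

lemma energy_pow_sum3:
  fixes G :: "'k::field set"
  assumes "finite G" and six: "(6 :: 'k) \<noteq> 0"
  shows "energy (G \<times> G \<times> G) pow_sum3 {1, 2, 3} \<le> 27 * card G ^ 3"
proof -
  define S where "S = (\<lambda>(x, y, z). {x, y, z :: 'k})"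
  have cS: "card (S t) \<le> 3" for t
    by (cases t) (simp add: S_def card_insert_if)
  have fS: "finite (S t)" for t
    by (cases t) (simp add: S_def)
  have "{(t, t') \<in> (G \<times> G \<times> G) \<times> (G \<times> G \<times> G). \<forall>j\<in>{1, 2, 3}. pow_sum3 t j = pow_sum3 t' j}
      \<subseteq> Sigma (G \<times> G \<times> G) (\<lambda>t. S t \<times> S t \<times> S t)"
  proof
    fix w assume w: "w \<in> {(t, t') \<in> (G \<times> G \<times> G) \<times> (G \<times> G \<times> G). \<forall>j\<in>{1, 2, 3}. pow_sum3 t j = pow_sum3 t' j}"
    obtain y1 y2 y3 x1 x2 x3 where [simp]: "w = ((y1, y2, y3), (x1, x2, x3))"
      by (metis prod.exhaust)
    have "(y1, y2, y3) \<in> G \<times> G \<times> G" "\<forall>j\<in>{1, 2, 3}. pow_sum3 (y1, y2, y3) j = pow_sum3 (x1, x2, x3) j"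
      using w by auto
    then have e: "x1 + x2 + x3 = y1 + y2 + y3" "x1 ^ 2 + x2 ^ 2 + x3 ^ 2 = y1 ^ 2 + y2 ^ 2 + y3 ^ 2"
      "x1 ^ 3 + x2 ^ 3 + x3 ^ 3 = y1 ^ 3 + y2 ^ 3 + y3 ^ 3"
      by (simp_all add: pow_sum3_def)
    have "x1 \<in> S (y1, y2, y3)"
      using equal_power_sums3[OF six e] by (simp add: S_def)
    moreover have "x2 \<in> S (y1, y2, y3)"
      using equal_power_sums3[OF six, of x2 x1 x3 y1 y2 y3] e by (simp add: S_def add_ac)
    moreover have "x3 \<in> S (y1, y2, y3)"
      using equal_power_sums3[OF six, of x3 x1 x2 y1 y2 y3] e by (simp add: S_def add_ac)
    ultimately show "w \<in> Sigma (G \<times> G \<times> G) (\<lambda>t. S t \<times> S t \<times> S t)"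
      using \<open>(y1, y2, y3) \<in> G \<times> G \<times> G\<close> by simp
  qed
  then have "energy (G \<times> G \<times> G) pow_sum3 {1, 2, 3} \<le> card (Sigma (G \<times> G \<times> G) (\<lambda>t. S t \<times> S t \<times> S t))"
    unfolding energy_def using assms fS by (intro card_mono finite_SigmaI finite_cartesian_product) simp_all
  also have "\<dots> \<le> card (G \<times> G \<times> G) * (3 * (3 * 3))"
  proof (rule card_Sigma_le)
    show "card (S t \<times> S t \<times> S t) \<le> 3 * (3 * 3)" for t
      unfolding card_cartesian_product by (intro mult_le_mono cS)
  qed (use assms fS in simp_all)
  finally show ?thesis
    by (simp add: card_cartesian_product power3_eq_cube)
qed

section \<open>Character sums and mean values\<close>

text \<open>Chebyshev's sum inequality: h and its powers are ordered alike, so each product of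
  differences is nonnegative.\<close>

lemma sum_mult_sum_le:
  fixes h :: "'a \<Rightarrow> real"
  assumes "finite A" "\<And>x. x \<in> A \<Longrightarrow> h x \<ge> 0"
  shows "sum h A * (\<Sum>x\<in>A. h x ^ m) \<le> real (card A) * (\<Sum>x\<in>A. h x ^ Suc m)"
proof -
  have "0 \<le> (\<Sum>x\<in>A. \<Sum>y\<in>A. (h x - h y) * (h x ^ m - h y ^ m))"
  proof (intro sum_nonneg)
    fix x y assume "x \<in> A" "y \<in> A"
    then show "0 \<le> (h x - h y) * (h x ^ m - h y ^ m)"
      using assms(2) by (cases "h x \<le> h y")
        (auto intro!: mult_nonneg_nonneg mult_nonpos_nonpos simp: power_mono)
  qed
  also have "\<dots> = (\<Sum>x\<in>A. \<Sum>y\<in>A. h x ^ Suc m + h y ^ Suc m - h x * h y ^ m - h y * h x ^ m)"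
    by (intro sum.cong refl) (simp add: algebra_simps)
  also have "\<dots> = 2 * (real (card A) * (\<Sum>x\<in>A. h x ^ Suc m)) - 2 * (sum h A * (\<Sum>x\<in>A. h x ^ m))"
  proof -
    have "(\<Sum>x\<in>A. \<Sum>y\<in>A. h y * h x ^ m) = sum h A * (\<Sum>x\<in>A. h x ^ m)"
      by (subst sum.swap) (simp add: sum_product)
    moreover have "(\<Sum>x\<in>A. \<Sum>y\<in>A. h x * h y ^ m) = sum h A * (\<Sum>x\<in>A. h x ^ m)"
      by (simp add: sum_product)
    ultimately show ?thesis
      by (simp add: sum.distrib sum_subtractf sum_distrib_left sum_negf del: power_Suc)
  qed
  finally show ?thesis by simp
qed

text \<open>The power mean inequality, which supplies the integer-exponent form of Hoelder's
  inequality.\<close>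

lemma sum_power_le:
  fixes h :: "'a \<Rightarrow> real"
  assumes "finite A" "\<And>x. x \<in> A \<Longrightarrow> h x \<ge> 0"
  shows "sum h A ^ Suc m \<le> real (card A) ^ m * (\<Sum>x\<in>A. h x ^ Suc m)"
proof (induction m)
  case (Suc m)
  have "sum h A ^ Suc (Suc m) \<le> sum h A * (real (card A) ^ m * (\<Sum>x\<in>A. h x ^ Suc m))"
    using Suc assms by (simp add: mult_left_mono sum_nonneg)
  also have "\<dots> = real (card A) ^ m * (sum h A * (\<Sum>x\<in>A. h x ^ Suc m))"
    by simp
  also have "\<dots> \<le> real (card A) ^ m * (real (card A) * (\<Sum>x\<in>A. h x ^ Suc (Suc m)))"
    by (intro mult_left_mono sum_mult_sum_le assms) auto
  finally show ?case by (simp add: mult_ac)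
qed simp

locale additive_character =
  fixes \<psi> :: "'k::{finite,field_gcd} \<Rightarrow> complex"
  assumes \<psi>_add: "\<psi> (x + y) = \<psi> x * \<psi> y"
    and norm_\<psi>: "cmod (\<psi> x) = 1"
    and nontrivial: "\<exists>x. \<psi> x \<noteq> 1"
begin

lemma \<psi>_0 [simp]: "\<psi> 0 = 1"
  using \<psi>_add[of 0 0] norm_\<psi>[of 0] by auto

lemma \<psi>_sum: "\<psi> (sum f A) = (\<Prod>x\<in>A. \<psi> (f x))"
  by (induction A rule: infinite_finite_induct) (simp_all add: \<psi>_add)

lemma cnj_\<psi>: "cnj (\<psi> x) = \<psi> (- x)"
proof -
  have "\<psi> x * \<psi> (- x) = 1"
    by (simp flip: \<psi>_add)
  moreover have "\<psi> x * cnj (\<psi> x) = 1"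
    using norm_\<psi>[of x] complex_norm_square[of "\<psi> x"] by simp
  moreover have "\<psi> x \<noteq> 0"
    using norm_\<psi>[of x] by auto
  ultimately show ?thesis
    by (metis mult_cancel_left)
qed

lemma \<psi>_diff: "\<psi> (x - y) = \<psi> x * cnj (\<psi> y)"
  unfolding cnj_\<psi> by (simp flip: \<psi>_add)

lemma orthogonality: "(\<Sum>c\<in>UNIV. \<psi> (c * d)) = (if d = 0 then of_nat CARD('k) else 0)"
proof (cases "d = 0")
  case False
  obtain z where z: "\<psi> z \<noteq> 1" using nontrivial by auto
  have "(\<Sum>c\<in>UNIV. \<psi> (c * d)) = (\<Sum>c\<in>UNIV. \<psi> ((c + z / d) * d))"
    by (rule sum.reindex_bij_witness[of _ "\<lambda>c. c + z / d" "\<lambda>c. c - z / d"]) auto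
  also have "\<dots> = (\<Sum>c\<in>UNIV. \<psi> (c * d) * \<psi> z)"
    using False by (intro sum.cong refl) (simp add: distrib_right \<psi>_add)
  also have "\<dots> = (\<Sum>c\<in>UNIV. \<psi> (c * d)) * \<psi> z"
    by (rule sum_distrib_right[symmetric])
  finally have "(\<Sum>c\<in>UNIV. \<psi> (c * d)) * (1 - \<psi> z) = 0"
    by (simp add: algebra_simps)
  then show ?thesis
    using z False by simp
qed simp

section \<open>Moments of character sums\<close>

definition lin :: "nat set \<Rightarrow> (nat \<Rightarrow> 'k) \<Rightarrow> (nat \<Rightarrow> 'k) \<Rightarrow> 'k" where
  "lin J a v = (\<Sum>j\<in>J. a j * v j)"

text \<open>Extensional functions form a finite set, over which a sum of products splits into a
  product of sums.\<close>

definition coeffs :: "nat set \<Rightarrow> (nat \<Rightarrow> 'k) set" where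
  "coeffs J = J \<rightarrow>\<^sub>E UNIV"

lemma finite_coeffs: "finite J \<Longrightarrow> finite (coeffs J)"
  unfolding coeffs_def by (intro finite_PiE) auto

lemma sum_\<psi>_lin:
  assumes "finite J"
  shows "(\<Sum>a\<in>coeffs J. \<psi> (lin J a d)) = (if \<forall>j\<in>J. d j = 0 then of_nat CARD('k) ^ card J else 0)"
proof -
  have "(\<Sum>a\<in>coeffs J. \<psi> (lin J a d)) = (\<Sum>a\<in>coeffs J. \<Prod>j\<in>J. \<psi> (a j * d j))"
    by (simp add: lin_def \<psi>_sum)
  also have "\<dots> = (\<Prod>j\<in>J. \<Sum>c\<in>UNIV. \<psi> (c * d j))"
    unfolding coeffs_def using assms by (intro prod_sum_PiE[symmetric]) auto
  also have "\<dots> = (\<Prod>j\<in>J. if d j = 0 then of_nat CARD('k) else 0)"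
    by (simp add: orthogonality)
  also have "\<dots> = (if \<forall>j\<in>J. d j = 0 then of_nat CARD('k) ^ card J else 0)"
    using assms by (auto intro: prod_zero)
  finally show ?thesis .
qed

lemma parseval:
  assumes "finite J" "finite T"
  shows "(\<Sum>a\<in>coeffs J. (cmod (\<Sum>t\<in>T. \<psi> (lin J a (v t))))\<^sup>2) = real (CARD('k) ^ card J * energy T v J)"
proof -
  have "(\<Sum>a\<in>coeffs J. complex_of_real ((cmod (\<Sum>t\<in>T. \<psi> (lin J a (v t))))\<^sup>2))
      = (\<Sum>a\<in>coeffs J. \<Sum>(t, t')\<in>T \<times> T. \<psi> (lin J a (\<lambda>j. v t j - v t' j)))"
  proof (intro sum.cong refl)
    fix a
    have "complex_of_real ((cmod (\<Sum>t\<in>T. \<psi> (lin J a (v t))))\<^sup>2)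
        = (\<Sum>t\<in>T. \<psi> (lin J a (v t))) * cnj (\<Sum>t\<in>T. \<psi> (lin J a (v t)))"
      by (rule complex_norm_square)
    also have "\<dots> = (\<Sum>(t, t')\<in>T \<times> T. \<psi> (lin J a (v t)) * cnj (\<psi> (lin J a (v t'))))"
      by (simp add: sum_product sum.cartesian_product)
    also have "\<dots> = (\<Sum>(t, t')\<in>T \<times> T. \<psi> (lin J a (\<lambda>j. v t j - v t' j)))"
      by (simp add: lin_def right_diff_distrib sum_subtractf flip: \<psi>_diff)
    finally show "complex_of_real ((cmod (\<Sum>t\<in>T. \<psi> (lin J a (v t))))\<^sup>2)
        = (\<Sum>(t, t')\<in>T \<times> T. \<psi> (lin J a (\<lambda>j. v t j - v t' j)))" .
  qed
  also have "\<dots> = (\<Sum>(t, t')\<in>T \<times> T. \<Sum>a\<in>coeffs J. \<psi> (lin J a (\<lambda>j. v t j - v t' j)))"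
    unfolding case_prod_unfold by (rule sum.swap)
  also have "\<dots> = (\<Sum>(t, t')\<in>T \<times> T. if \<forall>j\<in>J. v t j = v t' j then of_nat CARD('k) ^ card J else 0)"
    using assms by (simp add: sum_\<psi>_lin)
  also have "\<dots> = (\<Sum>w\<in>{(t, t') \<in> T \<times> T. \<forall>j\<in>J. v t j = v t' j}. of_nat CARD('k) ^ card J)"
    using assms by (intro sum.mono_neutral_cong_right) (auto split: if_splits)
  also have "\<dots> = complex_of_real (real (CARD('k) ^ card J * energy T v J))"
    by (simp add: energy_def mult.commute)
  finally show ?thesis
    by (simp only: of_real_sum[symmetric] of_real_eq_iff)
qed

definition char_sum :: "'k set \<Rightarrow> nat set \<Rightarrow> (nat \<Rightarrow> 'k) \<Rightarrow> complex" where
  "char_sum G J a = (\<Sum>x\<in>G. \<psi> (lin J a (pow1 x)))"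

definition tuples :: "'k set \<Rightarrow> nat \<Rightarrow> (nat \<Rightarrow> 'k) set" where
  "tuples G m = {..<m} \<rightarrow>\<^sub>E G"

definition pow_sum :: "nat \<Rightarrow> (nat \<Rightarrow> 'k) \<Rightarrow> nat \<Rightarrow> 'k" where
  "pow_sum m x j = (\<Sum>i<m. x i ^ j)"

definition mean_value :: "'k set \<Rightarrow> nat \<Rightarrow> nat set \<Rightarrow> nat" where
  "mean_value G m J = energy (tuples G m) (pow_sum m) J"

lemma finite_tuples: "finite (tuples G m)"
  unfolding tuples_def by (intro finite_PiE) auto

lemma card_tuples: "card (tuples G m) = card G ^ m"
  by (simp add: tuples_def card_PiE)

lemma lin_add: "lin J a (\<lambda>j. v j + w j) = lin J a v + lin J a w"
  by (simp add: lin_def distrib_left sum.distrib)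

lemma lin_diff: "lin J a (\<lambda>j. v j - w j) = lin J a v - lin J a w"
  by (simp add: lin_def right_diff_distrib sum_subtractf)

lemma lin_pow_sum: "lin J a (pow_sum m x) = (\<Sum>i<m. lin J a (pow1 (x i)))"
  unfolding lin_def pow_sum_def pow1_def sum_distrib_left by (rule sum.swap)

lemma sum_tuples: "(\<Sum>x\<in>tuples G m. \<psi> (lin J a (pow_sum m x))) = char_sum G J a ^ m"
proof -
  have "char_sum G J a ^ m = (\<Prod>i<m. \<Sum>x\<in>G. \<psi> (lin J a (pow1 x)))"
    by (simp add: char_sum_def)
  also have "\<dots> = (\<Sum>x\<in>tuples G m. \<Prod>i<m. \<psi> (lin J a (pow1 (x i))))"
    unfolding tuples_def by (intro prod_sum_PiE) auto
  finally show ?thesis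
    by (simp add: lin_pow_sum \<psi>_sum)
qed

lemma moment_eq_energy:
  assumes "finite J" "finite T"
    and "\<And>a. cmod (\<Sum>t\<in>T. \<psi> (lin J a (v t))) = cmod (char_sum G J a) ^ m"
  shows "(\<Sum>a\<in>coeffs J. cmod (char_sum G J a) ^ (2 * m)) = real (CARD('k) ^ card J * energy T v J)"
  using parseval[OF assms(1,2), of v] by (simp add: assms(3) mult.commute flip: power_mult)

lemma moment: "finite J \<Longrightarrow>
  (\<Sum>a\<in>coeffs J. cmod (char_sum G J a) ^ (2 * m)) = real (CARD('k) ^ card J * mean_value G m J)"
  unfolding mean_value_def
  by (rule moment_eq_energy) (simp_all add: finite_tuples sum_tuples norm_power)

text \<open>Conjugating some of the \<open>m\<close> factors of a product of sums changes signs in \<open>v\<close>, not the moment.\<close>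

lemma mean_value_eq_energy:
  assumes "finite J" "finite T"
    and "\<And>a. cmod (\<Sum>t\<in>T. \<psi> (lin J a (v t))) = cmod (char_sum G J a) ^ m"
  shows "mean_value G m J = energy T v J"
proof -
  have "real (CARD('k) ^ card J * mean_value G m J) = real (CARD('k) ^ card J * energy T v J)"
    using moment_eq_energy[OF assms] moment[OF assms(1)] by simp
  then show ?thesis
    by (simp del: of_nat_mult of_nat_power)
qed

lemma mean_value_antimono: "J \<subseteq> J' \<Longrightarrow> mean_value G m J' \<le> mean_value G m J"
  unfolding mean_value_def by (intro energy_antimono finite_tuples)

lemma mean_value_1: "finite J \<Longrightarrow> mean_value G 1 J = energy G pow1 J"
  by (rule mean_value_eq_energy) (simp_all add: char_sum_def)

lemma mean_value_2: "finite J \<Longrightarrow> mean_value G 2 J = energy (G \<times> G) pow_sum2 J"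
proof (rule mean_value_eq_energy)
  fix a
  have "lin J a (pow_sum2 t) = lin J a (pow1 (fst t)) + lin J a (pow1 (snd t))" for t
    unfolding lin_add[symmetric] by (simp add: pow_sum2_def pow1_def case_prod_unfold)
  then have "(\<Sum>t\<in>G \<times> G. \<psi> (lin J a (pow_sum2 t))) = char_sum G J a * char_sum G J a"
    by (simp add: \<psi>_add char_sum_def sum_product sum.cartesian_product case_prod_unfold)
  then show "cmod (\<Sum>t\<in>G \<times> G. \<psi> (lin J a (pow_sum2 t))) = cmod (char_sum G J a) ^ 2"
    by (simp add: norm_mult power2_eq_square)
qed simp_all

lemma mean_value_2': "finite J \<Longrightarrow> mean_value G 2 J = energy (G \<times> G) pow_diff2 J"
proof (rule mean_value_eq_energy)
  fix a
  have "lin J a (pow_diff2 t) = lin J a (pow1 (fst t)) - lin J a (pow1 (snd t))" for t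
    unfolding lin_diff[symmetric] by (simp add: pow_diff2_def pow1_def case_prod_unfold)
  then have "(\<Sum>t\<in>G \<times> G. \<psi> (lin J a (pow_diff2 t))) = char_sum G J a * cnj (char_sum G J a)"
    by (simp add: \<psi>_diff char_sum_def sum_product sum.cartesian_product case_prod_unfold)
  then show "cmod (\<Sum>t\<in>G \<times> G. \<psi> (lin J a (pow_diff2 t))) = cmod (char_sum G J a) ^ 2"
    by (simp add: norm_mult power2_eq_square)
qed simp_all

lemma mean_value_3: "finite J \<Longrightarrow> mean_value G 3 J = energy (G \<times> G \<times> G) pow_sum3 J"
proof (rule mean_value_eq_energy)
  fix a
  have "lin J a (pow_sum3 t) = lin J a (pow1 (fst t)) + (lin J a (pow1 (fst (snd t))) + lin J a (pow1 (snd (snd t))))" for t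
    unfolding lin_add[symmetric] by (simp add: pow_sum3_def pow1_def case_prod_unfold add.assoc)
  then have "(\<Sum>t\<in>G \<times> G \<times> G. \<psi> (lin J a (pow_sum3 t))) = char_sum G J a * (char_sum G J a * char_sum G J a)"
    by (simp add: \<psi>_add char_sum_def sum_product sum.cartesian_product case_prod_unfold)
  then show "cmod (\<Sum>t\<in>G \<times> G \<times> G. \<psi> (lin J a (pow_sum3 t))) = cmod (char_sum G J a) ^ 3"
    by (simp add: norm_mult power3_eq_cube)
qed simp_all

lemma mean_value_3': "finite J \<Longrightarrow> mean_value G 3 J = energy (G \<times> G \<times> G) pow_diff3 J"
proof (rule mean_value_eq_energy)
  fix a
  have "lin J a (pow_diff3 t) = lin J a (pow1 (snd (snd t))) - (lin J a (pow1 (fst t)) + lin J a (pow1 (fst (snd t))))" for t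
    unfolding lin_add[symmetric] lin_diff[symmetric] by (simp add: pow_diff3_def pow1_def case_prod_unfold diff_diff_eq)
  then have "(\<Sum>t\<in>G \<times> G \<times> G. \<psi> (lin J a (pow_diff3 t)))
      = (\<Sum>t\<in>G \<times> G \<times> G. cnj (\<psi> (lin J a (pow1 (fst t)))) * (cnj (\<psi> (lin J a (pow1 (fst (snd t))))) * \<psi> (lin J a (pow1 (snd (snd t))))))"
    by (simp add: \<psi>_add \<psi>_diff mult_ac)
  also have "\<dots> = cnj (char_sum G J a) * (cnj (char_sum G J a) * char_sum G J a)"
    by (simp add: char_sum_def sum_product sum.cartesian_product case_prod_unfold)
  finally show "cmod (\<Sum>t\<in>G \<times> G \<times> G. \<psi> (lin J a (pow_diff3 t))) = cmod (char_sum G J a) ^ 3"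
    by (simp add: norm_mult power3_eq_cube)
qed simp_all

lemma norm_char_sum_le: "cmod (char_sum G J a) \<le> card G"
  unfolding char_sum_def using norm_sum[of "\<lambda>x. \<psi> (lin J a (pow1 x))" G] by (simp add: norm_\<psi>)

text \<open>The zero vector contributes trivially. At any other vector, 2k - 2m factors of the 2k-th
  power are estimated by M, and the remaining 2m are completed to a full moment.\<close>

lemma mean_value_le:
  assumes "finite J" "m \<le> k"
    and M: "\<And>a. a \<in> coeffs J \<Longrightarrow> (\<exists>j\<in>J. a j \<noteq> 0) \<Longrightarrow> cmod (char_sum G J a) \<le> M"
  shows "real CARD('k) ^ card J * real (mean_value G k J)
    \<le> real (card G) ^ (2 * k) + M ^ (2 * k - 2 * m) * (real CARD('k) ^ card J * real (mean_value G m J))"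
proof -
  define z where "z = (\<lambda>j\<in>J. 0 :: 'k)"
  have z: "z \<in> coeffs J" by (simp add: z_def coeffs_def)
  have nz: "\<exists>j\<in>J. a j \<noteq> 0" if "a \<in> coeffs J - {z}" for a
  proof (rule ccontr)
    assume "\<not> ?thesis"
    then have "a = z"
      using that by (intro PiE_ext[of _ J "\<lambda>_. UNIV"]) (auto simp: z_def coeffs_def)
    then show False using that by simp
  qed
  have "real CARD('k) ^ card J * real (mean_value G k J) = (\<Sum>a\<in>coeffs J. cmod (char_sum G J a) ^ (2 * k))"
    using moment[OF assms(1), of G k] by simp
  also have "\<dots> = cmod (char_sum G J z) ^ (2 * k) + (\<Sum>a\<in>coeffs J - {z}. cmod (char_sum G J a) ^ (2 * k))"
    using z by (intro sum.remove finite_coeffs assms)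
  also have "cmod (char_sum G J z) ^ (2 * k) \<le> real (card G) ^ (2 * k)"
    by (intro power_mono norm_char_sum_le) auto
  also have "(\<Sum>a\<in>coeffs J - {z}. cmod (char_sum G J a) ^ (2 * k))
      \<le> (\<Sum>a\<in>coeffs J - {z}. M ^ (2 * k - 2 * m) * cmod (char_sum G J a) ^ (2 * m))"
  proof (intro sum_mono)
    fix a assume a: "a \<in> coeffs J - {z}"
    have "cmod (char_sum G J a) ^ (2 * k) = cmod (char_sum G J a) ^ (2 * k - 2 * m) * cmod (char_sum G J a) ^ (2 * m)"
      using assms(2) by (simp flip: power_add)
    also have "\<dots> \<le> M ^ (2 * k - 2 * m) * cmod (char_sum G J a) ^ (2 * m)"
      using M a nz[OF a] by (intro mult_right_mono power_mono) auto
    finally show "cmod (char_sum G J a) ^ (2 * k) \<le> M ^ (2 * k - 2 * m) * cmod (char_sum G J a) ^ (2 * m)" .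
  qed
  also have "\<dots> \<le> M ^ (2 * k - 2 * m) * (\<Sum>a\<in>coeffs J. cmod (char_sum G J a) ^ (2 * m))"
  proof (cases "coeffs J - {z} = {}")
    case True
    \<comment> \<open>Without a nonzero vector nothing is known about the sign of M, but its
      exponent is even.\<close>
    have "0 \<le> M ^ (2 * (k - m)) * (\<Sum>a\<in>coeffs J. cmod (char_sum G J a) ^ (2 * m))"
      by (intro mult_nonneg_nonneg sum_nonneg zero_le_even_power) auto
    then show ?thesis
      unfolding True diff_mult_distrib2 by simp
  next
    case False
    then obtain a where "a \<in> coeffs J - {z}" by blast
    then have "M \<ge> 0"
      using order_trans[OF norm_ge_zero M[OF _ nz]] by blast
    then show ?thesis
      unfolding sum_distrib_left by (intro sum_mono2 finite_coeffs assms) auto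
  qed
  finally show ?thesis
    using moment[OF assms(1), of G m] by simp
qed

text \<open>The exponent 2 m is reached in two stages: power means with exponent m over the
  k-tuples, then Cauchy-Schwarz over the vectors of power sums that these tuples attain.\<close>

lemma bilinear_bound:
  assumes J: "finite J" and G: "\<And>u. u \<in> G \<Longrightarrow> bij_betw (\<lambda>x. u * x) G G"
    and f: "\<And>j. j \<in> J \<Longrightarrow> f j \<noteq> 0" and m: "m \<ge> 1"
  shows "(real (card G) * cmod (char_sum G J f) ^ k) ^ (2 * m)
    \<le> real (card G) ^ (k * (2 * m - 2)) * real (mean_value G k J)
        * (real CARD('k) ^ card J * real (mean_value G m J))"
proof -
  define T where "T = tuples G k"
  define scaled where "scaled = (\<lambda>l. \<lambda>j\<in>J. f j * l j)"
  define H where "H = (\<lambda>l. cmod (char_sum G J (scaled l)))"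
  define pr where "pr = (\<lambda>t. restrict (pow_sum k t) J)"
  obtain m' where m': "m = Suc m'" using m by (cases m) auto
  have finT: "finite T" by (simp add: T_def finite_tuples)
  have cong: "lin J a v = lin J a' v'" if "\<And>j. j \<in> J \<Longrightarrow> a j * v j = a' j * v' j" for a v a' v'
    unfolding lin_def using that by (intro sum.cong refl)
  have "real (card G) * cmod (char_sum G J f) ^ k \<le> (\<Sum>t\<in>T. H (pr t))"
  proof -
    \<comment> \<open>Once x is replaced by u x, the k-th power has the phases f j * u^j times the
      j-th power sum of the tuple. Read the other way round, u is the variable and the power sums
      are part of the coefficients.\<close>
    have eq: "char_sum G J f ^ k = (\<Sum>t\<in>T. \<psi> (lin J (scaled (pr t)) (pow1 u)))" if u: "u \<in> G" for u
    proof -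
      have "char_sum G J f = (\<Sum>x\<in>G. \<psi> (lin J f (pow1 (u * x))))"
        unfolding char_sum_def by (rule sum.reindex_bij_betw[OF G[OF u], symmetric])
      also have "\<dots> = char_sum G J (\<lambda>j. f j * u ^ j)"
        unfolding char_sum_def by (intro sum.cong refl arg_cong[of _ _ \<psi>] cong) (simp add: pow1_def power_mult_distrib)
      finally have "char_sum G J f ^ k = (\<Sum>t\<in>T. \<psi> (lin J (\<lambda>j. f j * u ^ j) (pow_sum k t)))"
        by (simp add: T_def sum_tuples)
      also have "\<dots> = (\<Sum>t\<in>T. \<psi> (lin J (scaled (pr t)) (pow1 u)))"
        by (intro sum.cong refl arg_cong[of _ _ \<psi>] cong) (simp add: scaled_def pr_def pow1_def)
      finally show ?thesis .
    qed
    have "of_nat (card G) * char_sum G J f ^ k = (\<Sum>u\<in>G. char_sum G J f ^ k)"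
      by simp
    also have "\<dots> = (\<Sum>u\<in>G. \<Sum>t\<in>T. \<psi> (lin J (scaled (pr t)) (pow1 u)))"
      by (rule sum.cong[OF refl eq])
    also have "\<dots> = (\<Sum>t\<in>T. char_sum G J (scaled (pr t)))"
      unfolding char_sum_def by (rule sum.swap)
    finally have "cmod (of_nat (card G) * char_sum G J f ^ k) = cmod (\<Sum>t\<in>T. char_sum G J (scaled (pr t)))"
      by simp
    then show ?thesis
      unfolding H_def by (simp add: norm_mult norm_power norm_sum)
  qed
  then have "(real (card G) * cmod (char_sum G J f) ^ k) ^ (2 * m) \<le> ((\<Sum>t\<in>T. H (pr t)) ^ m) ^ 2"
    unfolding power_mult[symmetric] by (subst mult.commute) (intro power_mono; simp)
  also have "\<dots> \<le> (real (card T) ^ m' * (\<Sum>t\<in>T. H (pr t) ^ m)) ^ 2"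
    unfolding m' by (intro power_mono sum_power_le finT zero_le_power sum_nonneg) (simp_all add: H_def)
  also have "\<dots> = real (card G) ^ (k * (2 * m - 2)) * (\<Sum>t\<in>T. H (pr t) ^ m) ^ 2"
    by (simp add: T_def card_tuples m' power_mult_distrib mult_ac flip: power_mult)
  finally have main: "(real (card G) * cmod (char_sum G J f) ^ k) ^ (2 * m)
      \<le> real (card G) ^ (k * (2 * m - 2)) * (\<Sum>t\<in>T. H (pr t) ^ m) ^ 2" .
  have "(\<Sum>t\<in>T. H (pr t) ^ m) = (\<Sum>l\<in>coeffs J. real (card {t\<in>T. pr t = l}) * H l ^ m)"
  proof -
    have "(\<Sum>t\<in>T. H (pr t) ^ m) = (\<Sum>l\<in>coeffs J. \<Sum>t\<in>{t\<in>T. pr t = l}. H (pr t) ^ m)"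
      by (rule sum.group[OF finT finite_coeffs[OF J], symmetric]) (auto simp: pr_def coeffs_def)
    also have "\<dots> = (\<Sum>l\<in>coeffs J. real (card {t\<in>T. pr t = l}) * H l ^ m)"
      by (intro sum.cong refl) simp
    finally show ?thesis .
  qed
  \<comment> \<open>Cauchy-Schwarz separates the multiplicity of each power sum vector, whose
    squares add up to \<open>mean_value G k J\<close>, from the character sum attached to that
    vector.\<close>
  also have "(\<Sum>l\<in>coeffs J. real (card {t\<in>T. pr t = l}) * H l ^ m) ^ 2
      \<le> (\<Sum>l\<in>coeffs J. real (card {t\<in>T. pr t = l}) ^ 2) * (\<Sum>l\<in>coeffs J. (H l ^ m) ^ 2)"
    by (rule Cauchy_Schwarz_ineq_sum)
  also have "(\<Sum>l\<in>coeffs J. real (card {t\<in>T. pr t = l}) ^ 2) = real (mean_value G k J)"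
  proof -
    have "{(t, t') \<in> T \<times> T. \<forall>j\<in>J. pow_sum k t j = pow_sum k t' j} = (SIGMA t:T. {t'\<in>T. pr t' = pr t})"
      by (auto simp: pr_def restrict_def fun_eq_iff)
    then have "mean_value G k J = (\<Sum>t\<in>T. card {t'\<in>T. pr t' = pr t})"
      unfolding mean_value_def energy_def T_def[symmetric] using finT by simp
    also have "\<dots> = (\<Sum>l\<in>coeffs J. \<Sum>t\<in>{t\<in>T. pr t = l}. card {t'\<in>T. pr t' = pr t})"
      by (rule sum.group[OF finT finite_coeffs[OF J], symmetric]) (auto simp: pr_def coeffs_def)
    also have "\<dots> = (\<Sum>l\<in>coeffs J. card {t\<in>T. pr t = l} ^ 2)"
      by (intro sum.cong refl) (simp add: power2_eq_square)
    finally show ?thesis by simp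
  qed
  also have "(\<Sum>l\<in>coeffs J. (H l ^ m) ^ 2) = real CARD('k) ^ card J * real (mean_value G m J)"
  proof -
    have "(\<Sum>l\<in>coeffs J. (H l ^ m) ^ 2) = (\<Sum>l\<in>coeffs J. cmod (char_sum G J (scaled l)) ^ (2 * m))"
      by (simp add: H_def mult.commute flip: power_mult)
    \<comment> \<open>No f j is zero, so scaling by f permutes the coefficient vectors and the sum
      is a complete moment.\<close>
    also have "\<dots> = (\<Sum>l\<in>coeffs J. cmod (char_sum G J l) ^ (2 * m))"
      by (rule sum.reindex_bij_witness[of _ "\<lambda>l. \<lambda>j\<in>J. l j / f j" scaled])
        (use f in \<open>auto simp: scaled_def coeffs_def fun_eq_iff restrict_def PiE_def extensional_def\<close>)
    finally show ?thesis
      using moment[OF J, of G m] by simp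
  qed
  finally have "(\<Sum>t\<in>T. H (pr t) ^ m) ^ 2
      \<le> real (mean_value G k J) * (real CARD('k) ^ card J * real (mean_value G m J))" .
  from order_trans[OF main mult_left_mono[OF this]] show ?thesis
    by (simp add: mult.assoc)
qed

end

section \<open>Induction on the degree\<close>

context
  fixes \<epsilon> :: real
  assumes \<epsilon>: "0 < \<epsilon>" "\<epsilon> < 4 / 7"
begin

text \<open>The numerator 1 - 7 \<epsilon> / 3 becomes negative for \<epsilon> > 3/7, but its
  quotient stays above -2 because \<epsilon> < 27/35; so positivity is not lost.\<close>

lemma kappa_3_ge: "kappa \<epsilon> 3 \<ge> 2"
proof -
  have "kappa \<epsilon> 3 = \<lceil>(1 - 7 * \<epsilon> / 3) / (2 * (7 / 27 * \<epsilon>)) + 3\<rceil>"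
    using kappa_rec[of 3 \<epsilon>] eta_1_2[of \<epsilon>] by simp
  moreover have "(1 - 7 * \<epsilon> / 3) / (2 * (7 / 27 * \<epsilon>)) + 3 > 1"
  proof -
    have "(1 - 7 * \<epsilon> / 3) / (2 * (7 / 27 * \<epsilon>)) > - 2"
      using \<epsilon> by (subst less_divide_eq) (simp add: field_simps)
    then show ?thesis by simp
  qed
  ultimately show ?thesis by linarith
qed

text \<open>Since \<open>kappa \<epsilon> (n - 1) * eta \<epsilon> (n - 1)\<close> is 7 \<epsilon> /
  18, the claim reduces to 7 \<epsilon> / 9 <= n - 2 - 7 \<epsilon> / 3, which \<epsilon> < 4/7 and
  n >= 4 ensure.\<close>

lemma kappa_step:
  assumes "n \<ge> 4" "kappa \<epsilon> (n - 1) \<ge> 2"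
  shows "kappa \<epsilon> n \<ge> kappa \<epsilon> (n - 1)"
proof -
  define k where "k = real_of_int (kappa \<epsilon> (n - 1))"
  have k: "k \<ge> 2" using assms by (simp add: k_def)
  have eta: "eta \<epsilon> (n - 1) = 7 * \<epsilon> / (18 * k)"
    using assms eta_rec[of "n - 1" \<epsilon>] by (simp add: k_def)
  have "k \<le> (real n - 2 - 7 * \<epsilon> / 3) / (2 * eta \<epsilon> (n - 1))"
  proof -
    have "k * (2 * (7 * \<epsilon> / (18 * k))) = 7 * \<epsilon> / 9"
      using k by simp
    also have "\<dots> \<le> real n - 2 - 7 * \<epsilon> / 3"
      using assms \<epsilon> by linarith
    finally show ?thesis
      unfolding eta using k \<epsilon> by (subst le_divide_eq) simp
  qed
  then show ?thesis
    using kappa_rec[of n \<epsilon>] assms unfolding k_def by linarith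
qed

lemma kappa_ge_2: "n \<ge> 3 \<Longrightarrow> kappa \<epsilon> n \<ge> 2"
proof (induction n rule: dec_induct)
  case (step n)
  then show ?case
    using kappa_step[of "Suc n"] by simp
qed (rule kappa_3_ge)

lemma eta_pos: "eta \<epsilon> n > 0"
proof (cases "n \<le> 2")
  case False
  then show ?thesis
    using \<epsilon> kappa_ge_2[of n] eta_rec[of n \<epsilon>] by simp
qed (use \<epsilon> in \<open>simp add: eta.simps\<close>)

lemma eta_antimono: "n \<ge> 2 \<Longrightarrow> eta \<epsilon> n \<le> eta \<epsilon> (n - 1)"
proof -
  assume "n \<ge> 2"
  then consider "n = 2" | "n = 3" | "n \<ge> 4" by linarith
  then show ?thesis
  proof cases
    case 1
    then show ?thesis by (simp add: eta.simps)
  next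
    case 2
    have "7 * \<epsilon> / (18 * real_of_int (kappa \<epsilon> 3)) \<le> 7 * \<epsilon> / (18 * 2)"
      using kappa_3_ge \<epsilon> by (intro divide_left_mono) auto
    also have "\<dots> \<le> 7 / 27 * \<epsilon>"
      using \<epsilon> by simp
    finally show ?thesis
      using 2 eta_rec[of 3 \<epsilon>] eta_1_2[of \<epsilon>] by simp
  next
    case 3
    have "kappa \<epsilon> n \<ge> 2" "kappa \<epsilon> (n - 1) \<ge> 2"
      using 3 by (intro kappa_ge_2; simp)+
    then have "7 * \<epsilon> / (18 * real_of_int (kappa \<epsilon> n)) \<le> 7 * \<epsilon> / (18 * real_of_int (kappa \<epsilon> (n - 1)))"
      using 3 kappa_step[of n] \<epsilon> by (intro divide_left_mono mult_pos_pos) auto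
    then show ?thesis
      using 3 eta_rec[of n \<epsilon>] eta_rec[of "n - 1" \<epsilon>] by simp
  qed
qed

lemma eta_le: "n \<ge> 1 \<Longrightarrow> eta \<epsilon> n \<le> 7 / 27 * \<epsilon>"
proof (induction n rule: dec_induct)
  case (step n)
  then show ?case
    using eta_antimono[of "Suc n"] by simp
qed (simp add: eta.simps)

text \<open>The form in which the choice of \<open>kappa\<close> is used: it feeds the hypothesis on
  exponents in \<open>mean_value_powr\<close>.\<close>

lemma kappa_ge: "n \<ge> 3 \<Longrightarrow> real n - 2 - 7 * \<epsilon> / 3 \<le> 2 * (real_of_int (kappa \<epsilon> n) - 3) * eta \<epsilon> (n - 1)"
proof -
  assume n: "n \<ge> 3"
  have "(real n - 2 - 7 * \<epsilon> / 3) / (2 * eta \<epsilon> (n - 1)) \<le> real_of_int (kappa \<epsilon> n) - 3"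
    using kappa_rec[OF n, of \<epsilon>] by linarith
  then have "real n - 2 - 7 * \<epsilon> / 3 \<le> (real_of_int (kappa \<epsilon> n) - 3) * (2 * eta \<epsilon> (n - 1))"
    using eta_pos[of "n - 1"] pos_divide_le_eq[of "2 * eta \<epsilon> (n - 1)"] by simp
  then show ?thesis
    by (simp only: mult_ac)
qed

lemma kappa_ge_4: "n \<ge> 3 \<Longrightarrow> real n - 2 - 7 * \<epsilon> / 3 > 0 \<Longrightarrow> kappa \<epsilon> n \<ge> 4"
proof -
  assume n: "n \<ge> 3" "real n - 2 - 7 * \<epsilon> / 3 > 0"
  then have "(real n - 2 - 7 * \<epsilon> / 3) / (2 * eta \<epsilon> (n - 1)) > 0"
    using eta_pos[of "n - 1"] by simp
  then show ?thesis
    using kappa_rec[OF n(1), of \<epsilon>] by linarith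
qed

lemma kappa_eta: "n \<ge> 3 \<Longrightarrow> real_of_int (kappa \<epsilon> n) * eta \<epsilon> n = 7 * \<epsilon> / 18"
  using kappa_ge_2[of n] eta_rec[of n \<epsilon>] by simp

end

text \<open>N bounds the exponents. The size condition puts every i j with i, j <= N below the
  characteristic and makes 6 invertible, as the cubic identity requires. Equality of CHAR and CARD
  expresses that the field is a prime field.\<close>

locale subgroup_sums = additive_character \<psi>
  for \<psi> :: "'k::{finite,field_gcd} \<Rightarrow> complex" +
  fixes G :: "'k set" and N :: nat
  assumes G_bij: "u \<in> G \<Longrightarrow> bij_betw (\<lambda>x. u * x) G G"
    and G_pow: "x \<in> G \<Longrightarrow> x ^ card G = 1"
    and G_ne: "G \<noteq> {}"
    and N: "N \<ge> 1" and char: "CHAR('k) = CARD('k)" and big: "N\<^sup>2 + 6 < CARD('k)"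
begin

definition P :: real where "P = real CARD('k)"
definition t :: real where "t = log P (real (card G))"
text \<open>28 = 18 + 10 and 11 = 1 + 2 * 5 are taken from \<open>energy_pow_diff3\<close>; the
  constants of the other energy bounds are smaller.\<close>

definition c :: real where "c = 28 * real N ^ 11"

lemma P_gt_1: "P > 1"
  using big by (simp add: P_def)

lemma card_G: "real (card G) = P powr t"
proof -
  have "real (card G) > 0"
    using G_ne by (simp add: card_gt_0_iff)
  then show ?thesis
    using P_gt_1 by (simp add: t_def)
qed

lemma c_ge: "c \<ge> 28"
  using N by (simp add: c_def)

lemma CHAR_gt: "i \<le> N \<Longrightarrow> j \<le> N \<Longrightarrow> i * j < CHAR('k)"
  using mult_le_mono[of i N j N] big unfolding char power2_eq_square by linarith

lemma powr_t_power: "(P powr t) ^ n = P powr (real n * t)"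
  using P_gt_1 by (simp add: powr_power mult.commute)

lemma powr_43: "t \<le> 3 / 4 \<Longrightarrow> real (card G) powr (4 / 3) \<le> real CHAR('k)"
proof -
  assume "t \<le> 3 / 4"
  then have "P powr (t * (4 / 3)) \<le> P powr 1"
    using P_gt_1 by (intro powr_mono) auto
  then show ?thesis
    using P_gt_1 unfolding card_G powr_powr char P_def by simp
qed

lemma N_pow_le: "a \<le> 28 * N ^ 11 \<Longrightarrow> real a \<le> c"
  unfolding c_def by (metis of_nat_le_iff of_nat_mult of_nat_numeral of_nat_power)

lemma mean_value_1_single:
  assumes "1 \<le> n" "n \<le> N"
  shows "real (mean_value G 1 {n}) \<le> c * P powr t"
proof -
  have "real (mean_value G 1 {n}) \<le> real (n * card G)"
    unfolding mean_value_1[OF finite.insertI[OF finite.emptyI]] of_nat_le_iff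
    using assms by (intro energy_pow1) auto
  also have "\<dots> \<le> c * real (card G)"
  proof -
    have "real n \<le> c"
    proof (rule N_pow_le)
      have "n \<le> N ^ 11"
        using assms self_le_power[of N 11] by simp
      then show "n \<le> 28 * N ^ 11" by simp
    qed
    then show ?thesis
      by (simp add: mult_right_mono)
  qed
  finally show ?thesis by (simp add: card_G)
qed

lemma mean_value_2_single:
  assumes "1 \<le> n" "n \<le> N" "t \<le> 3 / 4"
  shows "real (mean_value G 2 {n}) \<le> c * P powr (8 * t / 3)"
proof -
  have "n < CHAR('k)"
    using CHAR_gt[of n 1] assms N by simp
  then have "real (mean_value G 2 {n}) \<le> 19 * real n ^ 5 * real (card G) powr (8 / 3)"
    using energy_pow_diff2[OF assms(1) _ G_pow powr_43[OF assms(3)] G_ne] by (simp add: mean_value_2')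
  also have "\<dots> \<le> c * real (card G) powr (8 / 3)"
  proof (intro mult_right_mono)
    have "n ^ 5 \<le> N ^ 5" "N ^ 5 \<le> N ^ 11"
      using assms N by (auto intro: power_mono power_increasing)
    then have "real (19 * n ^ 5) \<le> c"
      by (intro N_pow_le) linarith
    then show "19 * real n ^ 5 \<le> c" by simp
  qed simp
  finally show ?thesis
    by (simp add: card_G powr_powr mult.commute)
qed

lemma mean_value_2_pair:
  assumes "1 \<le> i" "i < j" "j \<le> N"
  shows "real (mean_value G 2 {i, j}) \<le> c * P powr (2 * t)"
proof -
  have "real (mean_value G 2 {i, j}) \<le> 2 * real (i * j * i) * real (card G) ^ 2"
    using energy_pow_sum2[OF _ assms(1,2) CHAR_gt] assms by (simp add: mean_value_2)
  also have "\<dots> \<le> c * real (card G) ^ 2"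
  proof (intro mult_right_mono)
    have "i * j * i \<le> N * N * N"
      using assms by (intro mult_le_mono) auto
    also have "\<dots> = N ^ 3" by (simp add: power3_eq_cube)
    also have "\<dots> \<le> N ^ 11"
      using N by (intro power_increasing) auto
    finally have "real (2 * (i * j * i)) \<le> c"
      by (intro N_pow_le) linarith
    then show "2 * real (i * j * i) \<le> c" by simp
  qed simp
  finally show ?thesis
    using powr_t_power[of 2] by (simp add: card_G)
qed

lemma mean_value_3_pair:
  assumes "1 \<le> i" "i < j" "j \<le> N" "t \<le> 3 / 4"
  shows "real (mean_value G 3 {i, j}) \<le> c * P powr (11 * t / 3)"
proof -
  have "real (mean_value G 3 {i, j})
      \<le> (18 * real i * real (i * j) ^ 5 + 10 * real (i * i * i * j * j)) * real (card G) powr (11 / 3)"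
    using energy_pow_diff3[OF assms(1,2) CHAR_gt G_pow powr_43[OF assms(4)] G_ne] assms
    by (simp add: mean_value_3')
  also have "\<dots> \<le> c * real (card G) powr (11 / 3)"
  proof (intro mult_right_mono)
    have "i * (i * j) ^ 5 \<le> N * (N * N) ^ 5"
      using assms by (intro mult_le_mono power_mono) auto
    also have "\<dots> = N ^ 11"
      by (simp add: power_mult_distrib eval_nat_numeral)
    finally have 1: "i * (i * j) ^ 5 \<le> N ^ 11" .
    have "i * i * i * j * j \<le> N * N * N * N * N"
      using assms by (intro mult_le_mono) auto
    also have "\<dots> = N ^ 5" by (simp add: eval_nat_numeral)
    also have "\<dots> \<le> N ^ 11"
      using N by (intro power_increasing) auto
    finally have "real (18 * (i * (i * j) ^ 5) + 10 * (i * i * i * j * j)) \<le> c"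
      using 1 by (intro N_pow_le) linarith
    then show "18 * real i * real (i * j) ^ 5 + 10 * real (i * i * i * j * j) \<le> c"
      by (simp add: mult.assoc)
  qed simp
  finally show ?thesis
    by (simp add: card_G powr_powr mult.commute)
qed

lemma mean_value_3_cubic: "real (mean_value G 3 {1, 2, 3}) \<le> c * P powr (3 * t)"
proof -
  have "(of_nat 6 :: 'k) \<noteq> 0"
    using big char by (intro of_nat_neq_0_CHAR) auto
  then have "energy (G \<times> G \<times> G) pow_sum3 {1, 2, 3} \<le> 27 * card G ^ 3"
    by (intro energy_pow_sum3) auto
  then have "real (mean_value G 3 {1, 2, 3}) \<le> real (27 * card G ^ 3)"
    using mean_value_3[of "{1, 2, 3}" G] by (simp only: of_nat_le_iff finite_insert finite.emptyI)
  also have "\<dots> \<le> c * real (card G) ^ 3"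
    using c_ge by (simp add: mult_right_mono)
  finally show ?thesis
    using powr_t_power[of 3] by (simp add: card_G)
qed

text \<open>\<open>bilinear_bound\<close> in exponents of P. The factor P ^ card J is grouped with
  the count for k, since \<open>mean_value_powr\<close> estimates such a product.\<close>

lemma bilinear_powr:
  assumes J: "finite J" and f: "\<And>j. j \<in> J \<Longrightarrow> f j \<noteq> 0" and m: "m \<ge> 1"
    and k: "P ^ card J * real (mean_value G k J) \<le> A * P powr ek" and em: "real (mean_value G m J) \<le> c * P powr em"
  shows "cmod (char_sum G J f) ^ (2 * m * k) \<le> A * c * P powr (real (k * (2 * m - 2)) * t + ek + em - 2 * real m * t)"
proof -
  define S where "S = cmod (char_sum G J f)"
  have A: "A \<ge> 0"
    using k P_gt_1 by (smt (verit) mult_nonneg_nonneg mult_neg_pos of_nat_0_le_iff powr_gt_zero zero_le_power)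
  have "(P powr t * S ^ k) ^ (2 * m) \<le> (P powr t) ^ (k * (2 * m - 2)) * real (mean_value G k J) * (P ^ card J * real (mean_value G m J))"
    using bilinear_bound[OF J G_bij f m, where k = k] unfolding S_def card_G P_def by simp
  also have "\<dots> = P powr (real (k * (2 * m - 2)) * t) * ((P ^ card J * real (mean_value G k J)) * real (mean_value G m J))"
    unfolding powr_t_power by simp
  also have "\<dots> \<le> P powr (real (k * (2 * m - 2)) * t) * ((A * P powr ek) * (c * P powr em))"
    using A by (intro mult_left_mono mult_mono[OF k em]) auto
  also have "\<dots> = A * c * P powr (real (k * (2 * m - 2)) * t + ek + em)"
    by (simp add: powr_add)
  finally have "P powr (2 * real m * t) * S ^ (2 * m * k) \<le> A * c * P powr (real (k * (2 * m - 2)) * t + ek + em)"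
    unfolding power_mult_distrib powr_t_power by (simp add: mult_ac flip: power_mult)
  then have "S ^ (2 * m * k) \<le> A * c * P powr (real (k * (2 * m - 2)) * t + ek + em) / P powr (2 * real m * t)"
    using P_gt_1 by (subst le_divide_eq) (simp add: mult.commute)
  then show ?thesis
    by (simp add: S_def powr_diff)
qed

lemma root_bound:
  assumes "x \<ge> 0" "q \<ge> 1" "x ^ q \<le> A * P powr e" "A \<le> B ^ q" "B \<ge> 0" "e \<le> real q * (t - \<eta>)"
  shows "x \<le> B * P powr (t - \<eta>)"
proof (rule power_le_imp_le_base)
  have "x ^ q \<le> B ^ q * P powr (real q * (t - \<eta>))"
    using assms P_gt_1 by (intro order_trans[OF assms(3)] mult_mono powr_mono) auto
  also have "\<dots> = (B * P powr (t - \<eta>)) ^ q"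
    using P_gt_1 by (simp add: power_mult_distrib powr_power mult.commute)
  finally show "x ^ Suc (q - 1) \<le> (B * P powr (t - \<eta>)) ^ Suc (q - 1)"
    using assms(2) by simp
qed (use assms in simp)

text \<open>The condition on exponents says that saving \<eta> in 2 (k - m) factors outweighs the
  excess of P^(card J + em) over P^(2 m t). Then the nonzero vectors contribute the same power of P
  as the zero vector, whence the factor 2.\<close>

lemma mean_value_powr:
  assumes J: "finite J" and mk: "m \<le> k" and C: "C \<ge> 1"
    and M: "\<And>a. (\<exists>j\<in>J. a j \<noteq> 0) \<Longrightarrow> cmod (char_sum G J a) \<le> C * P powr (t - \<eta>)"
    and em: "real (mean_value G m J) \<le> c * P powr em"
    and e: "real (card J) + em - 2 * real m * t \<le> 2 * real (k - m) * \<eta>"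
  shows "P ^ card J * real (mean_value G k J) \<le> 2 * c * C ^ (2 * k) * P powr (2 * real k * t)"
proof -
  have "P ^ card J * real (mean_value G k J)
      \<le> (P powr t) ^ (2 * k) + (C * P powr (t - \<eta>)) ^ (2 * k - 2 * m) * (P ^ card J * real (mean_value G m J))"
    using mean_value_le[OF J mk M] unfolding card_G P_def by blast
  also have "(C * P powr (t - \<eta>)) ^ (2 * k - 2 * m) * (P ^ card J * real (mean_value G m J))
      \<le> (C * P powr (t - \<eta>)) ^ (2 * k - 2 * m) * (P ^ card J * (c * P powr em))"
    using em C P_gt_1 by (intro mult_left_mono) auto
  also have "(C * P powr (t - \<eta>)) ^ (2 * k - 2 * m) = C ^ (2 * k - 2 * m) * P powr (2 * real (k - m) * (t - \<eta>))"
    using P_gt_1 mk by (simp add: power_mult_distrib powr_power of_nat_diff algebra_simps)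
  also have "C ^ (2 * k - 2 * m) * P powr (2 * real (k - m) * (t - \<eta>)) * (P ^ card J * (c * P powr em))
      = (C ^ (2 * k - 2 * m) * c) * P powr (2 * real (k - m) * (t - \<eta>) + real (card J) + em)"
    using P_gt_1 by (simp add: powr_add powr_realpow)
  also have "\<dots> \<le> (C ^ (2 * k) * c) * P powr (2 * real k * t)"
  proof (intro mult_mono powr_mono power_increasing)
    define d where "d = real (k - m)"
    have "2 * real k * t = 2 * d * t + 2 * real m * t"
      using mk by (simp add: d_def algebra_simps of_nat_diff)
    moreover have "2 * d * (t - \<eta>) = 2 * d * t - 2 * d * \<eta>"
      by (simp add: algebra_simps)
    ultimately show "2 * real (k - m) * (t - \<eta>) + real (card J) + em \<le> 2 * real k * t"
      using e unfolding d_def[symmetric] by linarith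
  qed (use C c_ge P_gt_1 in auto)
  also have "(P powr t) ^ (2 * k) = 1 * P powr (2 * real k * t)"
    unfolding powr_t_power by simp
  also have "1 * P powr (2 * real k * t) \<le> (C ^ (2 * k) * c) * P powr (2 * real k * t)"
  proof (intro mult_right_mono)
    have "1 * 1 \<le> C ^ (2 * k) * c"
      using C c_ge by (intro mult_mono one_le_power) auto
    then show "1 \<le> C ^ (2 * k) * c" by simp
  qed simp
  finally show ?thesis by (simp add: mult_ac)
qed

lemma char_sum_restrict:
  assumes "finite J" "J' \<subseteq> J" "\<And>j. j \<in> J - J' \<Longrightarrow> a j = 0"
  shows "char_sum G J a = char_sum G J' a"
proof -
  have "lin J a v = lin J' a v" for v
    unfolding lin_def using assms by (intro sum.mono_neutral_right) auto
  then show ?thesis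
    by (simp add: char_sum_def)
qed

text \<open>
  The energy bounds that rest on Stepanov's method need \<open>\<bar>G\<bar>\<^bsup>4/3\<^esup> \<le> p\<close>, that is \<open>t \<le> 3/4\<close>; for larger \<open>t\<close>
  the elementary ones are strong enough.
\<close>

lemma main_step:
  assumes \<epsilon>: "0 < \<epsilon>" "\<epsilon> < 4 / 7" "3 / 7 + \<epsilon> \<le> t"
    and n: "1 \<le> n" "n \<le> N" and J: "J \<subseteq> {1..n}" "n \<in> J" and f: "\<And>j. j \<in> J \<Longrightarrow> f j \<noteq> 0"
    and C: "C \<ge> 1"
    and IH: "\<And>J' a. n \<ge> 2 \<Longrightarrow> J' \<subseteq> {1..n-1} \<Longrightarrow> (\<exists>j\<in>J'. a j \<noteq> 0) \<Longrightarrow>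
      cmod (char_sum G J' a) \<le> C * P powr (t - eta \<epsilon> (n - 1))"
  shows "cmod (char_sum G J f) \<le> 2 * c\<^sup>2 * C * P powr (t - eta \<epsilon> n)"
proof -
  have finJ: "finite J"
    using J(1) finite_subset by blast
  define S where "S = cmod (char_sum G J f)"
  have S0: "S \<ge> 0" by (simp add: S_def)
  have eta: "eta \<epsilon> n \<le> 7 / 27 * \<epsilon>"
    using eta_le[OF \<epsilon>(1,2)] n by simp
  \<comment> \<open>From \<epsilon> <= t - 3/7 one gets 14 \<epsilon> / 9 <= 14 t / 9 - 2/3, and
    this is at most 2 t - 1 exactly for t >= 3/4.\<close>
  have t34: "14 * \<epsilon> / 9 \<le> 2 * t - 1" if "t \<ge> 3 / 4"
    using that \<epsilon> by linarith
  define B where "B = 2 * c\<^sup>2 * C"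
  have B0: "B \<ge> 0" and B1: "B \<ge> 1" and cB: "c\<^sup>2 \<le> B"
  proof -
    have "1 * 1 \<le> c\<^sup>2 * C" "c\<^sup>2 * 1 \<le> c\<^sup>2 * C"
      using c_ge C by (intro mult_mono one_le_power; simp)+
    then show "B \<ge> 0" "B \<ge> 1" "c\<^sup>2 \<le> B"
      unfolding B_def by linarith+
  qed
  have cc: "c * c \<le> B ^ q" if "q \<ge> 1" for q
    using cB self_le_power[OF B1, of q] that by (simp add: power2_eq_square)
  \<comment> \<open>The bilinear estimate with k = m. Its condition amounts to 2 m^2 eta <= 4 m t -
    2 em - card J.\<close>
  have direct: "S \<le> B * P powr (t - eta \<epsilon> n)"
    if m: "m \<ge> 1" and em: "real (mean_value G m J) \<le> c * P powr em"
      and e: "real (m * (2 * m - 2)) * t + real (card J) + 2 * em - 2 * real m * t \<le> 2 * real m * real m * (t - eta \<epsilon> n)"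
    for m em
  proof -
    have "P ^ card J * real (mean_value G m J) \<le> c * P powr (real (card J) + em)"
      using mult_left_mono[OF em, of "P ^ card J"] P_gt_1 by (simp add: powr_add powr_realpow mult_ac)
    from bilinear_powr[OF finJ f m this em]
    have *: "S ^ (2 * m * m) \<le> c * c * P powr (real (m * (2 * m - 2)) * t + real (card J) + 2 * em - 2 * real m * t)"
      by (simp add: S_def add.assoc)
    show ?thesis
      by (rule root_bound[OF S0 _ * cc B0]) (use m e in simp_all)
  qed
  have sub: "real (mean_value G m J) \<le> b" if "real (mean_value G m J') \<le> b" "J' \<subseteq> J" for m b J'
    using that mean_value_antimono[OF that(2), of G m] by (meson of_nat_le_iff order_trans)
  have pair: "\<exists>i j. i \<in> J' \<and> j \<in> J' \<and> 1 \<le> i \<and> i < j \<and> j \<le> N" if sub: "J' \<subseteq> J" and two: "card J' \<ge> 2" for J'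
  proof -
    obtain i j where "i \<in> J'" "j \<in> J'" "i \<noteq> j"
      using two by (metis card_le_Suc0_iff_eq card.infinite not_less_eq_eq numeral_2_eq_2 zero_le)
    then show ?thesis
      using sub J(1) n(2) by (metis atLeastAtMost_iff linorder_neqE_nat order_trans subsetD)
  qed
  have cardJ: "card J \<ge> 1" "card J \<le> n"
    using J finJ card_mono[OF _ J(1)] by (auto simp: Suc_le_eq card_gt_0_iff)
  consider "card J = 1" | "card J = 2" | "card J \<ge> 3" using cardJ by linarith
  then have "S \<le> B * P powr (t - eta \<epsilon> n)"
  proof cases
    case 1
    then have Jn: "J = {n}"
      using J(2) by (metis card_1_singletonE singletonD)
    show ?thesis
    proof (cases "t \<le> 3 / 4")
      case True
      show ?thesis
        by (rule direct[of 2 "8 * t / 3"]) (use mean_value_2_single[OF n True] eta \<epsilon> in \<open>simp_all add: Jn\<close>)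
    next
      case False
      show ?thesis
        by (rule direct[of 1 t]) (use mean_value_1_single[OF n] eta \<epsilon> t34 False in \<open>simp_all add: Jn\<close>)
    qed
  next
    case 2
    then obtain i j where ij: "i \<in> J" "j \<in> J" "1 \<le> i" "i < j" "j \<le> N"
      using pair[of J] by auto
    then have sJ: "{i, j} \<subseteq> J" by simp
    show ?thesis
    proof (cases "t \<le> 3 / 4")
      case True
      show ?thesis
        by (rule direct[of 3 "11 * t / 3", OF _ sub[OF mean_value_3_pair[OF ij(3-5) True] sJ]])
          (use eta \<epsilon> 2 in simp_all)
    next
      case False
      show ?thesis
        by (rule direct[of 2 "2 * t", OF _ sub[OF mean_value_2_pair[OF ij(3-5)] sJ]])
          (use eta \<epsilon> 2 t34 False in simp_all)
    qed
  next
    case 3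
    define J' where "J' = J - {n}"
    have n3: "n \<ge> 3" using 3 cardJ by simp
    have J': "J' \<subseteq> {1..n-1}" "J' \<subseteq> J" "finite J'"
      using J(1) finJ by (auto simp: J'_def)
    have cJ: "card J = card J' + 1"
      using card_Suc_Diff1[OF finJ J(2)] by (simp add: J'_def)
    obtain i j where ij: "i \<in> J'" "j \<in> J'" "1 \<le> i" "i < j" "j \<le> N"
      using pair[of J'] J' cJ 3 by auto
    have sJ': "{i, j} \<subseteq> J'" and sJ: "{i, j} \<subseteq> J" using ij J' by auto
    have sub': "real (mean_value G m J') \<le> b" if "real (mean_value G m J'') \<le> b" "J'' \<subseteq> J'" for m b J''
      using that mean_value_antimono[OF that(2), of G m] by (meson of_nat_le_iff order_trans)
    define k where "k = nat (kappa \<epsilon> n)"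
    have kk: "real k = real_of_int (kappa \<epsilon> n)"
      using kappa_ge_2[OF \<epsilon>(1,2) n3] by (simp add: k_def)
    have k_eta: "real k * eta \<epsilon> n = 7 * \<epsilon> / 18"
      using kappa_eta[OF \<epsilon>(1,2) n3] by (simp add: kk)
    have k_ge: "real n - 2 - 7 * \<epsilon> / 3 \<le> 2 * (real k - 3) * eta \<epsilon> (n - 1)"
      using kappa_ge[OF \<epsilon>(1,2) n3] by (simp add: kk)
    have eta': "eta \<epsilon> (n - 1) > 0"
      using eta_pos[OF \<epsilon>(1,2)] .
    \<comment> \<open>Dropping the equation for the exponent n can only enlarge the count for k;
      passing from \<open>card J'\<close> to \<open>card J\<close> costs one factor P. The last
      hypothesis says that the count for l recovers this factor with a margin of 2 l (7 \<epsilon> /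
      18), that is 2 l k eta.\<close>
    have via: "S \<le> B * P powr (t - eta \<epsilon> n)"
      if k4: "k \<ge> 4" and m: "1 \<le> m" "m \<le> k" "1 \<le> l" and em: "real (mean_value G m J') \<le> c * P powr em"
        and e: "real (card J') + em - 2 * real m * t \<le> 2 * real (k - m) * eta \<epsilon> (n - 1)"
        and el: "real (mean_value G l J) \<le> c * P powr el"
        and e2: "1 + el - 2 * real l * t \<le> - (2 * real l * (7 * \<epsilon> / 18))"
      for m em l el
    proof -
      have "P ^ card J' * real (mean_value G k J') \<le> 2 * c * C ^ (2 * k) * P powr (2 * real k * t)"
        using IH J'(1) n3 by (intro mean_value_powr[OF J'(3) m(2) C _ em e]) auto
      moreover have "P ^ card J' * real (mean_value G k J) \<le> P ^ card J' * real (mean_value G k J')"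
        using mean_value_antimono[OF J'(2), of G k] P_gt_1 by (intro mult_left_mono) simp_all
      ultimately have "P ^ card J' * real (mean_value G k J) \<le> 2 * c * C ^ (2 * k) * P powr (2 * real k * t)"
        by linarith
      then have "P * (P ^ card J' * real (mean_value G k J)) \<le> P * (2 * c * C ^ (2 * k) * P powr (2 * real k * t))"
        using P_gt_1 by (intro mult_left_mono) auto
      then have "P ^ card J * real (mean_value G k J) \<le> (2 * c * C ^ (2 * k)) * P powr (2 * real k * t + 1)"
        using P_gt_1 by (simp add: cJ powr_add mult_ac)
      from bilinear_powr[OF finJ f m(3) this el]
      have *: "S ^ (2 * l * k) \<le> 2 * c * C ^ (2 * k) * c
          * P powr (real (k * (2 * l - 2)) * t + (2 * real k * t + 1) + el - 2 * real l * t)"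
        by (simp add: S_def)
      show ?thesis
      proof (rule root_bound[OF S0 _ * _ B0])
        show "1 \<le> 2 * l * k"
          using m k4 by simp
        have "2 * c * C ^ (2 * k) * c = 2 * c\<^sup>2 * C ^ (2 * k)"
          by (simp add: power2_eq_square)
        also have "\<dots> \<le> (2 * c\<^sup>2) ^ (2 * l * k) * C ^ (2 * l * k)"
        proof (rule mult_mono)
          have "1 \<le> c\<^sup>2"
            using c_ge by (intro one_le_power) simp
          then show "2 * c\<^sup>2 \<le> (2 * c\<^sup>2) ^ (2 * l * k)"
            using m k4 by (intro self_le_power) (linarith, simp)
          show "C ^ (2 * k) \<le> C ^ (2 * l * k)"
            using C m by (intro power_increasing) simp_all
        qed (use C in simp_all)
        also have "\<dots> = B ^ (2 * l * k)"
          by (simp add: B_def power_mult_distrib)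
        finally show "2 * c * C ^ (2 * k) * c \<le> B ^ (2 * l * k)" .
        have "real (2 * l - 2) = 2 * real l - 2"
          using m by simp
        then have "real (k * (2 * l - 2)) * t + (2 * real k * t + 1) + el - 2 * real l * t
            = 2 * real l * real k * t + (1 + el - 2 * real l * t)"
          by (simp add: algebra_simps)
        also have "\<dots> \<le> 2 * real l * real k * t - 2 * real l * (real k * eta \<epsilon> n)"
          using e2 by (simp add: k_eta)
        also have "\<dots> = real (2 * l * k) * (t - eta \<epsilon> n)"
          by (simp add: algebra_simps)
        finally show "real (k * (2 * l - 2)) * t + (2 * real k * t + 1) + el - 2 * real l * t
            \<le> real (2 * l * k) * (t - eta \<epsilon> n)" .
      qed
    qed
    have cJ': "real (card J') = real (card J) - 1" "real (card J) \<le> real n"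
      using cJ cardJ by simp_all
    show ?thesis
    proof (cases "t \<le> 3 / 4")
      case True
      \<comment> \<open>Here \<epsilon> <= 3/4 - 3/7 = 9/28, so the numerator in
        \<open>kappa\<close> is positive and k - 3 is a genuine difference.\<close>
      have "real n - 2 - 7 * \<epsilon> / 3 > 0"
        using n3 True \<epsilon> by linarith
      then have k4: "k \<ge> 4"
        using kappa_ge_4[OF \<epsilon>(1,2) n3] by (simp add: k_def)
      show ?thesis
      proof (rule via[OF k4 _ _ _ sub'[OF mean_value_3_pair[OF ij(3-5) True] sJ'] _
            sub[OF mean_value_3_pair[OF ij(3-5) True] sJ]])
        show "real (card J') + 11 * t / 3 - 2 * real 3 * t \<le> 2 * real (k - 3) * eta \<epsilon> (n - 1)"
          using k_ge k4 cJ' \<epsilon> by (simp add: of_nat_diff)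
      qed (use k4 \<epsilon> in simp_all)
    next
      case False
      then have T34: "14 * \<epsilon> / 9 \<le> 2 * t - 1" by (intro t34) simp
      show ?thesis
      \<comment> \<open>For n = 3 and large \<epsilon>, \<open>kappa\<close> may drop below 3; then
        J is {1, 2, 3} and its own cubic count suffices.\<close>
      proof (cases "n = 3")
        case True
        have "J = {1..3}"
          using J(1) 3 True cardJ by (intro card_subset_eq) auto
        then have J3: "J = {1, 2, 3}" by auto
        show ?thesis
          by (rule direct[of 3 "3 * t"]) (use mean_value_3_cubic eta T34 in \<open>simp_all add: J3\<close>)
      next
        case False
        then have n4: "n \<ge> 4" using n3 by simp
        then have "real n - 2 - 7 * \<epsilon> / 3 > 0"
          using \<epsilon> by linarith
        then have k4: "k \<ge> 4"
          using kappa_ge_4[OF \<epsilon>(1,2) n3] by (simp add: k_def)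
        note el = sub[OF mean_value_2_pair[OF ij(3-5)] sJ]
        show ?thesis
        \<comment> \<open>If J is all of {1..n}, then J' contains {1, 2, 3} and the cubic count
          serves with m = 3. Otherwise \<open>card J'\<close> is at most n - 2, and this spare unit
          makes the weaker count with m = 2 enough.\<close>
        proof (cases "card J = n")
          case True
          then have "J = {1..n}"
            using J(1) by (intro card_subset_eq) auto
          then have s123: "{1, 2, 3} \<subseteq> J'"
            using n4 by (auto simp: J'_def)
          show ?thesis
          proof (rule via[OF k4 _ _ _ sub'[OF mean_value_3_cubic s123] _ el])
            show "real (card J') + 3 * t - 2 * real 3 * t \<le> 2 * real (k - 3) * eta \<epsilon> (n - 1)"
              using k_ge k4 cJ' \<epsilon> by (simp add: of_nat_diff)
          qed (use k4 T34 in simp_all)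
        next
          case False
          then have "card J \<le> n - 1" using cardJ by simp
          then have "real (card J) \<le> real n - 1" using n4 by linarith
          show ?thesis
          proof (rule via[OF k4 _ _ _ sub'[OF mean_value_2_pair[OF ij(3-5)] sJ'] _ el])
            have "2 * (real k - 3) * eta \<epsilon> (n - 1) \<le> 2 * (real k - 2) * eta \<epsilon> (n - 1)"
              using eta' by simp
            then show "real (card J') + 2 * t - 2 * real 2 * t \<le> 2 * real (k - 2) * eta \<epsilon> (n - 1)"
              using k_ge k4 cJ' \<epsilon> \<open>real (card J) \<le> real n - 1\<close> by (simp add: of_nat_diff)
          qed (use k4 T34 in simp_all)
        qed
      qed
    qed
  qed
  then show ?thesis
    by (simp add: S_def B_def)
qed

text \<open>Each degree costs one factor 2 c^2. Zero coefficients are discarded first; if that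
  removes the top exponent, the bound for the smaller degree is already stronger because eta
  decreases.\<close>

lemma main_bound:
  assumes \<epsilon>: "0 < \<epsilon>" "\<epsilon> < 4 / 7" "3 / 7 + \<epsilon> \<le> t"
    and "1 \<le> n" "n \<le> N" "J \<subseteq> {1..n}" "\<exists>j\<in>J. f j \<noteq> 0"
  shows "cmod (char_sum G J f) \<le> (2 * c\<^sup>2) ^ n * P powr (t - eta \<epsilon> n)"
proof -
  have C: "(2 * c\<^sup>2) ^ n \<ge> 1" for n
  proof -
    have "1 \<le> c\<^sup>2"
      using c_ge by (intro one_le_power) simp
    then show ?thesis
      by (intro one_le_power) linarith
  qed
  have restrict: "char_sum G J f = char_sum G {j\<in>J. f j \<noteq> 0} f" if "J \<subseteq> {1..n}" for J f n
    using that finite_subset by (intro char_sum_restrict) auto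
  show ?thesis
    using assms(4-)
  proof (induction n arbitrary: J f rule: dec_induct)
    case base
    have "cmod (char_sum G {j\<in>J. f j \<noteq> 0} f) \<le> 2 * c\<^sup>2 * 1 * P powr (t - eta \<epsilon> 1)"
      using base by (intro main_step[OF \<epsilon>]) auto
    then show ?case
      using restrict[OF base(2)] by simp
  next
    case (step n)
    define J' where "J' = {j\<in>J. f j \<noteq> 0}"
    have "cmod (char_sum G J' f) \<le> (2 * c\<^sup>2) ^ Suc n * P powr (t - eta \<epsilon> (Suc n))"
    proof (cases "Suc n \<in> J'")
      case True
      have "cmod (char_sum G J' f) \<le> 2 * c\<^sup>2 * (2 * c\<^sup>2) ^ n * P powr (t - eta \<epsilon> (Suc n))"
        using True step by (intro main_step[OF \<epsilon>] C) (auto simp: J'_def)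
      then show ?thesis by simp
    next
      case False
      have "J' \<subseteq> {1..n}"
      proof
        fix j assume "j \<in> J'"
        then have "j \<in> {1..Suc n}" "j \<noteq> Suc n"
          using step.prems False by (auto simp: J'_def)
        then show "j \<in> {1..n}" by simp
      qed
      moreover have "\<exists>j\<in>J'. f j \<noteq> 0"
        using step.prems by (auto simp: J'_def)
      ultimately have "cmod (char_sum G J' f) \<le> (2 * c\<^sup>2) ^ n * P powr (t - eta \<epsilon> n)"
        using step by auto
      also have "\<dots> \<le> (2 * c\<^sup>2) ^ Suc n * P powr (t - eta \<epsilon> (Suc n))"
      proof (intro mult_mono powr_mono)
        show "(2 * c\<^sup>2) ^ n \<le> (2 * c\<^sup>2) ^ Suc n"
          using C[of 1] by (intro power_increasing) auto
        show "t - eta \<epsilon> n \<le> t - eta \<epsilon> (Suc n)"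
          using eta_antimono[OF \<epsilon>(1,2), of "Suc n"] step by simp
        show "0 \<le> (2 * c\<^sup>2) ^ Suc n"
          using C[of "Suc n"] by linarith
      qed (use P_gt_1 in simp_all)
      finally show ?thesis .
    qed
    then show ?case
      using restrict[OF step.prems(2)] by (simp add: J'_def)
  qed
qed

end

section \<open>Prime residue rings\<close>

text \<open>The second summand absorbs the primes p <= n^2 + 6: there the trivial bound is enough,
  because eta is at most 1.\<close>

definition bound_const :: "nat \<Rightarrow> real" where
  "bound_const n = (2 * (28 * real n ^ 11)\<^sup>2) ^ n + (real n ^ 2 + 6)"

lemma e_p_add: "e_p p (x + y) = e_p p x * e_p p y"
  by (simp add: e_p_def ring_distribs add_divide_distrib exp_add)

lemma e_p_multiple: "p > 0 \<Longrightarrow> e_p p (int p * z) = 1"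
proof -
  assume "p > 0"
  then have "e_p p (int p * z) = exp (2 * of_int z * of_real pi * \<i>)"
    by (simp add: e_p_def field_simps)
  then show ?thesis
    using exp_integer_2pi[of "of_int z"] by (simp add: mult_ac)
qed

lemma e_p_mod: "p > 0 \<Longrightarrow> e_p p (z mod int p) = e_p p z"
  using e_p_add[of p "z mod int p" "int p * (z div int p)"] e_p_multiple[of p "z div int p"] by simp

lemma norm_e_p: "cmod (e_p p z) = 1"
proof -
  have "2 * complex_of_real pi * \<i> * of_int z / of_nat p = \<i> * complex_of_real (2 * pi * of_int z / of_nat p)"
    by simp
  then show ?thesis
    unfolding e_p_def by (simp only: norm_exp_i_times)
qed

lemma e_p_1_neq_1: "p > 1 \<Longrightarrow> e_p p 1 \<noteq> 1"
proof
  assume p: "p > 1" and "e_p p 1 = 1"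
  then have "\<exists>n::int. Im (2 * complex_of_real pi * \<i> / of_nat p) = of_int (2 * n) * pi"
    by (simp add: e_p_def exp_eq_1)
  then obtain n :: int where "2 * pi / real p = of_int (2 * n) * pi"
    by (auto simp: Im_divide_of_nat)
  then have "1 = of_int n * real p"
    using p by (simp add: field_simps)
  then have "1 = n * int p"
    by (metis of_int_1 of_int_eq_iff of_int_mult of_int_of_nat_eq)
  then have "int p dvd 1"
    by (metis dvd_triv_right)
  then show False
    using p by simp
qed

section \<open>Passage from residue rings to the field type\<close>

lemma mod_ring_of_int_mod: "(of_int (z mod int CARD('a)) :: 'a::prime_card mod_ring) = of_int z"
  unfolding of_int_of_int_mod_ring by transfer simp

lemma mod_ring_of_int_eq_iff:
  assumes "x \<in> {0..<int CARD('a)}" "y \<in> {0..<int CARD('a)}"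
  shows "(of_int x :: 'a::prime_card mod_ring) = of_int y \<longleftrightarrow> x = y"
proof
  assume "(of_int x :: 'a mod_ring) = of_int y"
  then have "to_int_mod_ring (of_int_mod_ring x :: 'a mod_ring) = to_int_mod_ring (of_int_mod_ring y :: 'a mod_ring)"
    by (simp only: of_int_of_int_mod_ring)
  moreover have "to_int_mod_ring (of_int_mod_ring z :: 'a mod_ring) = z" if "z \<in> {0..<int CARD('a)}" for z
    using that by simp
  ultimately show "x = y"
    using assms by metis
qed simp

lemma additive_character_e_p:
  "additive_character (\<lambda>z :: 'a::prime_card mod_ring. e_p CARD('a) (to_int_mod_ring z))"
proof
  have p: "CARD('a) > 1"
    using prime_card[where 'a = 'a] prime_gt_1_nat by blast
  show "e_p CARD('a) (to_int_mod_ring (x + y)) = e_p CARD('a) (to_int_mod_ring x) * e_p CARD('a) (to_int_mod_ring y)"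
    for x y :: "'a mod_ring"
    unfolding to_int_mod_ring_add using p by (simp add: e_p_mod e_p_add)
  show "cmod (e_p CARD('a) (to_int_mod_ring x)) = 1" for x :: "'a mod_ring"
    by (rule norm_e_p)
  have "e_p CARD('a) (to_int_mod_ring (1 :: 'a mod_ring)) \<noteq> 1"
    using e_p_1_neq_1[OF p] by simp
  then show "\<exists>x::'a mod_ring. e_p CARD('a) (to_int_mod_ring x) \<noteq> 1"
    by blast
qed

lemma e_p_of_int: "e_p CARD('a) (to_int_mod_ring (of_int z :: 'a::prime_card mod_ring)) = e_p CARD('a) z"
proof -
  have p: "CARD('a) > 0" by simp
  have "to_int_mod_ring (of_int z :: 'a mod_ring) = z mod int CARD('a)"
    unfolding of_int_of_int_mod_ring by transfer simp
  then show ?thesis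
    by (simp add: e_p_mod[OF p])
qed

context
  fixes R :: "int ring"
  assumes R: "R = Fp CARD('a::prime_card)"
begin

interpretation residues_prime "CARD('a)" R
  using prime_card[where 'a = 'a] by unfold_locales (simp_all add: R)

lemma of_int_nat_pow: "(of_int (x [^]\<^bsub>R\<^esub> (k :: nat)) :: 'a mod_ring) = of_int x ^ k"
proof (induction k)
  case 0
  then show ?case
    by (simp add: one_cong R residue_ring_def nat_pow_def)
next
  case (Suc k)
  have "x [^]\<^bsub>R\<^esub> Suc k = (x [^]\<^bsub>R\<^esub> k * x) mod int CARD('a)"
    by (simp add: R residue_ring_def nat_pow_def)
  then show ?case
    by (simp add: mod_ring_of_int_mod Suc mult.commute)
qed

text \<open>Polynomials are coefficient lists with the leading coefficient first, hence the reversed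
  index.\<close>

lemma of_int_eval:
  "(of_int (ring.eval R f x) :: 'a mod_ring) = (\<Sum>j<length f. of_int (f ! (length f - 1 - j)) * of_int x ^ j)"
proof (induction f)
  case (Cons a f)
  have "ring.eval R (a # f) x = ((a * (x [^]\<^bsub>R\<^esub> length f)) mod int CARD('a) + ring.eval R f x) mod int CARD('a)"
    by (simp add: res_add_eq res_mult_eq)
  then have "(of_int (ring.eval R (a # f) x) :: 'a mod_ring) = of_int a * of_int x ^ length f + of_int (ring.eval R f x)"
    by (simp add: mod_ring_of_int_mod of_int_nat_pow)
  also have "\<dots> = of_int a * of_int x ^ length f + (\<Sum>j<length f. of_int ((a # f) ! (length f - j)) * of_int x ^ j)"
    unfolding Cons by (intro arg_cong2[of _ _ _ _ "(+)"] refl sum.cong) (simp add: nth_Cons')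
  finally show ?case by simp
qed (simp add: res_zero_eq)

lemma subgroup_image:
  assumes G: "subgroup G (units_of R)"
  defines "G' \<equiv> of_int ` G :: 'a mod_ring set"
  shows "G \<subseteq> {0..<int CARD('a)}" "inj_on (of_int :: int \<Rightarrow> 'a mod_ring) G" "0 \<notin> G'" "G' \<noteq> {}"
    "u \<in> G' \<Longrightarrow> bij_betw (\<lambda>x. u * x) G' G'" "u \<in> G' \<Longrightarrow> u ^ card G' = 1"
proof -
  have units: "G \<subseteq> Units R"
    using subgroup.subset[OF G] by (simp add: units_of_def)
  have mult: "(x * y) mod int CARD('a) \<in> G" if "x \<in> G" "y \<in> G" for x y
    using subgroup.m_closed[OF G that] by (simp add: units_of_def R residue_ring_def)
  show sub: "G \<subseteq> {0..<int CARD('a)}"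
  proof
    fix x assume "x \<in> G"
    then have "x \<in> carrier R"
      using units by (auto simp: Units_def)
    then show "x \<in> {0..<int CARD('a)}"
      by (simp add: R residue_ring_def)
  qed
  then show "inj_on (of_int :: int \<Rightarrow> 'a mod_ring) G"
    by (intro inj_onI) (metis mod_ring_of_int_eq_iff subsetD)
  show zero: "0 \<notin> G'"
  proof
    assume "0 \<in> G'"
    then obtain x where x: "x \<in> G" "(of_int x :: 'a mod_ring) = 0"
      by (auto simp: G'_def)
    then obtain y where "(x * y) mod int CARD('a) = 1"
      using units unfolding Units_def by (auto simp: R residue_ring_def)
    then have "(of_int (x * y) :: 'a mod_ring) = 1"
      by (metis mod_ring_of_int_mod of_int_1)
    then show False
      using x by simp
  qed
  show "G' \<noteq> {}"
    using subgroup.one_closed[OF G] by (auto simp: G'_def)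
  have closed: "u * x \<in> G'" if ux: "u \<in> G'" "x \<in> G'" for u x
  proof -
    obtain a b where "a \<in> G" "b \<in> G" "u = of_int a" "x = of_int b"
      using ux by (auto simp: G'_def)
    then have "u * x = of_int ((a * b) mod int CARD('a))" "(a * b) mod int CARD('a) \<in> G"
      using mult by (simp_all add: mod_ring_of_int_mod)
    then show ?thesis
      by (simp add: G'_def)
  qed
  show bij: "bij_betw (\<lambda>x. u * x) G' G'" if "u \<in> G'" for u
  proof -
    have "u \<noteq> 0" using that zero by auto
    then have "inj_on (\<lambda>x. u * x) G'"
      by (simp add: inj_on_def)
    moreover have "(\<lambda>x. u * x) ` G' \<subseteq> G'"
      using closed[OF that] by auto
    ultimately show ?thesis
      by (simp add: bij_betw_def endo_inj_surj)
  qed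
  show "u ^ card G' = 1" if "u \<in> G'" for u
  proof -
    \<comment> \<open>Multiplication by u permutes G', so the product of all elements picks up the
      factor u ^ card G'; being nonzero, the product cancels.\<close>
    have "(\<Prod>x\<in>G'. x) = (\<Prod>x\<in>G'. u * x)"
      by (rule prod.reindex_bij_betw[OF bij[OF that], symmetric])
    also have "\<dots> = u ^ card G' * (\<Prod>x\<in>G'. x)"
      by (simp add: prod.distrib)
    finally have "(u ^ card G' - 1) * (\<Prod>x\<in>G'. x) = 0"
      by (simp add: algebra_simps)
    moreover have "(\<Prod>x\<in>G'. x) \<noteq> 0"
      using zero by (simp add: prod_zero_iff)
    ultimately show ?thesis
      by simp
  qed
qed

lemma card_prime_bound:
  assumes n: "n \<ge> 1" and \<epsilon>: "\<epsilon> > 0"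
    and f: "f \<in> carrier (poly_ring R)" "Polynomials.degree f = n"
    and G: "subgroup G (units_of R)"
    and card: "real (card G) \<ge> real CARD('a) powr (3 / 7 + \<epsilon>)"
  shows "cmod (\<Sum>x\<in>G. e_p CARD('a) (ring.eval R f x))
    \<le> bound_const n * real (card G) * real CARD('a) powr (- eta \<epsilon> n)"
proof -
  define p where "p = CARD('a)"
  define \<psi> where "\<psi> = (\<lambda>z :: 'a mod_ring. e_p p (to_int_mod_ring z))"
  define G' where "G' = (of_int ` G :: 'a mod_ring set)"
  define a where "a = (\<lambda>j. of_int (f ! (n - j)) :: 'a mod_ring)"
  note Gp = subgroup_image[OF G, folded G'_def]
  have p: "p > 1"
    unfolding p_def using prime_card[where 'a = 'a] prime_gt_1_nat by blast
  have card_eq: "card G' = card G"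
    unfolding G'_def by (rule card_image[OF Gp(2)])
  have fin: "finite G"
    using Gp(1) finite_subset by blast
  \<comment> \<open>A subgroup has fewer than p elements, so its assumed size forces \<epsilon> <
    4/7, the range in which the exponents behave well.\<close>
  have "card G' \<le> card (UNIV - {0 :: 'a mod_ring})"
    using Gp(3) by (intro card_mono) auto
  then have "card G < p"
    using p by (simp add: card_eq p_def card_Diff_singleton)
  then have "real p powr (3 / 7 + \<epsilon>) < real p powr 1"
    using card p by (simp add: p_def)
  then have \<epsilon>': "\<epsilon> < 4 / 7"
    using p by (subst (asm) powr_less_cancel_iff) auto
  have eta: "0 < eta \<epsilon> n" "eta \<epsilon> n \<le> 1"
    using eta_pos[OF \<epsilon> \<epsilon>'] eta_le[OF \<epsilon> \<epsilon>' n] \<epsilon>' by auto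
  have len: "length f = n + 1" and hd: "hd f \<in> {0..<int CARD('a)}" "hd f \<noteq> 0"
  proof -
    have "f \<noteq> []" using f(2) n by auto
    then have "hd f \<in> carrier R" "hd f \<noteq> \<zero>\<^bsub>R\<^esub>" "length f = n + 1"
      using f unfolding univ_poly_carrier[symmetric] polynomial_def by auto
    then show "length f = n + 1" "hd f \<in> {0..<int CARD('a)}" "hd f \<noteq> 0"
      by (auto simp: R residue_ring_def)
  qed
  have an: "a n \<noteq> 0"
  proof -
    have "f ! 0 = hd f"
      using len by (cases f) auto
    then show ?thesis
      using mod_ring_of_int_eq_iff[of "hd f" 0, where 'a = 'a] hd by (simp add: a_def)
  qed
  interpret additive_character \<psi>
    unfolding \<psi>_def p_def by (rule additive_character_e_p)
  have S: "cmod (\<Sum>x\<in>G. e_p p (ring.eval R f x)) = cmod (char_sum G' {1..n} a)"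
  proof -
    have "(\<Sum>x\<in>G. e_p p (ring.eval R f x)) = (\<Sum>x\<in>G. \<psi> (\<Sum>j\<le>n. a j * of_int x ^ j))"
    proof (intro sum.cong refl)
      fix x
      have "(of_int (ring.eval R f x) :: 'a mod_ring) = (\<Sum>j\<le>n. a j * of_int x ^ j)"
        unfolding of_int_eval len a_def by (simp add: lessThan_Suc_atMost)
      then show "e_p p (ring.eval R f x) = \<psi> (\<Sum>j\<le>n. a j * of_int x ^ j)"
        unfolding \<psi>_def p_def by (metis e_p_of_int)
    qed
    also have "\<dots> = (\<Sum>z\<in>G'. \<psi> (\<Sum>j\<le>n. a j * z ^ j))"
      unfolding G'_def by (rule sum.reindex[OF Gp(2), symmetric, unfolded o_def])
    \<comment> \<open>The constant term of f comes out as a factor of absolute value 1, leaving the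
      exponents 1 to n.\<close>
    also have "\<dots> = (\<Sum>z\<in>G'. \<psi> (a 0) * \<psi> (lin {1..n} a (pow1 z)))"
    proof (intro sum.cong refl)
      fix z
      have "(\<Sum>j\<le>n. a j * z ^ j) = a 0 + lin {1..n} a (pow1 z)"
        by (simp add: lin_def pow1_def sum.atMost_shift sum.atLeast1_atMost_eq)
      then show "\<psi> (\<Sum>j\<le>n. a j * z ^ j) = \<psi> (a 0) * \<psi> (lin {1..n} a (pow1 z))"
        by (simp add: \<psi>_add)
    qed
    finally show ?thesis
      by (simp add: char_sum_def norm_mult norm_\<psi> flip: sum_distrib_left)
  qed
  have base: "0 \<le> (2 * (28 * real n ^ 11)\<^sup>2) ^ n" by simp
  show ?thesis
  proof (cases "n\<^sup>2 + 6 < p")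
    case True
    interpret subgroup_sums \<psi> G' n
      by unfold_locales (use Gp(4-6) n True in \<open>simp_all add: p_def\<close>)
    have "3 / 7 + \<epsilon> \<le> t"
    proof -
      have "P powr (3 / 7 + \<epsilon>) \<le> P powr t"
        using card unfolding card_G[symmetric] card_eq by (simp add: P_def)
      then show ?thesis
        using P_gt_1 by simp
    qed
    then have "cmod (char_sum G' {1..n} a) \<le> (2 * c\<^sup>2) ^ n * P powr (t - eta \<epsilon> n)"
      using n an by (intro main_bound \<epsilon> \<epsilon>') auto
    also have "P powr (t - eta \<epsilon> n) = real (card G) * real p powr (- eta \<epsilon> n)"
      using card_G by (simp add: card_eq powr_diff powr_minus divide_inverse P_def p_def)
    also have "(2 * c\<^sup>2) ^ n * (real (card G) * real p powr (- eta \<epsilon> n))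
        \<le> bound_const n * (real (card G) * real p powr (- eta \<epsilon> n))"
      by (intro mult_right_mono) (simp_all add: bound_const_def c_def)
    finally show ?thesis
      using S by (simp add: p_def mult.assoc)
  next
    case False
    have "real p powr eta \<epsilon> n \<le> real p powr 1"
      using eta p by (intro powr_mono) auto
    also have "\<dots> = real p"
      using p by simp
    also have "\<dots> \<le> real (n\<^sup>2 + 6)"
      using False by (simp only: of_nat_le_iff not_less)
    also have "\<dots> \<le> bound_const n"
      using base by (simp add: bound_const_def)
    finally have "1 \<le> bound_const n * real p powr (- eta \<epsilon> n)"
      using p by (simp add: powr_minus field_simps)
    then have "real (card G) * 1 \<le> real (card G) * (bound_const n * real p powr (- eta \<epsilon> n))"
      by (intro mult_left_mono) auto
    then show ?thesis
      using S norm_char_sum_le[of G' "{1..n}" a] by (simp add: p_def card_eq mult_ac)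
  qed
qed

end

text \<open>
  The argument needs a type whose cardinality is a given prime, while types cannot depend on
  variables. A closed term denoting a potential counterexample does the job: were the bound to fail
  for some prime, it would fail for \<open>bad_prime\<close>.
\<close>

definition violates :: "nat \<Rightarrow> bool" where
  "violates p \<longleftrightarrow> Factorial_Ring.prime p \<and> (\<exists>n \<epsilon> f G. n \<ge> 1 \<and> \<epsilon> > 0 \<and>
    f \<in> carrier (poly_ring (Fp p)) \<and> Polynomials.degree f = n \<and> subgroup G (units_of (Fp p)) \<and>
    real (card G) \<ge> real p powr (3 / 7 + \<epsilon>) \<and>
    \<not> cmod (\<Sum>x\<in>G. e_p p (ring.eval (Fp p) f x)) \<le> bound_const n * real (card G) * real p powr (- eta \<epsilon> n))"

definition bad_prime :: nat where
  "bad_prime = (if \<exists>p. violates p then SOME p. violates p else 2)"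

lemma violates_bad_prime: "violates p \<Longrightarrow> violates bad_prime"
  unfolding bad_prime_def by (auto intro: someI)

lemma prime_bad_prime: "Factorial_Ring.prime bad_prime"
proof (cases "\<exists>p. violates p")
  case True
  then have "violates bad_prime"
    using violates_bad_prime by blast
  then show ?thesis
    by (simp only: violates_def)
qed (simp add: bad_prime_def)

typedef bad_index = "{..<bad_prime}"
  using prime_bad_prime prime_gt_0_nat by blast

lemma card_bad_index: "CARD(bad_index) = bad_prime"
  using type_definition.card[OF type_definition_bad_index] by simp

instance bad_index :: prime_card
  by standard (simp add: card_bad_index prime_bad_prime)

lemma not_violates: "\<not> violates p"
proof
  assume "violates p"
  then have "violates bad_prime" by (rule violates_bad_prime)
  then show False
    unfolding violates_def
    using card_prime_bound[OF refl, where 'a = bad_index, unfolded card_bad_index] by blast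
qed

theorem theorem1p1:
  fixes n :: nat and \<epsilon> :: real
  assumes "n \<ge> 1" and "\<epsilon> > 0"
  shows "\<exists>C::real. C > 0 \<and>
    (\<forall>(p::nat) f G. Factorial_Ring.prime p \<longrightarrow>
       f \<in> carrier (poly_ring (Fp p)) \<longrightarrow> Polynomials.degree f = n \<longrightarrow>
       subgroup G (units_of (Fp p)) \<longrightarrow>
       real (card G) \<ge> real p powr (3 / 7 + \<epsilon>) \<longrightarrow>
       cmod (\<Sum>x\<in>G. e_p p (ring.eval (Fp p) f x))
         \<le> C * real (card G) * real p powr (- eta \<epsilon> n))"
proof (intro exI[of _ "bound_const n"] conjI allI impI)
  have "0 \<le> (2 * (28 * real n ^ 11)\<^sup>2) ^ n" "0 \<le> real n ^ 2"
    by simp_all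
  then show "bound_const n > 0"
    unfolding bound_const_def by linarith
next
  fix p f G
  assume "Factorial_Ring.prime p" "f \<in> carrier (poly_ring (Fp p))" "Polynomials.degree f = n"
    "subgroup G (units_of (Fp p))" "real p powr (3 / 7 + \<epsilon>) \<le> real (card G)"
  then show "cmod (\<Sum>x\<in>G. e_p p (ring.eval (Fp p) f x)) \<le> bound_const n * real (card G) * real p powr (- eta \<epsilon> n)"
    using assms not_violates[of p] unfolding violates_def by blast
qed

end
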